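(* For any $n\ge 2$, the planar $(n+1)$-body problem has parabolic-bounded motions. Precisely: for any $n\ge2$ there is a nonempty open set of masses $(m_0,\dots,m_n)\in(0,\infty)^{n+1}$ for which the planar $(n+1)$-body problem $$m_i\ddot q_i=\sum_{0\le j\le n,\ j\ne i}m_im_j\frac{q_j-q_i}{\|q_j-q_i\|^3},\qquad q_i(t)\in\mathbb R^2,\quad i=0,\dots,n,$$ has solutions defined for all $t\ge 0$ such that the relative position of one of the bodies with respect to the center of mass of the others goes to infinity with velocity tending to zero as $t\to+\infty$, while the relative positions of the rest of the bodies around their center of mass evolve in a bounded motion.
   Context: Explicitly, labelling the escaping body by $n$ and writing $c(t)=\sum_{i=0}^{n-1}m_iq_i(t)/\sum_{i=0}^{n-1}m_i$, a parabolic-bounded motion is a solution defined for all $t\ge0$ (no collisions or other singularities) with $\|q_n(t)-c(t)\|\to\infty$, $\frac{d}{dt}(q_n-c)(t)\to0$ as $t\to+\infty$, and $\sup_{t\ge0}\|q_i(t)-c(t)\|<\infty$ for $i=0,\dots,n-1$. *)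

theory Defs
  imports "HOL-Analysis.Analysis"
begin

text \<open>
  Bodies are labelled by natural numbers; a mass vector is a function on labels, and a motion
  \<open>q\<close> assigns to each label a curve in the plane.
\<close>

definition gravitational_force ::
    "nat \<Rightarrow> (nat \<Rightarrow> real) \<Rightarrow> (nat \<Rightarrow> real^2) \<Rightarrow> nat \<Rightarrow> real^2" where
  "gravitational_force n m x i =
     (\<Sum>j\<in>{..n} - {i}. (m i * m j / norm (x j - x i) ^ 3) *\<^sub>R (x j - x i))"

text \<open>
  A collision-free motion of the bodies \<open>0, \<dots>, n\<close> on the closed half-line \<open>t \<ge> 0\<close>, with \<open>v\<close> its
  velocities; derivatives at \<open>t = 0\<close> are one-sided. Freedom from collisions is demanded
  explicitly, since division by zero would otherwise make the force defined at collisions too.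
\<close>

definition nbody_solution ::
    "nat \<Rightarrow> (nat \<Rightarrow> real) \<Rightarrow> (nat \<Rightarrow> real \<Rightarrow> real^2) \<Rightarrow> bool" where
  "nbody_solution n m q \<longleftrightarrow>
     (\<forall>t\<ge>0. \<forall>i\<le>n. \<forall>j\<le>n. i \<noteq> j \<longrightarrow> q i t \<noteq> q j t) \<and>
     (\<exists>v a. \<forall>t\<ge>0. \<forall>i\<le>n.
        (q i has_vector_derivative v i t) (at t within {0..}) \<and>
        (v i has_vector_derivative a i t) (at t within {0..}) \<and>
        m i *\<^sub>R a i t = gravitational_force n m (\<lambda>j. q j t) i)"

definition center_of_mass ::
    "nat \<Rightarrow> (nat \<Rightarrow> real) \<Rightarrow> (nat \<Rightarrow> real \<Rightarrow> real^2) \<Rightarrow> real \<Rightarrow> real^2" where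
  "center_of_mass n m q t = (\<Sum>i<n. m i *\<^sub>R q i t) /\<^sub>R (\<Sum>i<n. m i)"

text \<open>The escaping body carries the label \<open>n\<close>; the other bodies are \<open>0, \<dots>, n - 1\<close>.\<close>

definition parabolic_bounded_motion ::
    "nat \<Rightarrow> (nat \<Rightarrow> real) \<Rightarrow> (nat \<Rightarrow> real \<Rightarrow> real^2) \<Rightarrow> bool" where
  "parabolic_bounded_motion n m q \<longleftrightarrow>
     nbody_solution n m q \<and>
     filterlim (\<lambda>t. norm (q n t - center_of_mass n m q t)) at_top at_top \<and>
     ((\<lambda>t. vector_derivative (\<lambda>s. q n s - center_of_mass n m q s) (at t)) \<longlongrightarrow> 0) at_top \<and>
     (\<forall>i<n. bounded ((\<lambda>t. q i t - center_of_mass n m q t) ` {0..}))"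

end

(*
  The bodies 0, ..., n - 1 are kept close to a uniformly rotating collinear central configuration
  (Moulton), which exists for all masses as a minimizer of an energy on ordered configurations,
  and the body n follows the radial parabolic orbit r = kappa t^(2/3), up to bounded corrections.
  Since the tidal force of a body of mass m_n at this distance is of order m_n t^(-2), the motion is
  found as a fixed point of the integral equations on a half-line [T, oo).

  The linearization at the relative equilibrium splits along the eigenvectors of the attraction
  between the bodies, whose eigenvalues other than 0 and 1 exceed 1 (Conley), into planar blocks with one
  hyperbolic pair and one elliptic pair of exponents, plus the Kepler block. Unstable and elliptic
  components are integrated from infinity and stay of size m_n t^(-1). The rotation angle is treated
  as a variable of its own, integrated from T and allowed to drift: it enters the
  equations only through the tidal terms, so that smallness of m_n makes the iteration contract.
  All constants are uniform for masses m_i in (1, 2), i < n, which gives an open set of masses.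
*)
theory Submission
  imports Defs "HOL-Real_Asymp.Real_Asymp"
begin

section \<open>The attraction kernel\<close>

text \<open>The obstacle is the neutral part of the Kepler block. A tidal force of order
  \<open>t^(-2)\<close> shifts the angular momentum \<open>Ang\<close> by order
  \<open>t^(-1)\<close>, hence also the angular speed, and this is not integrable: the angle cannot
  be prescribed at infinity, and two candidate motions may drift apart in phase. So the iteration
  does not contract in the norms of the balls that it preserves, and two families of weights,
  \<open>wt\<close> and \<open>wt'\<close>, are used. The couplings form a cycle. A phase error
  enters the outer orbit with a coefficient of order one; phase and outer errors enter the shape of
  the inner configuration only with the factor \<open>mn\<close>; a shape error enters the phase
  with order one. A large weight \<open>Bo\<close> on the outer modes and a small weight
  \<open>Bu\<close> on the shape modes absorb the order-one links, and \<open>mn\<close> is then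
  chosen small relative to both. The self-coupling of the shape is quadratic and is controlled by
  the radius \<open>ru\<close>. After diagonalization each mode obeys a scalar equation
  \<open>y' = (a + p/t) y + f\<close>. Comparing all propagators with powers of \<open>t\<close>
  lets hyperbolic, elliptic and outer modes share one estimate.\<close>

definition kern :: "complex \<Rightarrow> complex" where
  "kern z = z /\<^sub>R norm z ^ 3"

text \<open>This is the derivative of \<open>kern\<close> at 1: multiplication by -2 along the real
  axis and by 1 across it.\<close>

definition kern_lin :: "complex \<Rightarrow> complex" where
  "kern_lin w = w - of_real (3 * Re w)"

lemma kern_lin_diff: "kern_lin (u - v) = kern_lin u - kern_lin v"
  by (simp add: kern_lin_def algebra_simps)

lemma norm_kern_lin: "norm (kern_lin w) \<le> 2 * norm w"
proof -
  have "(norm (kern_lin w))\<^sup>2 = 4 * (Re w)\<^sup>2 + (Im w)\<^sup>2"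
    unfolding cmod_power2 by (simp add: kern_lin_def power2_eq_square algebra_simps)
  also have "\<dots> \<le> (2 * norm w)\<^sup>2"
    by (simp add: cmod_power2 power_mult_distrib)
  finally have "(norm (kern_lin w))\<^sup>2 \<le> (2 * norm w)\<^sup>2" .
  then show ?thesis by (rule power2_le_imp_le) simp
qed

text \<open>The factor \<open>r\<close> may be negative, so a signed difference of collinear
  positions can be pulled out whatever the order of the bodies. Every later estimate is thereby
  reduced to \<open>kern\<close> near 1.\<close>

lemma kern_scale:
  "kern (of_real r * w) = of_real (sgn r / r\<^sup>2) * kern w"
  by (cases "r = 0")
    (auto simp: kern_def norm_mult power_mult_distrib scaleR_conv_of_real field_simps
      power2_eq_square power3_eq_cube sgn_real_def)

lemma kern_cis: "kern (cis a * w) = cis a * kern w"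
  by (simp add: kern_def norm_mult)

lemma kern_minus: "kern (- w) = - kern w"
  by (simp add: kern_def)

lemma continuous_on_kern [continuous_intros]:
  assumes "continuous_on S f" "\<And>s. s \<in> S \<Longrightarrow> f s \<noteq> 0"
  shows "continuous_on S (\<lambda>s. kern (f s))"
  unfolding kern_def using assms by (intro continuous_intros) auto

lemma has_derivative_kern:
  assumes "z \<noteq> 0"
  shows "(kern has_derivative (\<lambda>v. v /\<^sub>R norm z ^ 3 - (3 * (z \<bullet> v) / norm z ^ 5) *\<^sub>R z)) (at z within S)"
proof -
  have "((\<lambda>z. z /\<^sub>R norm z ^ 3) has_derivative
      (\<lambda>v. v /\<^sub>R norm z ^ 3 - (3 * (z \<bullet> v) / norm z ^ 5) *\<^sub>R z)) (at z within S)"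
    using assms
    by (auto intro!: derivative_eq_intros
        has_derivative_at_withinI[OF has_derivative_norm]
        simp: fun_eq_iff field_simps sgn_div_norm inner_commute power_eq_if)
  then show ?thesis by (simp add: kern_def [abs_def])
qed

text \<open>The derivatives of \<open>kern\<close> at \<open>1 + u\<close> and at 1 are compared
  term by term through the modulus, which differs from 1 by at most \<open>norm u\<close>. The four
  contributions 40, 336, 5 and 3 are rounded up to 400.\<close>

lemma kern_deriv_lipschitz:
  assumes "norm u \<le> 1/2"
  shows "norm ((v /\<^sub>R norm (1 + u) ^ 3 - (3 * ((1 + u) \<bullet> v) / norm (1 + u) ^ 5) *\<^sub>R (1 + u)) - kern_lin v)
          \<le> 400 * norm u * norm v"
proof -
  define z where "z = 1 + u"
  define n where "n = norm z"
  have n1: "\<bar>n - 1\<bar> \<le> norm u"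
    using norm_triangle_ineq3[of z 1] by (simp add: n_def z_def)
  have n: "1/2 \<le> n" "n \<le> 3/2" using n1 assms by linarith+
  have le: "n ^ 2 \<le> 9/4" "n ^ 3 \<le> 27/8" "n ^ 4 \<le> 81/16"
    using power_mono[OF n(2), of 2] power_mono[OF n(2), of 3] power_mono[OF n(2), of 4] n
    by (auto simp: power_divide)
  have "(1/2)^3 \<le> n ^ 3" using n by (intro power_mono) auto
  then have ge: "1/8 \<le> n ^ 3" by (simp add: power_divide)
  have iv: "1 / n ^ 3 \<le> 8" using ge n by (simp add: field_simps)
  have a: "\<bar>1 / n ^ 3 - 1\<bar> \<le> 40 * norm u"
  proof -
    have "1 / n ^ 3 - 1 = (1 - n) * ((n^2 + n + 1) * (1 / n ^ 3))"
      using n by (simp add: field_simps power3_eq_cube power2_eq_square)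
    also have "\<bar>\<dots>\<bar> \<le> norm u * (5 * 8)"
      unfolding abs_mult using n n1 le iv by (intro mult_mono) auto
    finally show ?thesis by simp
  qed
  \<comment> \<open>The factor \<open>n ^ 2\<close> is kept because the radial term contains
    \<open>z\<close> twice, once in the inner product and once as a vector.\<close>
  have b: "n ^ 2 * \<bar>1 / n ^ 5 - 1\<bar> \<le> 112 * norm u"
  proof -
    have "n^2 * (1 / n ^ 5 - 1) = (1 - n) * ((n^4 + n^3 + n^2 + n + 1) * (1 / n ^ 3))"
      using n by (simp add: field_simps power_eq_if)
    then have "n^2 * \<bar>1 / n ^ 5 - 1\<bar> = \<bar>(1 - n) * ((n^4 + n^3 + n^2 + n + 1) * (1 / n ^ 3))\<bar>"
      using n by (metis abs_mult abs_power2)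
    also have "\<dots> \<le> norm u * (14 * 8)"
      unfolding abs_mult using n n1 le iv by (intro mult_mono) auto
    finally show ?thesis by simp
  qed
  have zv: "\<bar>z \<bullet> v\<bar> \<le> n * norm v" using Cauchy_Schwarz_ineq2[of z v] by (simp add: n_def)
  have lin: "kern_lin v = v - (3 * (1 \<bullet> v)) *\<^sub>R 1"
    by (simp add: kern_lin_def inner_complex_def scaleR_conv_of_real)
  have eq: "(v /\<^sub>R n ^ 3 - (3 * (z \<bullet> v) / n ^ 5) *\<^sub>R z) - kern_lin v
     = (1 / n ^ 3 - 1) *\<^sub>R v - (3 * (z \<bullet> v) * (1 / n ^ 5 - 1)) *\<^sub>R z
       - ((3 * (z \<bullet> v)) *\<^sub>R u + (3 * (u \<bullet> v)) *\<^sub>R 1)"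
    unfolding lin z_def by (simp add: algebra_simps inverse_eq_divide inner_add_left add_divide_distrib scaleR_add_left)
  have t1: "norm ((1 / n ^ 3 - 1) *\<^sub>R v) \<le> 40 * norm u * norm v"
    using a by (simp add: mult_right_mono)
  have t2: "norm ((3 * (z \<bullet> v) * (1 / n ^ 5 - 1)) *\<^sub>R z) \<le> 336 * norm u * norm v"
  proof -
    have "norm ((3 * (z \<bullet> v) * (1 / n ^ 5 - 1)) *\<^sub>R z) = 3 * \<bar>z \<bullet> v\<bar> * \<bar>1 / n ^ 5 - 1\<bar> * n"
      by (simp add: abs_mult n_def)
    also have "\<dots> \<le> 3 * (n * norm v) * \<bar>1 / n ^ 5 - 1\<bar> * n"
      using zv n by (intro mult_right_mono mult_left_mono) auto
    also have "\<dots> = 3 * norm v * (n^2 * \<bar>1 / n ^ 5 - 1\<bar>)"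
      by (simp add: power2_eq_square)
    also have "\<dots> \<le> 3 * norm v * (112 * norm u)"
      using b by (intro mult_left_mono) auto
    finally show ?thesis by (simp add: algebra_simps)
  qed
  have t3: "norm ((3 * (z \<bullet> v)) *\<^sub>R u) \<le> 5 * norm u * norm v"
  proof -
    have "norm ((3 * (z \<bullet> v)) *\<^sub>R u) = 3 * \<bar>z \<bullet> v\<bar> * norm u" by (simp add: abs_mult)
    also have "\<dots> \<le> 3 * (3/2 * norm v) * norm u"
      using zv n mult_right_mono[OF n(2), of "norm v"] by (intro mult_right_mono mult_left_mono) auto
    also have "\<dots> \<le> 5 * norm u * norm v" by (simp add: algebra_simps)
    finally show ?thesis .
  qed
  have t4: "norm ((3 * (u \<bullet> v)) *\<^sub>R (1::complex)) \<le> 3 * norm u * norm v"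
    using Cauchy_Schwarz_ineq2[of u v] by (simp add: abs_mult)
  have "norm ((v /\<^sub>R n ^ 3 - (3 * (z \<bullet> v) / n ^ 5) *\<^sub>R z) - kern_lin v) \<le> 400 * norm u * norm v"
    unfolding eq
    apply (rule order_trans[OF norm_triangle_ineq4])
    using norm_triangle_ineq4[of "(1 / n ^ 3 - 1) *\<^sub>R v" "(3 * (z \<bullet> v) * (1 / n ^ 5 - 1)) *\<^sub>R z"]
      norm_triangle_ineq[of "(3 * (z \<bullet> v)) *\<^sub>R u" "(3 * (u \<bullet> v)) *\<^sub>R (1::complex)"]
      t1 t2 t3 t4 mult_nonneg_nonneg[OF norm_ge_zero[of u] norm_ge_zero[of v]] by linarith
  then show ?thesis by (simp add: n_def z_def)
qed

text \<open>Mean value inequality for \<open>kern (1 + z) - kern_lin z\<close> on the ball of radius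
  \<open>r\<close>, where the derivative is of order \<open>r\<close>. Stated for differences, it
  yields both the size of the quadratic remainder and a Lipschitz constant proportional to the
  displacement, which is what a contraction needs.\<close>

lemma kern_expansion:
  assumes u: "norm u \<le> r" and v: "norm v \<le> r" and r: "r \<le> 1/2"
  shows "norm (kern (1 + u) - kern (1 + v) - kern_lin (u - v)) \<le> 400 * r * norm (u - v)"
proof -
  define g where "g z = kern (1 + z) - kern_lin z" for z
  define g' where "g' = (\<lambda>z v. (v /\<^sub>R norm (1 + z) ^ 3
      - (3 * ((1 + z) \<bullet> v) / norm (1 + z) ^ 5) *\<^sub>R (1 + z)) - kern_lin v)"
  have bl: "bounded_linear kern_lin"
    unfolding kern_lin_def
    by (intro bounded_linear_sub bounded_linear_ident bounded_linear_compose[OF bounded_linear_of_real]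
        bounded_linear_const_mult bounded_linear_Re)
  have d: "(g has_derivative g' z) (at z within cball 0 r)" if "z \<in> cball 0 r" for z
  proof -
    have nz: "1 + z \<noteq> 0"
    proof
      assume "1 + z = 0"
      then have "z = -1" by (simp add: eq_neg_iff_add_eq_0 add.commute)
      then show False using that r by simp
    qed
    have "((\<lambda>z. kern (1 + z)) has_derivative (\<lambda>v. v /\<^sub>R norm (1 + z) ^ 3
      - (3 * ((1 + z) \<bullet> v) / norm (1 + z) ^ 5) *\<^sub>R (1 + z))) (at z within cball 0 r)"
      by (rule has_derivative_compose[of "\<lambda>z. 1 + z" "\<lambda>v. v", OF _ has_derivative_kern[OF nz]])
        (auto intro!: derivative_eq_intros)
    then show ?thesis unfolding g_def[abs_def] g'_def
      by (intro has_derivative_diff bounded_linear.has_derivative[OF bl] has_derivative_ident)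
  qed
  have on: "onorm (g' z) \<le> 400 * r" if "z \<in> cball 0 r" for z
  proof (rule onorm_bound)
    show "0 \<le> 400 * r" using u norm_ge_zero[of u] by linarith
    fix v
    have "norm (g' z v) \<le> 400 * norm z * norm v"
      unfolding g'_def using that r by (intro kern_deriv_lipschitz) auto
    also have "\<dots> \<le> 400 * r * norm v" using that by (intro mult_right_mono) auto
    finally show "norm (g' z v) \<le> 400 * r * norm v" .
  qed
  have "norm (g u - g v) \<le> 400 * r * norm (u - v)"
    by (rule differentiable_bound[OF convex_cball d on]) (use u v in auto)
  then show ?thesis by (simp add: g_def kern_lin_diff algebra_simps)
qed

text \<open>Here 202 is \<open>400 / 2 + 2\<close>: the expansion at radius one half plus the norm
  bound for \<open>kern_lin\<close>.\<close>

lemma kern_lipschitz: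
  assumes "norm u \<le> 1/2" "norm v \<le> 1/2"
  shows "norm (kern (1 + u) - kern (1 + v)) \<le> 202 * norm (u - v)"
proof -
  have "norm (kern (1 + u) - kern (1 + v)) \<le> norm (kern (1 + u) - kern (1 + v) - kern_lin (u - v)) + norm (kern_lin (u - v))"
    by (metis diff_add_cancel norm_triangle_ineq)
  then show ?thesis
    using kern_expansion[OF assms order_refl] norm_kern_lin[of "u - v"] by linarith
qed

section \<open>Systems with dichotomies and power weights\<close>

text \<open>The solution \<open>e^(a t) t^p\<close> of \<open>y' = (a + p/t) y\<close>. Inner modes
  contribute the exponential, outer modes the power; a single \<open>exp\<close> makes it visibly
  nonzero.\<close>

definition propagator :: "complex \<Rightarrow> real \<Rightarrow> real \<Rightarrow> complex" where
  "propagator a p t = exp (a * of_real t + of_real (p * ln t))"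

lemma propagator_nonzero [simp]: "propagator a p t \<noteq> 0"
  by (simp add: propagator_def)

lemma continuous_on_propagator:
  "0 < T \<Longrightarrow> continuous_on {T..} (propagator a p)"
  unfolding propagator_def by (intro continuous_intros) auto

lemma propagator_has_derivative:
  assumes "0 < t"
  shows "(propagator a p has_vector_derivative (a + of_real (p / t)) * propagator a p t) (at t within S)"
proof -
  have "((\<lambda>t. a * of_real t + of_real (p * ln t)) has_vector_derivative (a + of_real (p / t))) (at t within S)"
    using assms
    by (auto intro!: derivative_eq_intros has_vector_derivative_of_real
        simp: has_real_derivative_iff_has_vector_derivative[symmetric])
  from field_vector_diff_chain_within[OF this, of exp "exp (a * of_real t + of_real (p * ln t))"]
  show ?thesis
    unfolding propagator_def [abs_def] o_def
    by (simp add: DERIV_exp has_field_derivative_at_within)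
qed

text \<open>
  Two ways of solving \<open>y' = (a + p/t) y + f\<close>: integration from the initial time \<open>T\<close>
  (\<open>d\<close> true), or from infinity (\<open>d\<close> false).
\<close>

definition duhamel :: "bool \<Rightarrow> complex \<Rightarrow> real \<Rightarrow> real \<Rightarrow> (real \<Rightarrow> complex) \<Rightarrow> real \<Rightarrow> complex" where
  "duhamel d a p T f t = propagator a p t *
     (if d then integral {T..t} (\<lambda>s. f s / propagator a p s)
      else - integral {t..} (\<lambda>s. f s / propagator a p s))"

text \<open>Only a power bound is asked for, and only in the direction of integration. It is exact
  for purely algebraic modes, has exponent 0 for oscillating ones, and is a weakening of exponential
  bounds for hyperbolic ones.\<close>

definition dichotomy :: "bool \<Rightarrow> complex \<Rightarrow> real \<Rightarrow> real \<Rightarrow> real \<Rightarrow> bool" where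
  "dichotomy d a p T e \<longleftrightarrow> (\<forall>s t. T \<le> s \<longrightarrow> T \<le> t \<longrightarrow> (if d then s \<le> t else t \<le> s) \<longrightarrow>
     norm (propagator a p t / propagator a p s) \<le> (t / s) powr e)"

lemma powr_has_integral:
  fixes t T c :: real
  assumes "0 < T" "T \<le> t" "c \<noteq> 0"
  shows "((\<lambda>s. s powr (c - 1)) has_integral (t powr c - T powr c) / c) {T..t}"
proof -
  have "((\<lambda>s. s powr (c - 1)) has_integral t powr c / c - T powr c / c) {T..t}"
    by (rule fundamental_theorem_of_calculus)
      (use assms in \<open>auto intro!: derivative_eq_intros
        simp: has_real_derivative_iff_has_vector_derivative[symmetric]\<close>)
  then show ?thesis by (simp add: diff_divide_distrib)
qed

context
  fixes a :: complex and p T e g A :: real and f :: "real \<Rightarrow> complex"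
  assumes T: "0 < T"
    and f: "continuous_on {T..} f"
    and fb: "\<And>s. T \<le> s \<Longrightarrow> norm (f s) \<le> A * s powr (g - 1)"
begin

lemma integrand_continuous: "continuous_on {T..} (\<lambda>s. f s / propagator a p s)"
  using f continuous_on_propagator[OF T] by (intro continuous_intros) auto

lemma forward_integrable: "T \<le> t \<Longrightarrow> (\<lambda>s. f s / propagator a p s) integrable_on {T..t}"
  by (intro integrable_continuous_interval continuous_on_subset[OF integrand_continuous]) auto

lemma propagated_bound:
  assumes "dichotomy d a p T e" "T \<le> s" "T \<le> t" "if d then s \<le> t else t \<le> s"
  shows "norm (propagator a p t * (f s / propagator a p s)) \<le> A * t powr e * s powr (g - e - 1)"
proof -
  have "norm (propagator a p t * (f s / propagator a p s))
      = norm (propagator a p t / propagator a p s) * norm (f s)"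
    by (simp add: norm_mult norm_divide)
  also have "\<dots> \<le> (t / s) powr e * (A * s powr (g - 1))"
    using assms fb by (intro mult_mono) (auto simp: dichotomy_def)
  also have "\<dots> = A * t powr e * s powr (g - e - 1)"
    using assms T by (simp add: powr_divide powr_diff powr_add field_simps)
  finally show ?thesis .
qed

lemma backward_integrable:
  assumes d: "dichotomy False a p T e" and ge: "g < e" and t: "T \<le> t"
  shows "(\<lambda>s. f s / propagator a p s) integrable_on {t..}"
    and "norm (propagator a p t * integral {t..} (\<lambda>s. f s / propagator a p s)) \<le> A / (e - g) * t powr g"
proof -
  have i: "((\<lambda>s. A * t powr e * s powr (g - e - 1)) has_integral A * t powr e * (t powr (g - e) / (e - g))) {t..}"
  proof -
    have "- (t powr (g - e)) / (g - e) = t powr (g - e) / (e - g)"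
      using ge by (simp add: divide_simps algebra_simps)
    then show ?thesis
      using has_integral_mult_right[OF has_integral_powr_to_inf[of "g - e - 1" t], of "A * t powr e"] ge t T
      by simp
  qed
  have m: "(\<lambda>s. propagator a p t * (f s / propagator a p s)) \<in> borel_measurable (lebesgue_on {t..})"
    by (intro continuous_imp_measurable_on_sets_lebesgue continuous_on_mult_left
        continuous_on_subset[OF integrand_continuous]) (use t in auto)
  have i': "(\<lambda>s. propagator a p t * (f s / propagator a p s)) integrable_on {t..}"
    by (rule measurable_bounded_by_integrable_imp_integrable[OF m])
      (use i t propagated_bound[OF d] in auto)
  have "(\<lambda>s. inverse (propagator a p t) * (propagator a p t * (f s / propagator a p s))) integrable_on {t..}"
    using i' by (rule integrable_on_mult_right)
  then show "(\<lambda>s. f s / propagator a p s) integrable_on {t..}"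
    by (simp add: mult.assoc[symmetric])
  have "norm (integral {t..} (\<lambda>s. propagator a p t * (f s / propagator a p s))) \<le> A * t powr e * (t powr (g - e) / (e - g))"
    unfolding integral_unique[OF i, symmetric]
    by (rule integral_norm_bound_integral) (use i i' t propagated_bound[OF d] in auto)
  also have "\<dots> = A / (e - g) * t powr g"
    using t T by (simp add: powr_diff)
  finally show "norm (propagator a p t * integral {t..} (\<lambda>s. f s / propagator a p s)) \<le> A / (e - g) * t powr g"
    by (simp only: integral_mult_right)
qed

text \<open>The propagated integrand is at most \<open>A t^e s^(g - e - 1)\<close>. Integrated from
  \<open>T\<close>, it is dominated by the upper end exactly when \<open>e < g\<close>; integrated
  from infinity, it converges exactly when \<open>g < e\<close>. In both cases the price is one over
  the gap \<open>\<bar>e - g\<bar>\<close>.\<close>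

lemma duhamel_bound:
  assumes d: "dichotomy d a p T e" and ge: "if d then e < g else g < e" and t: "T \<le> t"
  shows "norm (duhamel d a p T f t) \<le> A / \<bar>e - g\<bar> * t powr g"
proof (cases d)
  case False
  then show ?thesis using backward_integrable(2) d ge t by (simp add: duhamel_def)
next
  case True
  have "0 \<le> A * T powr (g - 1)" using order_trans[OF norm_ge_zero fb[of T]] by simp
  then have A: "0 \<le> A" using T by (simp add: zero_le_mult_iff)
  have i: "((\<lambda>s. A * t powr e * s powr (g - e - 1)) has_integral A * t powr e * ((t powr (g - e) - T powr (g - e)) / (g - e))) {T..t}"
    using has_integral_mult_right[OF powr_has_integral[of T t "g - e"], of "A * t powr e"] ge t T True
    by simp
  have i': "(\<lambda>s. propagator a p t * (f s / propagator a p s)) integrable_on {T..t}"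
    using forward_integrable[OF t] by (rule integrable_on_mult_right)
  have "norm (integral {T..t} (\<lambda>s. propagator a p t * (f s / propagator a p s)))
      \<le> A * t powr e * ((t powr (g - e) - T powr (g - e)) / (g - e))"
    unfolding integral_unique[OF i, symmetric]
    by (rule integral_norm_bound_integral) (use i i' t propagated_bound[OF d] True in auto)
  also have "\<dots> \<le> A * t powr e * (t powr (g - e) / (g - e))"
    using A ge True by (intro mult_left_mono divide_right_mono) auto
  also have "\<dots> = A / \<bar>e - g\<bar> * t powr g"
    using t T ge True by (simp add: powr_diff field_simps)
  finally have "norm (propagator a p t * integral {T..t} (\<lambda>s. f s / propagator a p s)) \<le> A / \<bar>e - g\<bar> * t powr g"
    by (simp only: integral_mult_right)
  then show ?thesis using True by (simp only: duhamel_def if_True)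
qed

lemma forward_integral_derivative:
  assumes t: "T \<le> t"
  shows "((\<lambda>t. integral {T..t} (\<lambda>s. f s / propagator a p s)) has_vector_derivative
      f t / propagator a p t) (at t within {T..})"
proof -
  have "((\<lambda>t. integral {T..t} (\<lambda>s. f s / propagator a p s)) has_vector_derivative
      f t / propagator a p t) (at t within {T..t+1})"
    by (rule integral_has_vector_derivative[OF continuous_on_subset[OF integrand_continuous]])
      (use t in auto)
  moreover have "at t within {T..t+1} = at t within {T..}"
    by (rule at_within_nhd[of _ "{..<t+1}"]) (use t in auto)
  ultimately show ?thesis by simp
qed

lemma duhamel_derivative:
  assumes d: "dichotomy d a p T e" and ge: "if d then e < g else g < e" and t: "T \<le> t"
  shows "(duhamel d a p T f has_vector_derivative
      (a + of_real (p / t)) * duhamel d a p T f t + f t) (at t within {T..})"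
proof -
  define J where "J t = (if d then integral {T..t} (\<lambda>s. f s / propagator a p s)
      else - integral {t..} (\<lambda>s. f s / propagator a p s))" for t
  have J: "(J has_vector_derivative f t / propagator a p t) (at t within {T..})"
  proof (cases d)
    case True
    then show ?thesis using forward_integral_derivative[OF t] by (simp add: J_def [abs_def])
  next
    case False
    let ?h = "\<lambda>s. f s / propagator a p s"
    \<comment> \<open>Minus the integral from \<open>t\<close> to infinity differs by a constant
      from the integral from \<open>T\<close> to \<open>t\<close>, so both directions of integration
      have the same derivative.\<close>
    have *: "- integral {T..} ?h + integral {T..t} ?h = J t" if "T \<le> t" for t
    proof -
      have "integral ({T..t} \<union> {t..}) ?h = integral {T..t} ?h + integral {t..} ?h"
        by (rule integral_Un) (use False d ge that forward_integrable backward_integrable(1) in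
          \<open>auto intro: negligible_subset[OF negligible_sing[of t]]\<close>)
      moreover have "{T..t} \<union> {t..} = {T..}" using that by auto
      ultimately show ?thesis using False by (simp add: J_def)
    qed
    have "((\<lambda>t. - integral {T..} ?h + integral {T..t} ?h) has_vector_derivative 0 + ?h t) (at t within {T..})"
      by (intro has_vector_derivative_add has_vector_derivative_const forward_integral_derivative t)
    then have "((\<lambda>t. - integral {T..} ?h + integral {T..t} ?h) has_vector_derivative ?h t) (at t within {T..})"
      by simp
    then show ?thesis
      by (rule has_vector_derivative_transform[rotated 2]) (use *[symmetric] t in \<open>simp_all\<close>)
  qed
  have "((\<lambda>t. propagator a p t * J t) has_vector_derivative
      propagator a p t * (f t / propagator a p t) + (a + of_real (p / t)) * propagator a p t * J t) (at t within {T..})"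
    by (rule has_vector_derivative_mult[OF propagator_has_derivative J]) (use t T in auto)
  moreover have "duhamel d a p T f = (\<lambda>t. propagator a p t * J t)"
    by (auto simp: duhamel_def J_def)
  ultimately show ?thesis by (simp add: algebra_simps)
qed

end

lemma duhamel_diff:
  assumes T: "0 < T" and f: "continuous_on {T..} f" and h: "continuous_on {T..} h"
    and fb: "\<And>s. T \<le> s \<Longrightarrow> norm (f s) \<le> A * s powr (g - 1)"
    and hb: "\<And>s. T \<le> s \<Longrightarrow> norm (h s) \<le> A * s powr (g - 1)"
    and d: "dichotomy d a p T e" and ge: "if d then e < g else g < e" and t: "T \<le> t"
  shows "duhamel d a p T f t - duhamel d a p T h t = duhamel d a p T (\<lambda>s. f s - h s) t"
proof (cases d)
  case True
  have "integral {T..t} (\<lambda>s. f s / propagator a p s) - integral {T..t} (\<lambda>s. h s / propagator a p s)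
      = integral {T..t} (\<lambda>s. f s / propagator a p s - h s / propagator a p s)"
    by (intro integral_diff[symmetric] forward_integrable[OF T f fb t] forward_integrable[OF T h hb t])
  then show ?thesis using True by (simp add: duhamel_def diff_divide_distrib algebra_simps)
next
  case False
  have "integral {t..} (\<lambda>s. f s / propagator a p s) - integral {t..} (\<lambda>s. h s / propagator a p s)
      = integral {t..} (\<lambda>s. f s / propagator a p s - h s / propagator a p s)"
    by (intro integral_diff[symmetric] backward_integrable(1)[OF T f fb _ _ t] backward_integrable(1)[OF T h hb _ _ t])
      (use False d ge in auto)
  then show ?thesis using False by (simp add: duhamel_def diff_divide_distrib algebra_simps)
qed

section \<open>Picard iteration with power weights\<close>

lemma geometric_Cauchy_limit:
  fixes Y :: "nat \<Rightarrow> 'a :: banach"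
  assumes "\<And>m. norm (Y (Suc m) - Y m) \<le> C * (1/2) ^ m"
  shows "\<exists>y. Y \<longlonglongrightarrow> y \<and> (\<forall>m. norm (y - Y m) \<le> 2 * C * (1/2) ^ m)"
proof -
  \<comment> \<open>Subtracting the remaining geometric tail on the right makes the induction on
    \<open>j\<close> close exactly.\<close>
  have step: "norm (Y (m + j) - Y m) \<le> 2 * C * (1/2) ^ m - 2 * C * (1/2) ^ (m + j)" for m j
  proof (induction j)
    case (Suc j)
    have "norm (Y (m + Suc j) - Y m) \<le> norm (Y (Suc (m + j)) - Y (m + j)) + norm (Y (m + j) - Y m)"
      using norm_triangle_ineq[of "Y (Suc (m + j)) - Y (m + j)" "Y (m + j) - Y m"] by simp
    then show ?case using Suc assms[of "m + j"] by simp
  qed simp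
  have C: "0 \<le> C" using order_trans[OF norm_ge_zero assms[of 0]] by simp
  then have bd: "norm (Y (m + j) - Y m) \<le> 2 * C * (1/2) ^ m" for m j
  proof -
    have "0 \<le> 2 * C * (1/2) ^ (m + j)" using C by simp
    with step[of m j] show ?thesis by linarith
  qed
  have "Cauchy Y"
  proof (rule metric_CauchyI)
    fix \<epsilon> :: real assume "0 < \<epsilon>"
    have "(\<lambda>m. 2 * (2 * C * (1/2) ^ m)) \<longlonglongrightarrow> 0"
      by (intro tendsto_mult_right_zero LIMSEQ_realpow_zero) auto
    then obtain M where M: "\<And>m. m \<ge> M \<Longrightarrow> 2 * (2 * C * (1/2) ^ m) < \<epsilon>"
      using \<open>0 < \<epsilon>\<close> by (metis (no_types, lifting) eventually_sequentially order_tendstoD(2))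
    have "dist (Y i) (Y j) < \<epsilon>" if "i \<ge> M" "j \<ge> M" for i j
    proof -
      have "dist (Y i) (Y M) \<le> 2 * C * (1/2) ^ M" "dist (Y j) (Y M) \<le> 2 * C * (1/2) ^ M"
        using bd[of M "i - M"] bd[of M "j - M"] that by (auto simp: dist_norm)
      then show ?thesis using dist_triangle2[of "Y i" "Y j" "Y M"] M[of M] by linarith
    qed
    then show "\<exists>M. \<forall>m\<ge>M. \<forall>n\<ge>M. dist (Y m) (Y n) < \<epsilon>" by blast
  qed
  then obtain y where y: "Y \<longlonglongrightarrow> y" using Cauchy_convergent convergentD by blast
  have "norm (y - Y m) \<le> 2 * C * (1/2) ^ m" for m
  proof (rule Lim_bounded)
    show "(\<lambda>j. norm (Y j - Y m)) \<longlonglongrightarrow> norm (y - Y m)" by (intro tendsto_intros y)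
    show "\<forall>j\<ge>m. norm (Y j - Y m) \<le> 2 * C * (1/2) ^ m"
      using bd[of m] by (metis le_add_diff_inverse)
  qed
  with y show ?thesis by blast
qed

text \<open>
  The Picard iteration is run inside the balls \<open>\<bar>y\<^sub>k\<bar> \<le> r\<^sub>k t\<^bsup>g k\<^esup>\<close>, but its contraction is measured
  with the weaker weights \<open>t\<^bsup>g' k\<^esup>\<close>: a component with a growing weight \<open>g' k > 0\<close> may
  then feed back into decaying ones.
\<close>

theorem weighted_ode_solution:
  fixes F :: "real \<Rightarrow> ('i \<Rightarrow> complex) \<Rightarrow> 'i \<Rightarrow> complex"
    and a :: "'i \<Rightarrow> complex" and p e g g' r B :: "'i \<Rightarrow> real" and d :: "'i \<Rightarrow> bool" and T D :: real
  defines "inball \<equiv> \<lambda>t y. \<forall>k. norm (y k) \<le> r k * t powr g k"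
  assumes T: "1 \<le> T"
    and dich: "\<And>k. dichotomy (d k) (a k) (p k) T (e k)"
    and ge: "\<And>k. if d k then e k < g k else g' k < e k"
    and gg: "\<And>k. g k \<le> g' k"
    and B: "\<And>k. 0 < B k" and r: "\<And>k. 0 \<le> r k" "\<And>k. r k \<le> D * B k"
    and cont: "\<And>y k. (\<And>l. continuous_on {T..} (\<lambda>t. y t l)) \<Longrightarrow> (\<And>t. T \<le> t \<Longrightarrow> inball t (y t)) \<Longrightarrow>
        continuous_on {T..} (\<lambda>t. F t (y t) k)"
    and bound: "\<And>t y k. T \<le> t \<Longrightarrow> inball t y \<Longrightarrow>
        norm (F t y k) \<le> r k * \<bar>e k - g k\<bar> * t powr (g k - 1)"
    and lip: "\<And>t y y' k D. T \<le> t \<Longrightarrow> inball t y \<Longrightarrow> inball t y' \<Longrightarrow> 0 \<le> D \<Longrightarrow>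
        (\<And>l. norm (y l - y' l) \<le> D * B l * t powr g' l) \<Longrightarrow>
        norm (F t y k - F t y' k) \<le> D * B k * \<bar>e k - g' k\<bar> / 2 * t powr (g' k - 1)"
  shows "\<exists>y. (\<forall>t\<ge>T. inball t (y t)) \<and> (\<forall>t\<ge>T. \<forall>k.
      ((\<lambda>t. y t k) has_vector_derivative (a k + of_real (p k / t)) * y t k + F t (y t) k) (at t within {T..}))"
proof -
  have T0: "0 < T" using T by simp
  have ge': "if d k then e k < g' k else g' k < e k" "if d k then e k < g k else g k < e k" for k
    using ge[of k] gg[of k] by (auto split: if_splits)
  have en: "e k \<noteq> g k" "e k \<noteq> g' k" for k using ge'[of k] by (auto split: if_splits)
  define \<Phi> where "\<Phi> y t k = duhamel (d k) (a k) (p k) T (\<lambda>s. F s (y s) k) t" for y t k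
  define good where "good y \<longleftrightarrow> (\<forall>l. continuous_on {T..} (\<lambda>t. y t l)) \<and> (\<forall>t\<ge>T. inball t (y t))"
    for y :: "real \<Rightarrow> 'i \<Rightarrow> complex"
  have Fc: "continuous_on {T..} (\<lambda>t. F t (y t) k)" if "good y" for y k
    using that cont by (auto simp: good_def)
  have Fb: "norm (F s (y s) k) \<le> r k * \<bar>e k - g k\<bar> * s powr (g k - 1)" if "good y" "T \<le> s" for y k s
    using that bound by (auto simp: good_def)
  have deriv: "((\<lambda>t. \<Phi> y t k) has_vector_derivative (a k + of_real (p k / t)) * \<Phi> y t k + F t (y t) k) (at t within {T..})"
    if "good y" "T \<le> t" for y t k
    using duhamel_derivative[OF T0 Fc[OF that(1)] Fb[OF that(1)] dich ge'(2) that(2)] by (simp add: \<Phi>_def)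
  have \<Phi>b: "norm (\<Phi> y t k) \<le> r k * t powr g k" if "good y" "T \<le> t" for y t k
    using duhamel_bound[OF T0 Fc[OF that(1)] Fb[OF that(1)] dich ge'(2) that(2), of k] en[of k] by (simp add: \<Phi>_def)
  have \<Phi>good: "good (\<Phi> y)" if "good y" for y
    unfolding good_def inball_def continuous_on_eq_continuous_within
    using \<Phi>b[OF that] has_vector_derivative_continuous[OF deriv[OF that]] by blast
  have contr: "norm (\<Phi> y t k - \<Phi> y' t k) \<le> C / 2 * B k * t powr g' k"
    if y: "good y" "good y'" and C: "0 \<le> C" and t: "T \<le> t"
      and le: "\<And>t l. T \<le> t \<Longrightarrow> norm (y t l - y' t l) \<le> C * B l * t powr g' l" for y y' C t k
  proof -
    \<comment> \<open>Integration divides by the gap \<open>\<bar>e k - g' k\<bar>\<close>, which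
      cancels the same factor in the Lipschitz hypothesis and leaves the contraction factor one
      half.\<close>
    have "norm (duhamel (d k) (a k) (p k) T (\<lambda>s. F s (y s) k - F s (y' s) k) t)
      \<le> C * B k * \<bar>e k - g' k\<bar> / 2 / \<bar>e k - g' k\<bar> * t powr g' k"
      by (rule duhamel_bound[OF T0 _ _ dich ge'(1) t])
        (use y C t le Fc lip in \<open>auto intro!: continuous_intros simp: good_def\<close>)
    moreover have "\<Phi> y t k - \<Phi> y' t k = duhamel (d k) (a k) (p k) T (\<lambda>s. F s (y s) k - F s (y' s) k) t"
      unfolding \<Phi>_def
      by (rule duhamel_diff[OF T0 Fc[OF y(1)] Fc[OF y(2)] Fb[OF y(1)] Fb[OF y(2)] dich ge'(2) t])
    ultimately show ?thesis using en[of k] by simp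
  qed
  define Y where "Y m = (\<Phi> ^^ m) (\<lambda>t k. 0)" for m
  have Y0: "good (Y m)" for m
  proof (induction m)
    case 0
    show ?case using r(1) by (simp add: Y_def good_def inball_def)
  next
    case (Suc m)
    then show ?case using \<Phi>good[of "Y m"] by (simp add: Y_def)
  qed
  \<comment> \<open>The index \<open>undefined\<close> only serves as some element of the index
    type: there \<open>0 \<le> r \<le> D * B\<close> with \<open>B\<close> positive.\<close>
  have D: "0 \<le> D"
    using order_trans[OF r(1)[of undefined] r(2)[of undefined]] B[of undefined]
    by (simp add: zero_le_mult_iff)
  have Yd: "T \<le> t \<Longrightarrow> norm (Y (Suc m) t k - Y m t k) \<le> (D * (1/2)^m) * B k * t powr g' k" for m t k
  proof (induction m arbitrary: t k)
    case 0
    have "norm (Y (Suc 0) t k) \<le> r k * t powr g k"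
      using Y0[of "Suc 0"] 0 by (auto simp: good_def inball_def)
    \<comment> \<open>The first increment is measured by the radius of the ball. Passing to the
      weaker weight \<open>g'\<close> uses \<open>1 \<le> t\<close>, and \<open>D\<close> compares
      the radii with the weights \<open>B\<close>.\<close>
    also have "\<dots> \<le> (D * B k) * t powr g' k"
      using 0 T gg r D B[of k] by (intro mult_mono powr_mono) auto
    finally show ?case by (simp add: Y_def)
  next
    case (Suc m)
    have "norm (\<Phi> (Y (Suc m)) t k - \<Phi> (Y m) t k) \<le> (D * (1/2)^m) / 2 * B k * t powr g' k"
      by (rule contr) (use Suc Y0 D in auto)
    then show ?case by (simp add: Y_def)
  qed
  have "\<exists>y. \<forall>t k. T \<le> t \<longrightarrow> (\<lambda>m. Y m t k) \<longlonglongrightarrow> y t k \<and>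
      (\<forall>m. norm (y t k - Y m t k) \<le> 2 * (D * B k * t powr g' k) * (1/2) ^ m)"
    (is "\<exists>y. \<forall>t k. ?P y t k")
  proof -
    have "\<exists>z. T \<le> t \<longrightarrow> (\<lambda>m. Y m t k) \<longlonglongrightarrow> z \<and>
      (\<forall>m. norm (z - Y m t k) \<le> 2 * (D * B k * t powr g' k) * (1/2) ^ m)" for t k
      using geometric_Cauchy_limit[of "\<lambda>m. Y m t k" "D * B k * t powr g' k"] Yd[of t _ k]
      by (auto simp: algebra_simps)
    then show ?thesis by metis
  qed
  then obtain y where lim: "\<And>t k. T \<le> t \<Longrightarrow> (\<lambda>m. Y m t k) \<longlonglongrightarrow> y t k"
    and tail: "\<And>t k m. T \<le> t \<Longrightarrow> norm (y t k - Y m t k) \<le> 2 * (D * B k * t powr g' k) * (1/2) ^ m"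
    by blast
  have "good y"
    unfolding good_def
  proof safe
    fix t :: real assume t: "T \<le> t"
    show "inball t (y t)" unfolding inball_def
    proof
      fix k show "norm (y t k) \<le> r k * t powr g k"
        by (rule Lim_bounded[OF tendsto_norm[OF lim[OF t]], of 0])
          (use Y0 t in \<open>auto simp: good_def inball_def\<close>)
    qed
  next
    fix l
    show "continuous_on {T..} (\<lambda>t. y t l)"
      unfolding continuous_on_eq_continuous_within
    proof
      fix t assume t: "t \<in> {T..}"
      \<comment> \<open>On a bounded interval the weight \<open>t powr g' l\<close> is at most this
        constant, whatever the sign of the exponent, so the iterates converge uniformly
        there.\<close>
      define S where "S = (t + 1) powr \<bar>g' l\<bar>"
      have "continuous_on {T..t+1} (\<lambda>t. y t l)"
      proof (rule uniform_limit_theorem)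
        show "\<forall>\<^sub>F m in sequentially. continuous_on {T..t+1} (\<lambda>t. Y m t l)"
        proof (intro always_eventually allI)
          fix m show "continuous_on {T..t+1} (\<lambda>t. Y m t l)"
            using Y0[of m] by (auto simp: good_def intro: continuous_on_subset[of "{T..}"])
        qed
        show "uniform_limit {T..t+1} (\<lambda>m t. Y m t l) (\<lambda>t. y t l) sequentially"
        proof (rule uniform_limitI)
          fix \<epsilon> :: real assume "0 < \<epsilon>"
          have "(\<lambda>m. 2 * (D * B l * S) * (1/2) ^ m) \<longlonglongrightarrow> 0"
            by (intro tendsto_mult_right_zero LIMSEQ_realpow_zero) auto
          then have "\<forall>\<^sub>F m in sequentially. 2 * (D * B l * S) * (1/2) ^ m < \<epsilon>"
            using \<open>0 < \<epsilon>\<close> by (rule order_tendstoD)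
          then show "\<forall>\<^sub>F m in sequentially. \<forall>s\<in>{T..t+1}. dist (Y m s l) (y s l) < \<epsilon>"
          proof (rule eventually_mono, safe)
            fix m s assume m: "2 * (D * B l * S) * (1/2) ^ m < \<epsilon>" and s: "s \<in> {T..t+1}"
            have "s powr g' l \<le> s powr \<bar>g' l\<bar>" using s T by (intro powr_mono) auto
            also have "\<dots> \<le> S" unfolding S_def using s T by (intro powr_mono2) auto
            finally have "2 * (D * B l * s powr g' l) * (1/2) ^ m \<le> 2 * (D * B l * S) * (1/2) ^ m"
              using D B[of l] by (intro mult_right_mono mult_left_mono) auto
            then show "dist (Y m s l) (y s l) < \<epsilon>"
              using tail[of s l m] s m by (simp add: dist_norm norm_minus_commute)
          qed
        qed
      qed simp
      then have "continuous (at t within {T..t+1}) (\<lambda>t. y t l)"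
        using t by (auto simp: continuous_on_eq_continuous_within)
      moreover have "at t within {T..t+1} = at t within {T..}"
        by (rule at_within_nhd[of _ "{..<t+1}"]) (use t in auto)
      ultimately show "continuous (at t within {T..}) (\<lambda>t. y t l)"
        by (simp add: continuous_within)
    qed
  qed
  moreover have "\<Phi> y t k = y t k" if t: "T \<le> t" for t k
  proof -
    \<comment> \<open>The contraction estimate between the limit and the \<open>m\<close>-th
      iterate, fed with the tail bound, shows that \<open>\<Phi>\<close> of the limit is again the
      limit of the shifted sequence.\<close>
    have "(\<lambda>m. Y (Suc m) t k) \<longlonglongrightarrow> \<Phi> y t k"
    proof (rule Lim_null_comparison[THEN LIM_zero_cancel])
      show "\<forall>\<^sub>F m in sequentially. norm (Y (Suc m) t k - \<Phi> y t k) \<le> (2 * D * (1/2)^m) / 2 * B k * t powr g' k"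
      proof (intro always_eventually allI)
        fix m
        have "norm (\<Phi> y t k - \<Phi> (Y m) t k) \<le> (2 * D * (1/2)^m) / 2 * B k * t powr g' k"
          by (rule contr) (use tail \<open>good y\<close> Y0 D t in \<open>auto simp: algebra_simps\<close>)
        then show "norm (Y (Suc m) t k - \<Phi> y t k) \<le> (2 * D * (1/2)^m) / 2 * B k * t powr g' k"
          by (simp add: Y_def norm_minus_commute)
      qed
      have "(\<lambda>m. (D * B k * t powr g' k) * (1/2::real)^m) \<longlonglongrightarrow> 0"
        by (intro tendsto_mult_right_zero LIMSEQ_realpow_zero) auto
      then show "(\<lambda>m. (2 * D * (1/2)^m) / 2 * B k * t powr g' k) \<longlonglongrightarrow> 0"
        by (simp add: algebra_simps)
    qed
    then show ?thesis using LIMSEQ_Suc[OF lim[OF t]] LIMSEQ_unique by blast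
  qed
  ultimately have "((\<lambda>t. y t k) has_vector_derivative (a k + of_real (p k / t)) * y t k + F t (y t) k) (at t within {T..})"
    if "T \<le> t" for t k
    using deriv[OF \<open>good y\<close> that, of k] that
    by (auto intro: has_vector_derivative_transform[rotated 2])
  then show ?thesis using \<open>good y\<close> by (auto simp: good_def)
qed

section \<open>Weighted inner product and linearized attraction\<close>

definition wip :: "nat \<Rightarrow> (nat \<Rightarrow> real) \<Rightarrow> (nat \<Rightarrow> real) \<Rightarrow> (nat \<Rightarrow> real) \<Rightarrow> real" where
  "wip n m u v = (\<Sum>i<n. m i * u i * v i)"

text \<open>A graph Laplacian with edge weights \<open>m j / \<bar>x i - x j\<bar> ^ 3\<close>,
  symmetric for \<open>wip\<close>. The equation \<open>lap n m x x i = x i\<close> says that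
  \<open>x\<close> rotates rigidly with angular velocity 1. The attraction linearized at
  \<open>x\<close> acts as \<open>2 * lap\<close> along the line and as \<open>- lap\<close> across
  it.\<close>

definition lap :: "nat \<Rightarrow> (nat \<Rightarrow> real) \<Rightarrow> (nat \<Rightarrow> real) \<Rightarrow> (nat \<Rightarrow> real) \<Rightarrow> nat \<Rightarrow> real" where
  "lap n m x u i = (\<Sum>j<n. m j * (u i - u j) / \<bar>x i - x j\<bar> ^ 3)"

lemma wip_commute: "wip n m u v = wip n m v u"
  by (simp add: wip_def algebra_simps)

lemma wip_add: "wip n m (\<lambda>i. u i + v i) w = wip n m u w + wip n m v w"
  by (simp add: wip_def algebra_simps sum.distrib)

lemma wip_diff: "wip n m (\<lambda>i. u i - v i) w = wip n m u w - wip n m v w"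
  by (simp add: wip_def algebra_simps sum_subtractf)

lemma wip_scale: "wip n m (\<lambda>i. c * u i) w = c * wip n m u w"
  by (simp add: wip_def algebra_simps sum_distrib_left)

lemma wip_sum: "wip n m (\<lambda>i. \<Sum>k\<in>K. u k i) w = (\<Sum>k\<in>K. wip n m (u k) w)"
  by (simp add: wip_def sum_distrib_left sum_distrib_right) (rule sum.swap)

lemma wip_unit: "k < n \<Longrightarrow> wip n m (\<lambda>i. if i = k then 1 else 0) u = m k * u k"
proof -
  assume "k < n"
  moreover have "wip n m (\<lambda>i. if i = k then 1 else 0) u = (\<Sum>i<n. if i = k then m k * u k else 0)"
    unfolding wip_def by (rule sum.cong) auto
  ultimately show ?thesis by simp
qed

lemma wip_cong: "(\<And>i. i < n \<Longrightarrow> u i = u' i) \<Longrightarrow> (\<And>i. i < n \<Longrightarrow> v i = v' i) \<Longrightarrow> wip n m u v = wip n m u' v'"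
  by (auto simp: wip_def)

text \<open>Averaging over the interchange of \<open>i\<close> and \<open>j\<close> gives the
  Dirichlet form, from which symmetry, nonnegativity and vanishing on constants can be read
  off.\<close>

lemma wip_lap:
  "wip n m u (lap n m x v) = (\<Sum>i<n. \<Sum>j<n. m i * m j * ((u i - u j) * (v i - v j)) / \<bar>x i - x j\<bar> ^ 3) / 2"
proof -
  let ?S = "\<Sum>i<n. \<Sum>j<n. m i * m j * (u i * (v i - v j)) / \<bar>x i - x j\<bar> ^ 3"
  have 1: "wip n m u (lap n m x v) = ?S"
    by (simp add: wip_def lap_def sum_distrib_left algebra_simps)
  have "?S = (\<Sum>i<n. \<Sum>j<n. m j * m i * (u j * (v j - v i)) / \<bar>x j - x i\<bar> ^ 3)"
    by (rule sum.swap)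
  then have "2 * ?S = ?S + (\<Sum>i<n. \<Sum>j<n. m j * m i * (u j * (v j - v i)) / \<bar>x j - x i\<bar> ^ 3)"
    by simp
  also have "\<dots> = (\<Sum>i<n. \<Sum>j<n. m i * m j * ((u i - u j) * (v i - v j)) / \<bar>x i - x j\<bar> ^ 3)"
    unfolding sum.distrib[symmetric]
    by (intro sum.cong refl)
      (simp add: abs_minus_commute[of "x _" "x _"] add_divide_distrib[symmetric] algebra_simps)
  finally show ?thesis using 1 by simp
qed

lemma wip_lap_commute: "wip n m u (lap n m x v) = wip n m (lap n m x u) v"
proof -
  have "wip n m (lap n m x u) v = wip n m v (lap n m x u)" by (rule wip_commute)
  then show ?thesis unfolding wip_lap by (simp add: mult.commute[of "u _ - u _"])
qed

text \<open>Tychonoff's theorem. Entries beyond \<open>n\<close> are pinned to 0, so functions on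
  all of \<open>nat\<close> can stand for vectors of length \<open>n\<close> and minima over them
  exist.\<close>

lemma compact_box:
  "compact {u :: nat \<Rightarrow> real. \<forall>i. \<bar>u i\<bar> \<le> (if i < n then H else 0)}"
proof -
  have "{u :: nat \<Rightarrow> real. \<forall>i. \<bar>u i\<bar> \<le> (if i < n then H else 0)}
      = PiE UNIV (\<lambda>i. {- (if i < n then H else 0)..(if i < n then H else 0)})"
  proof -
    have "\<bar>r\<bar> \<le> a \<longleftrightarrow> r \<in> {-a..a}" for r a :: real by auto
    then show ?thesis by (simp only: PiE_UNIV_domain) blast
  qed
  moreover have "compactin (product_topology (\<lambda>i. euclidean) UNIV) \<dots>"
    unfolding compactin_PiE by auto
  ultimately show ?thesis
    by (simp only: euclidean_product_topology compactin_euclidean_iff)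
qed

lemma continuous_on_coord [continuous_intros]: "continuous_on S (\<lambda>u :: nat \<Rightarrow> real. u i)"
  by (rule continuous_on_subset[OF continuous_on_product_coordinates]) simp

section \<open>Collinear central configurations\<close>

text \<open>The first half compensates the double count of pairs, and diagonal terms are 0 because
  division by zero gives 0. Critical points with distinct entries are exactly the solutions of
  \<open>lap n m x x i = x i\<close>.\<close>

definition config_energy :: "nat \<Rightarrow> (nat \<Rightarrow> real) \<Rightarrow> (nat \<Rightarrow> real) \<Rightarrow> real" where
  "config_energy n m x = (\<Sum>i<n. \<Sum>j<n. m i * m j / \<bar>x i - x j\<bar>) / 2 + (\<Sum>i<n. m i * (x i)\<^sup>2) / 2"

lemma has_real_derivative_abs:
  fixes y :: real assumes "y \<noteq> 0" shows "(abs has_real_derivative sgn y) (at y)"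
proof (cases "0 < y")
  case True
  have "(abs has_real_derivative 1) (at y)"
    by (rule has_field_derivative_transform_within_open[of "\<lambda>x. x" 1 y "{0<..}"]) (use True in auto)
  then show ?thesis using True by simp
next
  case False
  have "(abs has_real_derivative -1) (at y)"
    by (rule has_field_derivative_transform_within_open[of "\<lambda>x. - x" _ y "{..<0}"])
      (use False assms in \<open>auto intro!: derivative_eq_intros\<close>)
  then show ?thesis using False assms by simp
qed

lemma config_energy_derivative:
  assumes x: "\<And>i j. i < n \<Longrightarrow> j < n \<Longrightarrow> i \<noteq> j \<Longrightarrow> x i \<noteq> x j"
  shows "((\<lambda>s. config_energy n m (\<lambda>i. x i + s * v i)) has_real_derivative
    wip n m v (\<lambda>i. x i - lap n m x x i)) (at 0)"
proof -
  have p: "((\<lambda>s. m i * m j / \<bar>(x i + s * v i) - (x j + s * v j)\<bar>) has_real_derivative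
      - (m i * m j * ((v i - v j) * (x i - x j)) / \<bar>x i - x j\<bar> ^ 3)) (at 0)"
    if ij: "i < n" "j < n" for i j
  proof (cases "i = j")
    case False
    then have ne: "x i - x j \<noteq> 0" using x ij by simp
    have D1: "((\<lambda>s. (x i + s * v i) - (x j + s * v j)) has_real_derivative v i - v j) (at 0)"
      by (auto intro!: derivative_eq_intros)
    have D2: "(abs has_real_derivative sgn (x i - x j)) (at ((x i + 0 * v i) - (x j + 0 * v j)))"
      using has_real_derivative_abs ne by simp
    have "((\<lambda>s. \<bar>(x i + s * v i) - (x j + s * v j)\<bar>) has_real_derivative
       sgn (x i - x j) * (v i - v j)) (at 0)"
      by (rule DERIV_chain2[OF D2 D1])
    from DERIV_divide[OF DERIV_const[of "m i * m j"] this] ne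
    have "((\<lambda>s. m i * m j / \<bar>(x i + s * v i) - (x j + s * v j)\<bar>) has_real_derivative
       - (m i * m j * (sgn (x i - x j) * (v i - v j))) / \<bar>x i - x j\<bar>\<^sup>2) (at 0)"
      by (simp add: power2_eq_square)
    moreover have "- (m i * m j * (sgn (x i - x j) * (v i - v j))) / \<bar>x i - x j\<bar>\<^sup>2
      = - (m i * m j * ((v i - v j) * (x i - x j)) / \<bar>x i - x j\<bar> ^ 3)"
      unfolding real_sgn_eq by (simp add: power2_eq_square power3_eq_cube mult_ac)
    ultimately show ?thesis by simp
  qed simp
  have "((\<lambda>s. config_energy n m (\<lambda>i. x i + s * v i)) has_real_derivative
     (\<Sum>i<n. \<Sum>j<n. - (m i * m j * ((v i - v j) * (x i - x j)) / \<bar>x i - x j\<bar> ^ 3)) / 2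
     + (\<Sum>i<n. m i * (2 * x i * v i)) / 2) (at 0)"
    unfolding config_energy_def
    by (intro DERIV_add DERIV_cdivide DERIV_sum p) (auto intro!: derivative_eq_intros)
  moreover have "(\<Sum>i<n. \<Sum>j<n. - (m i * m j * ((v i - v j) * (x i - x j)) / \<bar>x i - x j\<bar> ^ 3)) / 2
     + (\<Sum>i<n. m i * (2 * x i * v i)) / 2 = wip n m v (\<lambda>i. x i - lap n m x x i)"
    unfolding wip_commute[of n m v] wip_diff unfolding wip_commute[of n m _ v] wip_lap
    by (simp add: wip_def sum_negf sum_distrib_left sum_divide_distrib algebra_simps)
  ultimately show ?thesis by simp
qed

text \<open>All terms are nonnegative, so a bound on the sum confines each of them. A pair occurs
  twice in the double sum, which undoes the factor one half.\<close>

lemma config_energy_bounds: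
  assumes m: "\<And>i. i < n \<Longrightarrow> 1 \<le> m i" and V: "config_energy n m x \<le> V"
  shows "i < n \<Longrightarrow> (x i)\<^sup>2 \<le> 2 * V" and "i < n \<Longrightarrow> j < n \<Longrightarrow> x i \<noteq> x j \<Longrightarrow> 1 \<le> V * \<bar>x i - x j\<bar>"
proof -
  have m0: "0 \<le> m i" if "i < n" for i using m[OF that] by simp
  have p: "0 \<le> (\<Sum>i<n. \<Sum>j<n. m i * m j / \<bar>x i - x j\<bar>)" and s: "0 \<le> (\<Sum>i<n. m i * (x i)\<^sup>2)"
    using m0 by (auto intro!: sum_nonneg)
  show "(x i)\<^sup>2 \<le> 2 * V" if i: "i < n"
  proof -
    have "(x i)\<^sup>2 \<le> m i * (x i)\<^sup>2" using m[OF i] by (simp add: mult_le_cancel_right1)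
    also have "\<dots> \<le> (\<Sum>i<n. m i * (x i)\<^sup>2)"
      using i m0 by (intro member_le_sum) auto
    finally show ?thesis using p V unfolding config_energy_def by linarith
  qed
  show "1 \<le> V * \<bar>x i - x j\<bar>" if i: "i < n" and j: "j < n" and ne: "x i \<noteq> x j"
  proof -
    have r: "m i * m j / \<bar>x i - x j\<bar> \<le> (\<Sum>j<n. m i * m j / \<bar>x i - x j\<bar>)" if "i < n" "j < n" for i j
      using that m0 by (intro member_le_sum[of j _ "\<lambda>j. m i * m j / \<bar>x i - x j\<bar>"]) auto
    have "i \<noteq> j" using ne by auto
    then have "(\<Sum>l\<in>{i,j}. \<Sum>k<n. m l * m k / \<bar>x l - x k\<bar>) \<le> (\<Sum>l<n. \<Sum>k<n. m l * m k / \<bar>x l - x k\<bar>)"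
      using i j m0 by (intro sum_mono2 sum_nonneg) auto
    then have "m i * m j / \<bar>x i - x j\<bar> + m j * m i / \<bar>x j - x i\<bar> \<le> (\<Sum>l<n. \<Sum>k<n. m l * m k / \<bar>x l - x k\<bar>)"
      using r[OF i j] r[OF j i] \<open>i \<noteq> j\<close> by simp
    then have "m i * m j / \<bar>x i - x j\<bar> \<le> V"
      using s V unfolding config_energy_def by (simp add: abs_minus_commute mult.commute)
    then have "m i * m j \<le> V * \<bar>x i - x j\<bar>" using ne by (simp add: field_simps)
    moreover have "1 * 1 \<le> m i * m j" using m[OF i] m[OF j] by (intro mult_mono) auto
    ultimately show ?thesis by linarith
  qed
qed

text \<open>Twice an upper bound for the energy of the equally spaced configuration
  \<open>0, ..., n - 1\<close> with masses at most 2: pairs contribute at most \<open>2 n^2\<close>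
  and the moment of inertia at most \<open>n^3\<close>.\<close>

definition config_bound :: "nat \<Rightarrow> real" where
  "config_bound n = 4 * real n ^ 2 + 2 * real n ^ 3"

lemma config_bound_ge: "2 \<le> n \<Longrightarrow> 32 \<le> config_bound n"
proof -
  assume n: "2 \<le> n"
  have "2 ^ 2 \<le> real n ^ 2" "2 ^ 3 \<le> real n ^ 3" using n by (intro power_mono; simp)+
  then show ?thesis by (simp add: config_bound_def)
qed

text \<open>The energy is minimized on a compact set of ordered configurations. Its value at the
  minimum keeps the minimizer away from every constraint, by 1 in position and by
  \<open>1 / H\<close> in the gaps, so that moving one body alone gives a genuine critical point
  equation.\<close>

theorem collinear_central_configuration:
  assumes n: "2 \<le> n" and m: "\<And>i. i < n \<Longrightarrow> 1 \<le> m i" "\<And>i. i < n \<Longrightarrow> m i \<le> 2"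
  defines "H \<equiv> config_bound n"
  shows "\<exists>x. (\<forall>i<n. \<bar>x i\<bar> \<le> H) \<and> (\<forall>j<n. \<forall>i<j. 1 / H \<le> x j - x i) \<and> (\<forall>i<n. lap n m x x i = x i)"
proof -
  have H: "32 \<le> H" using config_bound_ge[OF n] by (simp add: H_def)
  define K where "K = {u :: nat \<Rightarrow> real. \<forall>i. \<bar>u i\<bar> \<le> (if i < n then H else 0)}
    \<inter> (\<Inter>j\<in>{..<n}. \<Inter>i\<in>{..<j}. {u. 1 / H \<le> u j - u i})"
  have KD: "u \<in> K \<longleftrightarrow> (\<forall>i. \<bar>u i\<bar> \<le> (if i < n then H else 0)) \<and> (\<forall>j<n. \<forall>i<j. 1 / H \<le> u j - u i)" for u
    by (auto simp: K_def)
  have "compact K"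
    unfolding K_def
    by (intro compact_Int_closed compact_box closed_INT ballI closed_Collect_le continuous_intros)
  have nz: "u i \<noteq> u j" if "u \<in> K" "i < n" "j < n" "i \<noteq> j" for u i j
  proof (cases "i < j")
    case True
    then have "1 / H \<le> u j - u i" using that by (simp add: KD)
    then show ?thesis using H divide_pos_pos[of 1 H] by linarith
  next
    case False
    then have "1 / H \<le> u i - u j" using that by (simp add: KD)
    then show ?thesis using H divide_pos_pos[of 1 H] by linarith
  qed
  have cont: "continuous_on K (config_energy n m)"
  proof -
    have "continuous_on K (\<lambda>u. m i * m j / \<bar>u i - u j\<bar>)" if "i < n" "j < n" for i j
    proof (cases "i = j")
      case False
      then show ?thesis using nz that by (intro continuous_intros) auto
    qed (simp add: continuous_on_const)
    then have "continuous_on K (\<lambda>u. \<Sum>i<n. \<Sum>j<n. m i * m j / \<bar>u i - u j\<bar>)"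
      by (intro continuous_on_sum) simp
    then show ?thesis
      unfolding config_energy_def
      by (intro continuous_on_add continuous_on_divide) (auto intro!: continuous_intros)
  qed
  define x0 where "x0 i = (if i < n then real i else 0)" for i :: nat
  have x0: "x0 \<in> K"
  proof -
    have "real n \<le> real n ^ 3" "0 \<le> real n ^ 2" using n by (auto intro: self_le_power)
    then have nH: "real n \<le> H"
      unfolding H_def config_bound_def using of_nat_0_le_iff[of n, where 'a = real] by linarith
    have gap: "1 / H \<le> real j - real i" if "i < j" for i j :: nat
    proof -
      have "1 / H \<le> 1" using H by simp
      also have "1 \<le> real j - real i" using that by simp
      finally show ?thesis .
    qed
    show ?thesis
      unfolding KD
    proof (intro conjI allI impI)
      show "\<bar>x0 i\<bar> \<le> (if i < n then H else 0)" for i using nH by (simp add: x0_def)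
      show "1 / H \<le> x0 j - x0 i" if "j < n" "i < j" for i j
        using gap[OF that(2)] that by (simp add: x0_def)
    qed
  qed
  have E0: "config_energy n m x0 \<le> H / 2"
  proof -
    have "(\<Sum>i<n. \<Sum>j<n. m i * m j / \<bar>x0 i - x0 j\<bar>) \<le> (\<Sum>i<n. \<Sum>j<n. 4)"
    proof (intro sum_mono)
      fix i j assume ij: "i \<in> {..<n}" "j \<in> {..<n}"
      have "0 \<le> m j" using m(1)[of j] ij by simp
      then have mm: "m i * m j \<le> 2 * 2" using ij m(2) by (intro mult_mono) auto
      show "m i * m j / \<bar>x0 i - x0 j\<bar> \<le> 4"
      proof (cases "i = j")
        case False
        then have "1 \<le> \<bar>x0 i - x0 j\<bar>" using ij by (auto simp: x0_def)
        then have "m i * m j / \<bar>x0 i - x0 j\<bar> \<le> 4 / 1" using mm by (intro frac_le) auto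
        then show ?thesis by simp
      qed simp
    qed
    moreover have "(\<Sum>i<n. m i * (x0 i)\<^sup>2) \<le> (\<Sum>i<n. 2 * (real n)\<^sup>2)"
      using m(2) by (intro sum_mono mult_mono power_mono) (auto simp: x0_def)
    ultimately show ?thesis
      by (simp add: config_energy_def H_def config_bound_def power2_eq_square power3_eq_cube)
  qed
  obtain x where x: "x \<in> K" and min: "\<And>u. u \<in> K \<Longrightarrow> config_energy n m x \<le> config_energy n m u"
    using continuous_attains_inf[OF \<open>compact K\<close> _ cont] x0 by blast
  have E: "config_energy n m x \<le> H / 2" using min[OF x0] E0 by simp
  have xb: "\<bar>x i\<bar> \<le> H - 1" if "i < n" for i
  proof -
    have "(x i)\<^sup>2 \<le> H" using config_energy_bounds(1)[OF m(1) E that] by simp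
    also have "\<dots> \<le> H * (H - 2)" using H by (simp add: mult_le_cancel_left1)
    also have "\<dots> \<le> (H - 1)\<^sup>2" by (simp add: power2_eq_square algebra_simps)
    finally show ?thesis using H by (simp add: abs_le_square_iff[symmetric])
  qed
  \<comment> \<open>Since the energy is at most \<open>H / 2\<close>, the a priori gap is twice the
    one demanded in \<open>K\<close>; the surplus is the room for the variation.\<close>
  have xg: "2 / H \<le> x j - x i" if "j < n" "i < j" for i j
  proof -
    have "1 / H \<le> x j - x i" using x that by (simp add: KD)
    then have "x i < x j" using H divide_pos_pos[of 1 H] by linarith
    then have "1 \<le> H / 2 * (x j - x i)"
      using config_energy_bounds(2)[OF m(1) E, of j i] that by simp
    then show ?thesis using H by (simp add: field_simps)
  qed
  have crit: "lap n m x x k = x k" if k: "k < n" for k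
  proof -
    define v where "v i = (if i = k then 1 else 0 :: real)" for i
    have "wip n m v (\<lambda>i. x i - lap n m x x i) = 0"
    proof (rule DERIV_local_min[OF config_energy_derivative])
      show "x i \<noteq> x j" if "i < n" "j < n" "i \<noteq> j" for i j using nz[OF x that] .
      show "0 < 1 / H" using H by simp
      show "\<forall>s. \<bar>0 - s\<bar> < 1 / H \<longrightarrow> config_energy n m (\<lambda>i. x i + 0 * v i) \<le> config_energy n m (\<lambda>i. x i + s * v i)"
      proof safe
        fix s assume s: "\<bar>0 - s\<bar> < 1 / H"
        have "1 / H \<le> 1" using H by simp
        have "(\<lambda>i. x i + s * v i) \<in> K"
          unfolding KD
        proof (intro conjI allI impI)
          fix i
          have sv: "\<bar>s * v i\<bar> \<le> 1" using s \<open>1 / H \<le> 1\<close> by (simp add: v_def)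
          show "\<bar>x i + s * v i\<bar> \<le> (if i < n then H else 0)"
          proof (cases "i < n")
            case True
            then show ?thesis using xb[of i] sv by simp
          next
            case False
            moreover have "\<bar>x i\<bar> \<le> (if i < n then H else 0)" using x unfolding KD by blast
            ultimately have "x i = 0" "v i = 0" using k by (auto simp: v_def)
            then show ?thesis using False by simp
          qed
        next
          fix j i assume ij: "j < n" "i < j"
          have "\<bar>s * v j - s * v i\<bar> \<le> \<bar>s\<bar>" using ij by (simp add: v_def)
          then have "s * v j - s * v i \<ge> - (1 / H)" using s by linarith
          moreover have "2 / H = 1 / H + 1 / H" by simp
          ultimately show "1 / H \<le> x j + s * v j - (x i + s * v i)"
            using xg[OF ij] by linarith
        qed
        then show "config_energy n m (\<lambda>i. x i + 0 * v i) \<le> config_energy n m (\<lambda>i. x i + s * v i)"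
          using min[of "\<lambda>i. x i + s * v i"] by simp
      qed
    qed
    then have "m k * (x k - lap n m x x k) = 0"
      unfolding v_def [abs_def] wip_unit[OF k] .
    moreover have "m k \<noteq> 0" using m(1)[OF k] by simp
    ultimately show ?thesis by simp
  qed
  have "\<bar>x i\<bar> \<le> H" if "i < n" for i using xb[OF that] by linarith
  moreover have "\<forall>j<n. \<forall>i<j. 1 / H \<le> x j - x i"
    using x unfolding KD by (rule conjunct2)
  ultimately show ?thesis using crit by blast
qed

section \<open>Eigenvectors of the linearized attraction\<close>

definition eigensystem ::
    "nat \<Rightarrow> (nat \<Rightarrow> real) \<Rightarrow> (nat \<Rightarrow> real) \<Rightarrow> nat \<Rightarrow> (nat \<Rightarrow> nat \<Rightarrow> real) \<Rightarrow> (nat \<Rightarrow> real) \<Rightarrow> bool" where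
  "eigensystem n m x K e mu \<longleftrightarrow>
     (\<forall>k<K. \<forall>l<K. wip n m (e k) (e l) = (if k = l then 1 else 0)) \<and>
     (\<forall>k<K. \<forall>i<n. lap n m x (e k) i = mu k * e k i)"

lemma wip_nonneg: "\<forall>i<n. 0 < m i \<Longrightarrow> 0 \<le> wip n m u u"
  unfolding wip_def by (intro sum_nonneg) (auto simp: mult.assoc less_imp_le)

lemma wip_zero_iff: "\<forall>i<n. 0 < m i \<Longrightarrow> wip n m u u = 0 \<longleftrightarrow> (\<forall>i<n. u i = 0)"
proof -
  assume m: "\<forall>i<n. 0 < m i"
  have "wip n m u u = 0 \<longleftrightarrow> (\<forall>i\<in>{..<n}. m i * u i * u i = 0)"
    unfolding wip_def by (rule sum_nonneg_eq_0_iff) (use m in \<open>auto simp: mult.assoc less_imp_le\<close>)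
  also have "\<dots> \<longleftrightarrow> (\<forall>i<n. u i = 0)" using m by force
  finally show ?thesis .
qed

text \<open>
  The residual of the unit vector at \<open>i\<close>: summing its weighted square norms over \<open>i\<close> compares the
  number of orthonormal vectors with the dimension, which replaces a dimension argument.
\<close>

definition unit_residual :: "(nat \<Rightarrow> real) \<Rightarrow> nat \<Rightarrow> (nat \<Rightarrow> nat \<Rightarrow> real) \<Rightarrow> nat \<Rightarrow> nat \<Rightarrow> real" where
  "unit_residual m K e i j = (if j = i then 1 else 0) - (\<Sum>k<K. m i * e k i * e k j)"

text \<open>As \<open>m i * e k i\<close> is the product of the unit vector with \<open>e k\<close>,
  the residual is its projection off the span of the system. Its squared norm is \<open>m i\<close>
  times its own \<open>i\<close>-th entry, and the sum of these entries is the trace of the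
  projection, that is the codimension.\<close>

lemma wip_unit_residual:
  assumes "eigensystem n m x K e mu" "i < n"
  shows "wip n m (unit_residual m K e i) w = m i * w i - (\<Sum>k<K. m i * e k i * wip n m (e k) w)"
    and "k < K \<Longrightarrow> wip n m (unit_residual m K e i) (e k) = 0"
    and "wip n m (unit_residual m K e i) (unit_residual m K e i) = m i * unit_residual m K e i i"
    and "(\<Sum>i<n. unit_residual m K e i i) = real n - real K"
proof -
  show 1: "wip n m (unit_residual m K e i) w = m i * w i - (\<Sum>k<K. m i * e k i * wip n m (e k) w)" for w
    unfolding unit_residual_def [abs_def] wip_diff wip_unit[OF assms(2)] wip_sum wip_scale ..
  show 2: "wip n m (unit_residual m K e i) (e k) = 0" if "k < K" for k
  proof -
    have "(\<Sum>l<K. m i * e l i * wip n m (e l) (e k)) = (\<Sum>l<K. if l = k then m i * e l i else 0)"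
      using assms(1) that by (intro sum.cong) (auto simp: eigensystem_def)
    then show ?thesis using that by (simp add: 1)
  qed
  have "wip n m (e k) (unit_residual m K e i) = 0" if "k < K" for k
    using 2[OF that] by (simp add: wip_commute)
  then show "wip n m (unit_residual m K e i) (unit_residual m K e i) = m i * unit_residual m K e i i"
    by (simp add: 1[of "unit_residual m K e i"])
  have "(\<Sum>i<n. \<Sum>k<K. m i * e k i * e k i) = (\<Sum>k<K. \<Sum>i<n. m i * e k i * e k i)"
    by (rule sum.swap)
  also have "\<dots> = (\<Sum>k<K. 1)"
    using assms(1) by (intro sum.cong) (auto simp: eigensystem_def wip_def)
  finally show "(\<Sum>i<n. unit_residual m K e i i) = real n - real K"
    by (simp add: unit_residual_def sum_subtractf)
qed

text \<open>For \<open>n\<close> vectors the trace is 0. It is a sum of nonnegative entries, so all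
  residuals vanish.\<close>

lemma eigensystem_complete:
  assumes sys: "eigensystem n m x n e mu" and m: "\<forall>i<n. 0 < m i" and i: "i < n" and j: "j < n"
  shows "(\<Sum>k<n. m i * e k i * e k j) = (if j = i then 1 else 0)"
proof -
  have nn: "0 \<le> unit_residual m n e i i" if "i < n" for i
  proof -
    have "0 \<le> m i * unit_residual m n e i i"
      using wip_nonneg[OF m] unfolding wip_unit_residual(3)[OF sys that, symmetric] .
    then show ?thesis using m that by (auto simp: zero_le_mult_iff)
  qed
  have "(\<Sum>i<n. unit_residual m n e i i) = 0" using wip_unit_residual(4)[OF sys i] by simp
  then have "unit_residual m n e i i = 0"
    using sum_nonneg_eq_0_iff[of "{..<n}" "\<lambda>i. unit_residual m n e i i"] nn i by auto
  then have "wip n m (unit_residual m n e i) (unit_residual m n e i) = 0"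
    using wip_unit_residual(3)[OF sys i] by simp
  then have "unit_residual m n e i j = 0" using wip_zero_iff[OF m] j by blast
  then show ?thesis by (simp add: unit_residual_def)
qed

lemma wip_lap_scale: "wip n m (\<lambda>i. c * u i) (lap n m x (\<lambda>i. c * u i)) = c\<^sup>2 * wip n m u (lap n m x u)"
  unfolding wip_lap
  by (simp add: sum_distrib_left sum_divide_distrib power2_eq_square algebra_simps)

text \<open>The first order condition at a minimum in algebraic form: for
  \<open>s = - b / (\<bar>c\<bar> + 1)\<close> the linear term beats the quadratic one.\<close>

lemma quadratic_nonneg_imp_zero:
  fixes b c :: real
  assumes "\<And>s. 0 \<le> 2 * s * b + s\<^sup>2 * c"
  shows "b = 0"
proof (rule ccontr)
  assume "b \<noteq> 0"
  define a where "a = \<bar>c\<bar> + 1"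
  define s where "s = - b / a"
  have a: "0 < a" "c \<le> a" by (auto simp: a_def)
  have "s\<^sup>2 * c \<le> s\<^sup>2 * a" using a by (intro mult_left_mono) auto
  moreover have "s\<^sup>2 * a = b\<^sup>2 / a"
    using a by (simp add: s_def power2_eq_square)
  moreover have "2 * s * b = - 2 * (b\<^sup>2 / a)" by (simp add: s_def power2_eq_square)
  moreover have "0 < b\<^sup>2 / a" using \<open>b \<noteq> 0\<close> a by (intro divide_pos_pos) auto
  ultimately show False using assms[of s] by linarith
qed

lemma lap_add: "lap n m x (\<lambda>i. u i + v i) j = lap n m x u j + lap n m x v j"
  by (simp add: lap_def sum.distrib[symmetric] algebra_simps add_divide_distrib[symmetric])

lemma lap_scale: "lap n m x (\<lambda>i. c * u i) j = c * lap n m x u j"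
  by (simp add: lap_def sum_distrib_left algebra_simps)

text \<open>The Rayleigh quotient is minimized on the unit sphere of the orthogonal complement,
  which is nonempty because the trace \<open>n - K\<close> is not 0 and compact because masses at
  least 1 put unit vectors into a box. The residual \<open>w = lap u - c u\<close> is again
  orthogonal to the earlier vectors, hence an admissible variation, and the first order condition in
  its own direction reads \<open>wip n m w w = 0\<close>.\<close>

lemma eigensystem_extend:
  assumes sys: "eigensystem n m x K e mu" and K: "K < n" and m: "\<And>i. i < n \<Longrightarrow> 1 \<le> m i"
  shows "\<exists>u c. eigensystem n m x (Suc K) (e(K := u)) (mu(K := c))"
proof -
  have m0: "\<forall>i<n. 0 < m i" using m by (auto intro: less_le_trans[OF zero_less_one])
  define C where "C = {u. \<forall>i. \<bar>u i\<bar> \<le> (if i < n then 1 else 0)} \<inter> {u. wip n m u u = 1}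
    \<inter> (\<Inter>l\<in>{..<K}. {u. wip n m u (e l) = 0})"
  have C: "u \<in> C \<longleftrightarrow> (\<forall>i. \<bar>u i\<bar> \<le> (if i < n then 1 else 0)) \<and> wip n m u u = 1 \<and> (\<forall>l<K. wip n m u (e l) = 0)" for u
    by (auto simp: C_def)
  have lapc: "continuous_on S (\<lambda>u. lap n m x u i)" for S i
    unfolding lap_def divide_inverse by (intro continuous_intros)
  have cC: "compact C"
    unfolding C_def wip_def
    by (intro compact_Int_closed compact_box closed_INT ballI closed_Collect_eq continuous_intros)
  define q where "q u = wip n m u (lap n m x u)" for u
  have qc: "continuous_on C q"
    unfolding q_def wip_def by (intro continuous_intros lapc)
  have normalize: "\<exists>c. (\<lambda>i. c * (if i < n then u i else 0)) \<in> C \<and> c\<^sup>2 * wip n m u u = 1"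
    if u: "\<And>l. l < K \<Longrightarrow> wip n m u (e l) = 0" and nz: "wip n m u u \<noteq> 0" for u
  proof -
    define c where "c = 1 / sqrt (wip n m u u)"
    define v where "v i = c * (if i < n then u i else 0)" for i
    have pos: "0 < wip n m u u" using nz wip_nonneg[OF m0, of u] by simp
    then have cc: "c\<^sup>2 * wip n m u u = 1" by (simp add: c_def power_divide)
    have w: "wip n m v w = c * wip n m u w" for w
      unfolding wip_scale[symmetric] by (rule wip_cong) (auto simp: v_def)
    have w1: "wip n m v v = 1"
      using cc by (simp add: w wip_commute[of n m u v] power2_eq_square mult.assoc)
    have "\<bar>v i\<bar> \<le> 1" if "i < n" for i
    proof -
      have "1 * (v i)\<^sup>2 \<le> m i * (v i)\<^sup>2" using m[OF that] by (intro mult_right_mono) auto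
      also have "\<dots> \<le> (\<Sum>i<n. m i * (v i)\<^sup>2)"
        using that m0 by (intro member_le_sum) (auto simp: less_imp_le)
      also have "\<dots> = 1" using w1 by (simp add: wip_def power2_eq_square mult.assoc)
      finally show ?thesis by (simp add: abs_square_le_1)
    qed
    then have "v \<in> C" using w w1 u by (auto simp: C v_def)
    with cc show ?thesis by (auto simp: v_def [abs_def])
  qed
  have "C \<noteq> {}"
  proof -
    have "(\<Sum>i<n. unit_residual m K e i i) \<noteq> 0" using wip_unit_residual(4)[OF sys] K by simp
    then obtain i where i: "i < n" "unit_residual m K e i i \<noteq> 0" by (meson lessThan_iff sum.neutral)
    then have "wip n m (unit_residual m K e i) (unit_residual m K e i) \<noteq> 0"
      using wip_unit_residual(3)[OF sys i(1)] m0 i(1) by auto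
    then show ?thesis using normalize[of "unit_residual m K e i"] wip_unit_residual(2)[OF sys i(1)] by blast
  qed
  then obtain u where u: "u \<in> C" and min: "\<And>v. v \<in> C \<Longrightarrow> q u \<le> q v"
    using continuous_attains_inf[OF cC _ qc] by blast
  define c where "c = q u"
  have u1: "wip n m u u = 1" and uo: "\<And>l. l < K \<Longrightarrow> wip n m u (e l) = 0" using u by (auto simp: C)
  have ineq: "c * wip n m v v \<le> q v" if v: "\<And>l. l < K \<Longrightarrow> wip n m v (e l) = 0" for v
  proof (cases "wip n m v v = 0")
    case True
    then have "\<forall>i<n. v i = 0" using wip_zero_iff[OF m0] by blast
    then have "q v = 0" by (simp add: q_def wip_def)
    then show ?thesis using True by simp
  next
    case False
    from normalize[OF v False] obtain b where b: "(\<lambda>i. b * (if i < n then v i else 0)) \<in> C"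
      "b\<^sup>2 * wip n m v v = 1" by blast
    \<comment> \<open>Entries beyond \<open>n\<close> are cut off because \<open>C\<close> wants
      them to be 0; the form \<open>q\<close> does not see them.\<close>
    have "lap n m x (\<lambda>i. if i < n then v i else 0) i = lap n m x v i" if "i < n" for i
      using that by (simp add: lap_def)
    then have "q (\<lambda>i. if i < n then v i else 0) = q v"
      unfolding q_def by (intro wip_cong) auto
    then have "q (\<lambda>i. b * (if i < n then v i else 0)) = b\<^sup>2 * q v"
      unfolding q_def wip_lap_scale by simp
    then have "c \<le> b\<^sup>2 * q v" using min[OF b(1)] by (simp add: c_def)
    then have "c * wip n m v v \<le> b\<^sup>2 * q v * wip n m v v"
      using wip_nonneg[OF m0] by (intro mult_right_mono) auto
    also have "\<dots> = (b\<^sup>2 * wip n m v v) * q v" by (simp add: algebra_simps)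
    finally show ?thesis using b(2) by simp
  qed
  define w where "w i = lap n m x u i - c * u i" for i
  have lo: "wip n m (lap n m x u) (e l) = 0" if "l < K" for l
  proof -
    have "wip n m (lap n m x u) (e l) = wip n m u (lap n m x (e l))" by (rule wip_lap_commute[symmetric])
    also have "\<dots> = wip n m u (\<lambda>i. mu l * e l i)"
      using sys that by (intro wip_cong) (auto simp: eigensystem_def)
    also have "\<dots> = 0" using uo[OF that] by (simp add: wip_commute[of n m u] wip_scale)
    finally show ?thesis .
  qed
  have wo: "wip n m w (e l) = 0" if "l < K" for l
    unfolding w_def [abs_def] wip_diff wip_scale using lo uo that by simp
  have "wip n m w w = 0"
  proof (rule quadratic_nonneg_imp_zero)
    fix s :: real
    have "c * wip n m (\<lambda>i. u i + s * w i) (\<lambda>i. u i + s * w i) \<le> q (\<lambda>i. u i + s * w i)"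
      by (rule ineq) (use wo uo in \<open>simp add: wip_add wip_scale\<close>)
    moreover have "wip n m (\<lambda>i. u i + s * w i) (\<lambda>i. u i + s * w i) = 1 + 2 * s * wip n m w u + s\<^sup>2 * wip n m w w"
      unfolding wip_add wip_scale wip_commute[of n m _ "\<lambda>i. u i + s * w i"]
      unfolding wip_commute[of n m u w] by (simp add: u1 algebra_simps power2_eq_square)
    moreover have "q (\<lambda>i. u i + s * w i) = c + 2 * s * wip n m w (lap n m x u) + s\<^sup>2 * q w"
    proof -
      have "q (\<lambda>i. u i + s * w i) = wip n m (\<lambda>i. lap n m x u i + s * lap n m x w i) (\<lambda>i. u i + s * w i)"
        unfolding q_def wip_commute[of n m "\<lambda>i. u i + s * w i"]
        by (intro wip_cong) (simp_all add: lap_add lap_scale)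
      also have "\<dots> = wip n m (\<lambda>i. u i + s * w i) (lap n m x u) + s * wip n m (\<lambda>i. u i + s * w i) (lap n m x w)"
        by (simp add: wip_add[of n m "lap n m x u"] wip_scale[of n m s "lap n m x w"] wip_commute[of n m _ "\<lambda>i. u i + s * w i"])
      also have "\<dots> = (c + s * wip n m w (lap n m x u)) + s * (wip n m u (lap n m x w) + s * q w)"
        by (simp add: wip_add wip_scale q_def c_def)
      also have "wip n m u (lap n m x w) = wip n m w (lap n m x u)"
        unfolding wip_lap_commute[of n m u] by (rule wip_commute)
      finally show ?thesis by (simp add: algebra_simps power2_eq_square)
    qed
    moreover have "wip n m w (lap n m x u) = wip n m w w + c * wip n m w u"
    proof -
      have "wip n m (\<lambda>i. lap n m x u i - c * u i) w = wip n m w w" by (simp add: w_def [abs_def])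
      then show ?thesis
        unfolding wip_diff wip_scale wip_commute[of n m "lap n m x u" w] wip_commute[of n m u w] by simp
    qed
    ultimately show "0 \<le> 2 * s * wip n m w w + s\<^sup>2 * (q w - c * wip n m w w)"
      by (simp add: algebra_simps)
  qed
  then have "\<forall>i<n. w i = 0" using wip_zero_iff[OF m0] by blast
  then have "\<forall>i<n. lap n m x u i = c * u i" by (simp add: w_def)
  then have "eigensystem n m x (Suc K) (e(K := u)) (mu(K := c))"
    using sys u1 uo unfolding eigensystem_def
    by (auto simp: less_Suc_eq wip_commute[of n m "e _" u])
  then show ?thesis by blast
qed


lemma eigensystem_bound:
  assumes "\<forall>i<n. 1 \<le> m i" "wip n m u u = 1" "i < n"
  shows "\<bar>u i\<bar> \<le> 1"
proof -
  have m0: "0 \<le> m j" if "j < n" for j using order_trans[OF zero_le_one, of "m j"] assms(1) that by blast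
  have "1 * (u i)\<^sup>2 \<le> m i * (u i)\<^sup>2" using assms by (intro mult_right_mono) auto
  also have "\<dots> \<le> (\<Sum>i<n. m i * (u i)\<^sup>2)"
    using m0 assms(3) by (intro member_le_sum) auto
  also have "\<dots> = 1" using assms(2) by (simp add: wip_def power2_eq_square mult.assoc)
  finally show ?thesis by (simp add: abs_square_le_1)
qed

section \<open>Conley's spectral gap in quantitative form\<close>

lemma inverse_cube_gap:
  fixes r R H :: real
  assumes "0 < H" "0 < r" "r + 1 / H \<le> R" "R \<le> 2 * H"
  shows "1 / (16 * H ^ 5) \<le> 1 / r ^ 3 - 1 / R ^ 3"
proof -
  have R: "r \<le> R" "0 < R" "1 / H \<le> R - r" using assms divide_pos_pos[of 1 H] by linarith+
  have "r ^ 3 * R \<le> (2 * H) ^ 3 * (2 * H)"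
    using assms R by (intro mult_mono power_mono) auto
  then have "1 / ((2 * H) ^ 3 * (2 * H)) \<le> 1 / (r ^ 3 * R)"
    using assms R by (intro divide_left_mono) auto
  then have "1 / H * (1 / ((2 * H) ^ 3 * (2 * H))) \<le> (R - r) * (1 / (r ^ 3 * R))"
    using assms R by (intro mult_mono) auto
  also have "1 / H * (1 / ((2 * H) ^ 3 * (2 * H))) = 1 / (16 * H ^ 5)"
    using assms by (simp add: power_eq_if field_simps)
  also have "(R - r) * (1 / (r ^ 3 * R)) = (R - r) * R\<^sup>2 / (r ^ 3 * R ^ 3)"
    using assms R by (simp add: power_eq_if field_simps)
  also have "\<dots> \<le> (R ^ 3 - r ^ 3) / (r ^ 3 * R ^ 3)"
  proof (rule divide_right_mono)
    have "r * r\<^sup>2 \<le> r * R\<^sup>2" using assms R by (intro mult_left_mono power_mono) auto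
    then show "(R - r) * R\<^sup>2 \<le> R ^ 3 - r ^ 3"
      by (simp add: algebra_simps power2_eq_square power3_eq_cube)
  qed (use assms R in auto)
  also have "\<dots> = 1 / r ^ 3 - 1 / R ^ 3" using assms R by (simp add: field_simps)
  finally show ?thesis .
qed

text \<open>
  Conley's argument: with \<open>a\<close> the largest slope of the eigenvector \<open>u\<close> against \<open>x\<close>, the vector
  \<open>a x - u\<close> is nondecreasing along the line and has two equal consecutive entries; comparing the
  attraction on these two entries bounds the eigenvalue from below.
\<close>

lemma spectral_gap_aux:
  assumes m: "\<forall>i<n. 1 \<le> m i" "\<forall>i<n. m i \<le> 2" and H: "1 \<le> H"
    and x: "\<forall>i<n. \<bar>x i\<bar> \<le> H" "\<forall>j<n. \<forall>i<j. 1 / H \<le> x j - x i" "\<forall>i<n. lap n m x x i = x i"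
    and u: "\<forall>i<n. lap n m x u i = c * u i" "wip n m u x = 0"
    and inc: "\<exists>i. Suc i < n \<and> u i < u (Suc i)"
  shows "1 / (16 * H ^ 5) * wip n m x x \<le> (c - 1) * (4 * H\<^sup>2)"
proof -
  have H0: "0 < 1 / H" using H by simp
  have xi: "x i < x j" if "j < n" "i < j" for i j 
  proof -
    have "1 / H \<le> x j - x i" using x(2) that by blast
    then show ?thesis using H0 by linarith
  qed
  define slope where "slope i = (u (Suc i) - u i) / (x (Suc i) - x i)" for i
  define A where "A = {i. Suc i < n}"
  have finA: "finite (slope ` A)"
  proof -
    have "A \<subseteq> {..n}" by (auto simp: A_def)
    then show ?thesis using finite_subset by blast
  qed
  have "A \<noteq> {}" using inc by (auto simp: A_def)
  then have "Max (slope ` A) \<in> slope ` A" using finA by simp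
  then obtain k where k: "k \<in> A" and kmax': "slope k = Max (slope ` A)" by auto
  have kmax: "slope i \<le> slope k" if "i \<in> A" for i
    unfolding kmax' using finA that by (intro Max_ge) auto
  have kn: "Suc k < n" "k < n" using k by (auto simp: A_def)
  define a where "a = slope k"
  define d where "d = x (Suc k) - x k"
  have d: "0 < d" "d \<le> 2 * H" 
  proof -
    show "0 < d" using xi[of "Suc k" k] kn by (simp add: d_def)
    have "\<bar>x (Suc k)\<bar> \<le> H" "\<bar>x k\<bar> \<le> H" using x(1) kn by auto
    then show "d \<le> 2 * H" unfolding d_def by linarith
  qed
  have a0: "0 < a"
  proof -
    obtain i where i: "Suc i < n" "u i < u (Suc i)" using inc by blast
    then have "0 < slope i" using xi[of "Suc i" i] by (simp add: slope_def)
    also have "slope i \<le> a" using kmax[of i] i by (simp add: a_def A_def)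
    finally show ?thesis .
  qed
  define h where "h i = a * x i - u i" for i
  have hs: "h i \<le> h (Suc i)" if "Suc i < n" for i
  proof -
    have "u (Suc i) - u i = slope i * (x (Suc i) - x i)"
      using xi[of "Suc i" i] that by (simp add: slope_def)
    also have "\<dots> \<le> a * (x (Suc i) - x i)"
      using kmax[of i] that xi[of "Suc i" i] by (intro mult_right_mono) (auto simp: a_def A_def)
    finally show ?thesis by (simp add: h_def algebra_simps)
  qed
  have hm: "i \<le> j \<Longrightarrow> j < n \<Longrightarrow> h i \<le> h j" for i j
  proof (induction j rule: dec_induct)
    case (step l)
    then show ?case using hs[of l] by simp
  qed simp
  have ud: "u (Suc k) - u k = a * d"
    using d by (simp add: a_def slope_def d_def)
  have hk: "h (Suc k) = h k" using ud by (simp add: h_def d_def algebra_simps)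
  have lh: "lap n m x h i = a * x i - c * u i" if "i < n" for i
  proof -
    have "lap n m x h i = a * lap n m x x i + (-1) * lap n m x u i"
      unfolding lap_scale[symmetric] lap_add[symmetric] by (simp add: h_def [abs_def])
    then show ?thesis using x(3) u(1) that by simp
  qed
  define S where "S = (\<Sum>j<n. \<bar>h j - h k\<bar>)"
  have S: "0 \<le> S" unfolding S_def by (intro sum_nonneg) auto
  \<comment> \<open>To the left of both entries \<open>k\<close> is the nearer one and
    \<open>h k - h j\<close> is nonnegative; to the right both signs are reversed. For
    \<open>j = k\<close> and \<open>j = Suc k\<close> the difference of \<open>h\<close> is 0, so
    the self-interaction and the pair itself drop out.\<close>
  have summand: "1 / (16 * H ^ 5) * \<bar>h j - h k\<bar>
      \<le> m j * ((h k - h j) * (1 / \<bar>x k - x j\<bar> ^ 3 - 1 / \<bar>x (Suc k) - x j\<bar> ^ 3))" if j: "j < n" for j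
  proof -
    consider "j < k" | "j = k \<or> j = Suc k" | "Suc k < j" by linarith
    then show ?thesis
    proof cases
      case 1
      have "1 / (16 * H ^ 5) \<le> 1 / \<bar>x k - x j\<bar> ^ 3 - 1 / \<bar>x (Suc k) - x j\<bar> ^ 3"
      proof (rule inverse_cube_gap)
        have le: "x j < x k" "x k < x (Suc k)" using xi 1 kn by auto
        have "1 / H \<le> x (Suc k) - x k" using x(2) kn by blast
        then show "\<bar>x k - x j\<bar> + 1 / H \<le> \<bar>x (Suc k) - x j\<bar>" using le by simp
        have "\<bar>x (Suc k)\<bar> \<le> H" "\<bar>x j\<bar> \<le> H" using x(1) kn j by auto
        then show "\<bar>x (Suc k) - x j\<bar> \<le> 2 * H" by linarith
      qed (use H xi[of k j] 1 kn in auto)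
      moreover have "0 \<le> h k - h j" using hm[of j k] 1 kn by simp
      ultimately have "1 * ((h k - h j) * (1 / (16 * H ^ 5)))
        \<le> m j * ((h k - h j) * (1 / \<bar>x k - x j\<bar> ^ 3 - 1 / \<bar>x (Suc k) - x j\<bar> ^ 3))"
        using m(1) j H by (intro mult_mono mult_left_mono) auto
      then show ?thesis using \<open>0 \<le> h k - h j\<close> by (simp add: abs_minus_commute mult.commute)
    next
      case 2
      then show ?thesis using hk by auto
    next
      case 3
      have "1 / (16 * H ^ 5) \<le> 1 / \<bar>x (Suc k) - x j\<bar> ^ 3 - 1 / \<bar>x k - x j\<bar> ^ 3"
      proof (rule inverse_cube_gap)
        have le: "x (Suc k) < x j" "x k < x (Suc k)" using xi 3 kn j by auto
        have "1 / H \<le> x (Suc k) - x k" using x(2) kn by blast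
        then show "\<bar>x (Suc k) - x j\<bar> + 1 / H \<le> \<bar>x k - x j\<bar>" using le by simp
        have "\<bar>x k\<bar> \<le> H" "\<bar>x j\<bar> \<le> H" using x(1) kn j by auto
        then show "\<bar>x k - x j\<bar> \<le> 2 * H" by linarith
      qed (use H xi[of j "Suc k"] 3 j in auto)
      moreover have "0 \<le> h j - h k" using hm[of k j] 3 j by simp
      ultimately have "1 * ((h j - h k) * (1 / (16 * H ^ 5)))
        \<le> m j * ((h j - h k) * (1 / \<bar>x (Suc k) - x j\<bar> ^ 3 - 1 / \<bar>x k - x j\<bar> ^ 3))"
        using m(1) j H by (intro mult_mono mult_left_mono) auto
      also have "(h j - h k) * (1 / \<bar>x (Suc k) - x j\<bar> ^ 3 - 1 / \<bar>x k - x j\<bar> ^ 3)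
        = (h k - h j) * (1 / \<bar>x k - x j\<bar> ^ 3 - 1 / \<bar>x (Suc k) - x j\<bar> ^ 3)" by argo
      finally show ?thesis using \<open>0 \<le> h j - h k\<close> by (simp add: mult.commute)
    qed
  qed
  have "1 / (16 * H ^ 5) * S \<le> (\<Sum>j<n. m j * ((h k - h j) * (1 / \<bar>x k - x j\<bar> ^ 3 - 1 / \<bar>x (Suc k) - x j\<bar> ^ 3)))"
    unfolding S_def sum_distrib_left by (intro sum_mono summand) simp
  also have "\<dots> = lap n m x h k - lap n m x h (Suc k)"
    unfolding lap_def sum_subtractf[symmetric] hk by (intro sum.cong refl) (simp add: algebra_simps)
  also have "\<dots> = c * (u (Suc k) - u k) - a * d"
    using lh kn by (simp add: d_def algebra_simps)
  also have "\<dots> = a * ((c - 1) * d)" unfolding ud by (simp add: algebra_simps)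
  finally have main: "1 / (16 * H ^ 5) * S \<le> a * ((c - 1) * d)" .
  moreover have "0 \<le> 1 / (16 * H ^ 5) * S" using S H by simp
  ultimately have "0 \<le> a * ((c - 1) * d)" by linarith
  \<comment> \<open>The sign is needed first: it permits replacing the gap \<open>d\<close> by its
    upper bound \<open>2 * H\<close> at the end.\<close>
  then have c1: "0 \<le> c - 1" using a0 d by (simp add: zero_le_mult_iff)
  have "wip n m (\<lambda>i. 1) x = wip n m (\<lambda>i. 1) (lap n m x x)" using x(3) by (intro wip_cong) auto
  then have x1: "wip n m (\<lambda>i. 1) x = 0" by (simp add: wip_lap)
  \<comment> \<open>This bounds \<open>S\<close> from below. Both \<open>u\<close> and the constants
    are orthogonal to \<open>x\<close>, so \<open>a * x\<close> may be replaced by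
    \<open>h - h k\<close> in the product with \<open>x\<close>.\<close>
  have "a * wip n m x x = wip n m (\<lambda>i. h i - h k * 1) x"
    unfolding wip_diff wip_scale h_def using u(2) x1 by (simp add: wip_diff wip_scale)
  also have "\<dots> \<le> (\<Sum>j<n. 2 * H * \<bar>h j - h k\<bar>)"
    unfolding wip_def
  proof (rule sum_mono)
    fix j assume j: "j \<in> {..<n}"
    have "m j * (h j - h k * 1) * x j \<le> \<bar>m j * (h j - h k) * x j\<bar>" by simp
    also have "\<dots> = m j * \<bar>h j - h k\<bar> * \<bar>x j\<bar>" using m(1) j by (auto simp: abs_mult)
    also have "\<dots> \<le> 2 * \<bar>h j - h k\<bar> * H"
      using m x(1) j by (intro mult_mono) auto
    finally show "m j * (h j - h k * 1) * x j \<le> 2 * H * \<bar>h j - h k\<bar>" by (simp add: mult_ac)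
  qed
  finally have aI: "a * wip n m x x \<le> 2 * H * S" by (simp add: S_def sum_distrib_left)
  have "a * (1 / (16 * H ^ 5) * wip n m x x) = 1 / (16 * H ^ 5) * (a * wip n m x x)" by simp
  also have "\<dots> \<le> 1 / (16 * H ^ 5) * (2 * H * S)" using aI H by (intro mult_left_mono) auto
  also have "\<dots> = 2 * H * (1 / (16 * H ^ 5) * S)" by simp
  also have "\<dots> \<le> 2 * H * (a * ((c - 1) * d))" using main H by (intro mult_left_mono) auto
  also have "\<dots> \<le> 2 * H * (a * ((c - 1) * (2 * H)))"
    using c1 d a0 H by (intro mult_left_mono) auto
  also have "\<dots> = a * ((c - 1) * (4 * H\<^sup>2))" by (simp add: power2_eq_square)
  finally show ?thesis using a0 by (rule mult_left_le_imp_le)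
qed

text \<open>Either \<open>u\<close> or \<open>- u\<close> increases somewhere along the line; a
  constant vector cannot be of norm 1 and orthogonal to the constants.\<close>

lemma spectral_gap:
  assumes m: "\<forall>i<n. 1 \<le> m i" "\<forall>i<n. m i \<le> 2" and H: "1 \<le> H" and n: "2 \<le> n"
    and x: "\<forall>i<n. \<bar>x i\<bar> \<le> H" "\<forall>j<n. \<forall>i<j. 1 / H \<le> x j - x i" "\<forall>i<n. lap n m x x i = x i"
    and u: "\<forall>i<n. lap n m x u i = c * u i" "wip n m u x = 0" "wip n m u (\<lambda>i. 1) = 0" "wip n m u u = 1"
  shows "1 / (16 * H ^ 5) * wip n m x x \<le> (c - 1) * (4 * H\<^sup>2)"
proof -
  consider "\<exists>i. Suc i < n \<and> u i < u (Suc i)" | "\<exists>i. Suc i < n \<and> - u i < - u (Suc i)"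
    | "\<forall>i. Suc i < n \<longrightarrow> u i = u (Suc i)" by force
  then show ?thesis
  proof cases
    case 1
    show ?thesis by (rule spectral_gap_aux[OF m H x u(1,2) 1])
  next
    case 2
    have "lap n m x (\<lambda>i. - u i) j = - lap n m x u j" for j
      using lap_scale[of n m x "-1" u j] by simp
    moreover have "wip n m (\<lambda>i. - u i) x = 0" using wip_scale[of n m "-1" u x] u(2) by simp
    moreover have "\<forall>i<n. lap n m x (\<lambda>i. - u i) i = c * - u i"
      using u(1) calculation(1) by (simp only: mult_minus_right) simp
    ultimately show ?thesis
      by (intro spectral_gap_aux[OF m H x _ _ 2])
  next
    case 3
    have c0: "i < n \<Longrightarrow> u i = u 0 * 1" for i
    proof (induction i)
      case (Suc i)
      then have "u i = u (Suc i)" "u i = u 0 * 1" using 3 by auto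
      then show ?case by metis
    qed simp
    have s: "wip n m u u = wip n m (\<lambda>i. u 0 * 1) u"
      by (rule wip_cong[OF c0 refl])
    have "wip n m u u = u 0 * wip n m (\<lambda>i. 1) u"
      using s unfolding wip_scale .
    then show ?thesis using u(3,4) wip_commute[of n m "\<lambda>i. 1" u] by simp
  qed
qed

text \<open>The gap of the eigenvalues is at least \<open>1 / (256 H^9)\<close>, the product of
  \<open>1 / (16 H^5)\<close>, the lower bound \<open>1 / (4 H^2)\<close> of the moment of inertia,
  and a division by \<open>4 H^2\<close>. The factor \<open>n^2\<close> makes the same number
  dominate \<open>8 H^3 n^2\<close>, an upper bound of the eigenvalues by the Dirichlet
  form.\<close>

definition spectral_bound :: "nat \<Rightarrow> real" where
  "spectral_bound n = 256 * config_bound n ^ 9 * (real n)\<^sup>2"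

theorem collinear_spectral_data:
  assumes n: "2 \<le> n" and m: "\<forall>i<n. 1 \<le> m i" "\<forall>i<n. m i \<le> 2"
  defines "G \<equiv> spectral_bound n"
  shows "\<exists>x e mu. eigensystem n m x n e mu \<and>
    (\<forall>i<n. \<bar>x i\<bar> \<le> G) \<and> (\<forall>i<n. \<forall>j<n. i \<noteq> j \<longrightarrow> 1 / G \<le> \<bar>x i - x j\<bar>) \<and> (\<forall>i<n. lap n m x x i = x i) \<and>
    (\<forall>i<n. e 0 i = 1 / sqrt (\<Sum>j<n. m j)) \<and> (\<forall>i<n. x i = sqrt (wip n m x x) * e 1 i) \<and> mu 1 = 1 \<and>
    1 / G \<le> sqrt (wip n m x x) \<and> (\<forall>k. 2 \<le> k \<longrightarrow> k < n \<longrightarrow> 1 + 1 / G \<le> mu k \<and> mu k \<le> G)"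
proof -
  define H where "H = config_bound n"
  have H: "32 \<le> H" unfolding H_def by (rule config_bound_ge[OF n])
  have n2: "1 \<le> (real n)\<^sup>2" using n by (simp add: one_le_power)
  have pow: "H ^ k \<le> H ^ 9" if "k \<le> 9" for k using that H by (intro power_increasing) auto
  have GH: "256 * H ^ 9 \<le> G" unfolding G_def spectral_bound_def H_def[symmetric]
    using n2 H by (simp add: mult_le_cancel_left1)
  have "1 \<le> H ^ 9" using pow[of 0] by simp
  then have G: "H \<le> G" "256 \<le> G" "0 < G" "2 * H \<le> G" using GH pow[of 1] by auto
  have m0: "\<forall>i<n. 0 < m i" using m(1) by (auto intro: less_le_trans[OF zero_less_one])
  obtain x where x: "\<forall>i<n. \<bar>x i\<bar> \<le> H" "\<forall>j<n. \<forall>i<j. 1 / H \<le> x j - x i" "\<forall>i<n. lap n m x x i = x i"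
    using collinear_central_configuration[OF n, of m] m unfolding H_def by blast
  define I where "I = wip n m x x"
  define M where "M = (\<Sum>j<n. m j)"
  have "{..<n} \<noteq> {}" using n by (metis lessThan_empty_iff not_numeral_le_zero bot_nat_def)
  then have M: "0 < M" unfolding M_def using m0 by (intro sum_pos) auto
  have I1: "1 / (4 * H\<^sup>2) \<le> I"
  proof -
    have g: "1 / H \<le> x 1 - x 0" using x(2) n by simp
    have mx: "(x i)\<^sup>2 \<le> m i * (x i)\<^sup>2" if "i < n" for i
      using mult_right_mono[of 1 "m i" "(x i)\<^sup>2"] m(1) that by simp
    have "(\<Sum>i\<in>{0,1}. m i * (x i)\<^sup>2) \<le> (\<Sum>i<n. m i * (x i)\<^sup>2)"
      using n m0 by (intro sum_mono2) (auto simp: less_imp_le)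
    also have "\<dots> = I" by (simp add: I_def wip_def power2_eq_square mult.assoc)
    finally have "(x 0)\<^sup>2 + (x 1)\<^sup>2 \<le> I" using mx[of 0] mx[of 1] n by simp
    moreover have "(x 1 - x 0)\<^sup>2 \<le> 2 * (x 0)\<^sup>2 + 2 * (x 1)\<^sup>2"
      using zero_le_power2[of "x 0 + x 1"] by (simp add: power2_eq_square algebra_simps)
    moreover have "(1 / H)\<^sup>2 \<le> (x 1 - x 0)\<^sup>2" using g H by (intro power_mono) auto
    moreover have "1 / (4 * H\<^sup>2) \<le> (1 / H)\<^sup>2 / 2" using H by (simp add: power_divide field_simps)
    ultimately show ?thesis by linarith
  qed
  have "0 < 1 / (4 * H\<^sup>2)" using H by simp
  then have I0: "0 < I" using I1 by linarith
  have sI: "1 / (2 * H) \<le> sqrt I"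
    using H I1 by (intro real_le_rsqrt) (simp add: power_divide power_mult_distrib)
  \<comment> \<open>Translation (eigenvalue 0) and homothety (eigenvalue 1) are put in by hand.
    Every vector added later is orthogonal to both, as the spectral gap requires.\<close>
  define e where "e k i = (if k = 0 then 1 / sqrt M else x i / sqrt I)" for k i :: nat
  define mu where "mu k = (if k = 0 then 0 else 1 :: real)" for k :: nat
  have x1: "wip n m (\<lambda>i. 1) x = 0"
  proof -
    have "wip n m (\<lambda>i. 1) x = wip n m (\<lambda>i. 1) (lap n m x x)" using x(3) by (intro wip_cong) auto
    then show ?thesis by (simp add: wip_lap)
  qed
  have e0: "e 0 = (\<lambda>i. 1 / sqrt M * 1)" and e1: "e (Suc 0) = (\<lambda>i. 1 / sqrt I * x i)" by (auto simp: e_def)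
  have x1': "wip n m x (\<lambda>i. 1) = 0" using x1 wip_commute[of n m x] by simp
  have w11: "wip n m (\<lambda>i. 1) (\<lambda>i. 1) = M" by (simp add: wip_def M_def)
  have sc: "wip n m (\<lambda>i. a * u i) (\<lambda>i. b * v i) = a * b * wip n m u v" for a b u v
    by (simp add: wip_def sum_distrib_left algebra_simps)
  have sys2: "eigensystem n m x 2 e mu"
    unfolding eigensystem_def
  proof (intro conjI allI impI)
    have rr: "1 / sqrt A * (1 / sqrt A) * A = 1" if "0 < A" for A using that by simp
    have w: "wip n m (e 0) (e 0) = 1" "wip n m (e (Suc 0)) (e (Suc 0)) = 1"
      "wip n m (e 0) (e (Suc 0)) = 0" "wip n m (e (Suc 0)) (e 0) = 0"
      unfolding e0 e1 sc w11 x1 x1' I_def[symmetric] by (simp_all only: rr[OF M] rr[OF I0] mult_zero_right)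
    fix k l :: nat assume "k < 2" "l < 2"
    then show "wip n m (e k) (e l) = (if k = l then 1 else 0)"
      using w unfolding less_2_cases_iff One_nat_def by (elim disjE) simp_all
  next
    fix k i assume "k < (2::nat)" "i < n"
    then show "lap n m x (e k) i = mu k * e k i"
      using x(3) unfolding less_2_cases_iff One_nat_def
      by (elim disjE) (simp_all only: e0 e1 lap_scale mu_def, simp_all add: lap_def)
  qed
  have "K \<le> n \<Longrightarrow> \<exists>e' mu'. eigensystem n m x K e' mu' \<and> e' 0 = e 0 \<and> e' 1 = e 1 \<and> mu' 1 = 1" if "2 \<le> K" for K
    using that
  proof (induction K rule: dec_induct)
    case base
    have "mu 1 = 1" by (simp add: mu_def)
    with sys2 show ?case by (intro exI[of _ e] exI[of _ mu] conjI refl)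
  next
    case (step K)
    then obtain e' mu' where s: "eigensystem n m x K e' mu'" "e' 0 = e 0" "e' 1 = e 1" "mu' 1 = 1" by auto
    obtain u c where "eigensystem n m x (Suc K) (e'(K := u)) (mu'(K := c))"
      using eigensystem_extend[OF s(1)] step.prems m(1) by auto
    moreover have "(e'(K := u)) 0 = e 0" "(e'(K := u)) 1 = e 1" "(mu'(K := c)) 1 = 1"
      using s step.hyps by auto
    ultimately show ?case by blast
  qed
  from this[OF n order_refl] obtain e' mu' where
    s: "eigensystem n m x n e' mu'" "e' 0 = e 0" "e' 1 = e 1" "mu' 1 = 1" by auto
  have mub: "1 + 1 / G \<le> mu' k \<and> mu' k \<le> G" if k: "2 \<le> k" "k < n" for k
  proof
    have u: "\<forall>i<n. lap n m x (e' k) i = mu' k * e' k i" "wip n m (e' k) (e' k) = 1"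
      and o: "wip n m (e' k) (e' 0) = 0" "wip n m (e' k) (e' 1) = 0"
      using s(1) k n unfolding eigensystem_def by auto
    have "wip n m (e' k) (e' 0) = 1 / sqrt M * wip n m (e' k) (\<lambda>i. 1)"
      using sc[of 1 "e' k" "1 / sqrt M" "\<lambda>i. 1"] by (simp add: s(2) e0)
    then have o1: "wip n m (e' k) (\<lambda>i. 1) = 0" using o M by simp
    have "wip n m (e' k) (e' 1) = 1 / sqrt I * wip n m (e' k) x"
      using sc[of 1 "e' k" "1 / sqrt I" x] by (simp add: s(3)[unfolded One_nat_def] e1)
    then have o2: "wip n m (e' k) x = 0" using o I0 by simp
    have "1 / (16 * H ^ 5) * I \<le> (mu' k - 1) * (4 * H\<^sup>2)"
      unfolding I_def by (rule spectral_gap[OF m _ n x u(1) o2 o1 u(2)]) (use H in simp)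
    moreover have "1 / (16 * H ^ 5) * (1 / (4 * H\<^sup>2)) \<le> 1 / (16 * H ^ 5) * I"
      using I1 H by (intro mult_left_mono) auto
    ultimately have "1 / (16 * H ^ 5) * (1 / (4 * H\<^sup>2)) \<le> (mu' k - 1) * (4 * H\<^sup>2)" by linarith
    then have "1 / (16 * H ^ 5) * (1 / (4 * H\<^sup>2)) / (4 * H\<^sup>2) \<le> mu' k - 1"
      using H by (simp add: pos_divide_le_eq)
    moreover have "1 / (16 * H ^ 5) * (1 / (4 * H\<^sup>2)) / (4 * H\<^sup>2) = 1 / (256 * H ^ 9)"
      using H by (simp add: power_eq_if)
    moreover have "1 / G \<le> 1 / (256 * H ^ 9)" using GH H G(3) by (intro divide_left_mono) auto
    ultimately show "1 + 1 / G \<le> mu' k" by linarith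
    have eb: "\<bar>e' k i\<bar> \<le> 1" if "i < n" for i by (rule eigensystem_bound[OF m(1) u(2) that])
    have "mu' k = wip n m (e' k) (\<lambda>i. mu' k * e' k i)"
      using sc[of 1 "e' k" "mu' k" "e' k"] u(2) by simp
    also have "\<dots> = wip n m (e' k) (lap n m x (e' k))" using u(1) by (intro wip_cong) auto
    also have "\<dots> \<le> (\<Sum>i<n. \<Sum>j<n. 16 * H ^ 3) / 2"
      unfolding wip_lap
    proof (intro divide_right_mono sum_mono)
      fix i j assume "i \<in> {..<n}" "j \<in> {..<n}"
      then have ij: "i < n" "j < n" by auto
      show "m i * m j * ((e' k i - e' k j) * (e' k i - e' k j)) / \<bar>x i - x j\<bar> ^ 3 \<le> 16 * H ^ 3"
      proof (cases "i = j")
        case False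
        have "1 / H \<le> \<bar>x i - x j\<bar>"
        proof (cases "i < j")
          case True
          then have "1 / H \<le> x j - x i" using x(2) ij by blast
          then show ?thesis by linarith
        next
          case j: False
          then have "1 / H \<le> x i - x j" using x(2) ij False by simp
          then show ?thesis by linarith
        qed
        then have "(1 / H) ^ 3 \<le> \<bar>x i - x j\<bar> ^ 3" using H by (intro power_mono) auto
        then have c: "1 / H ^ 3 \<le> \<bar>x i - x j\<bar> ^ 3" by (simp add: power_divide)
        have "\<bar>e' k i - e' k j\<bar> \<le> 2" using eb[OF ij(1)] eb[OF ij(2)] by linarith
        then have ee: "(e' k i - e' k j) * (e' k i - e' k j) \<le> 2 * 2"
          using abs_le_square_iff[of "e' k i - e' k j" 2] by (simp add: power2_eq_square)
        have mm: "m i * m j \<le> 2 * 2"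
          using ij m m0 by (intro mult_mono) (auto simp: less_imp_le)
        have "m i * m j * ((e' k i - e' k j) * (e' k i - e' k j)) \<le> (2 * 2) * (2 * 2)"
          by (rule mult_mono[OF mm ee]) simp_all
        then have "m i * m j * ((e' k i - e' k j) * (e' k i - e' k j)) / \<bar>x i - x j\<bar> ^ 3 \<le> 16 / (1 / H ^ 3)"
          using c H by (intro frac_le) auto
        then show ?thesis by simp
      qed (use H in simp)
    qed simp
    also have "\<dots> = 8 * H ^ 3 * (real n)\<^sup>2" by (simp add: power2_eq_square)
    also have "\<dots> \<le> 256 * H ^ 9 * (real n)\<^sup>2"
      using pow[of 3] H by (intro mult_right_mono mult_mono) auto
    finally show "mu' k \<le> G" by (simp add: G_def spectral_bound_def H_def)
  qed
  show ?thesis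
  proof (rule exI[of _ x], rule exI[of _ e'], rule exI[of _ mu'], intro conjI allI impI)
    show "eigensystem n m x n e' mu'" by (rule s(1))
    show "\<bar>x i\<bar> \<le> G" if "i < n" for i using x(1) that G by (meson order_trans)
    show "1 / G \<le> \<bar>x i - x j\<bar>" if "i < n" "j < n" "i \<noteq> j" for i j
    proof -
      have "1 / G \<le> 1 / H" using G H by (intro divide_left_mono) auto
      moreover have "1 / H \<le> \<bar>x i - x j\<bar>"
      proof (cases "i < j")
        case True
        then have "1 / H \<le> x j - x i" using x(2) that by blast
        then show ?thesis by linarith
      next
        case False
        then have "1 / H \<le> x i - x j" using x(2) that by simp
        then show ?thesis by linarith
      qed
      ultimately show ?thesis by linarith
    qed
    show "lap n m x x i = x i" if "i < n" for i using x(3) that by blast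
    show "e' 0 i = 1 / sqrt (\<Sum>j<n. m j)" for i by (simp add: s(2) e_def M_def)
    show "x i = sqrt (wip n m x x) * e' 1 i" for i using I0 by (simp add: s(3)[unfolded One_nat_def] e_def I_def)
    show "mu' 1 = 1" by (rule s(4))
    have "1 / G \<le> 1 / (2 * H)" using G H by (intro divide_left_mono) auto
    then show "1 / G \<le> sqrt (wip n m x x)" using sI by (simp add: I_def)
    show "1 + 1 / G \<le> mu' k" "mu' k \<le> G" if "2 \<le> k" "k < n" for k using mub[OF that] by auto
  qed
qed

section \<open>The four-dimensional linear blocks\<close>

text \<open>The exponents of a planar block satisfy
  \<open>s^2 + (2 - \<mu>) s = (2 \<mu> + 1) (\<mu> - 1)\<close> for their squares \<open>s\<close>,
  with discriminant \<open>\<mu> (9 \<mu> - 8)\<close>. For \<open>\<mu> > 1\<close> the right side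
  is positive, so the roots have opposite signs; this is the square root of the positive
  one.\<close>

definition hyp_rate :: "real \<Rightarrow> real" where
  "hyp_rate \<mu> = sqrt ((\<mu> - 2 + sqrt (\<mu> * (9 * \<mu> - 8))) / 2)"

text \<open>The two roots add up to \<open>\<mu> - 2\<close>, so the negative root is minus the
  square of this number.\<close>

definition ell_rate :: "real \<Rightarrow> real" where
  "ell_rate \<mu> = sqrt ((hyp_rate \<mu>)\<^sup>2 + 2 - \<mu>)"

lemma rates:
  assumes "1 < \<mu>"
  shows "0 < hyp_rate \<mu>" "0 < ell_rate \<mu>" "\<mu> - 1 < (hyp_rate \<mu>)\<^sup>2" "(hyp_rate \<mu>)\<^sup>2 < 2 * \<mu>"
    and "(ell_rate \<mu>)\<^sup>2 = (hyp_rate \<mu>)\<^sup>2 + 2 - \<mu>"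
    and "(hyp_rate \<mu>)\<^sup>2 * (hyp_rate \<mu>)\<^sup>2 + (2 - \<mu>) * (hyp_rate \<mu>)\<^sup>2 = (2 * \<mu> + 1) * (\<mu> - 1)"
proof -
  define r where "r = sqrt (\<mu> * (9 * \<mu> - 8))"
  have p: "0 \<le> \<mu> * (9 * \<mu> - 8)" using assms by (intro mult_nonneg_nonneg) auto
  have r2: "r\<^sup>2 = \<mu> * (9 * \<mu> - 8)" using p by (simp add: r_def)
  have "\<mu> * 1 < \<mu> * \<mu>" using assms by (intro mult_strict_left_mono) auto
  then have "\<mu>\<^sup>2 < r\<^sup>2" unfolding r2 by (simp add: power2_eq_square algebra_simps)
  moreover have "0 \<le> r" by (simp add: r_def p)
  ultimately have r1: "\<mu> < r" by (rule power_less_imp_less_base)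
  have "r\<^sup>2 \<le> (3 * \<mu>)\<^sup>2" unfolding r2 unfolding power2_eq_square using assms by (simp add: algebra_simps)
  then have r3: "r \<le> 3 * \<mu>" by (rule power2_le_imp_le) (use assms in simp)
  have a2: "(hyp_rate \<mu>)\<^sup>2 = (\<mu> - 2 + r) / 2"
    using r1 assms unfolding hyp_rate_def r_def[symmetric] by simp
  show "\<mu> - 1 < (hyp_rate \<mu>)\<^sup>2" "(hyp_rate \<mu>)\<^sup>2 < 2 * \<mu>"
    unfolding a2 using r1 r3 by simp_all
  show "0 < hyp_rate \<mu>" using r1 assms unfolding hyp_rate_def r_def[symmetric] by simp
  have b2: "0 < (hyp_rate \<mu>)\<^sup>2 + 2 - \<mu>" unfolding a2 using r1 assms by (simp add: field_simps)
  show "0 < ell_rate \<mu>" "(ell_rate \<mu>)\<^sup>2 = (hyp_rate \<mu>)\<^sup>2 + 2 - \<mu>"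
    using b2 unfolding ell_rate_def by simp_all
  have "2 * (hyp_rate \<mu>)\<^sup>2 = \<mu> - 2 + r" using a2 by simp
  then show "(hyp_rate \<mu>)\<^sup>2 * (hyp_rate \<mu>)\<^sup>2 + (2 - \<mu>) * (hyp_rate \<mu>)\<^sup>2 = (2 * \<mu> + 1) * (\<mu> - 1)"
    using r2 unfolding power2_eq_square by algebra
qed

text \<open>
  For a root \<open>s\<close> of \<open>s\<^sup>2 + (2 - \<mu>) s = (2\<mu> + 1)(\<mu> - 1)\<close>, the functionals \<open>u\<close>, \<open>v\<close> of the deviation
  \<open>(Z, Y)\<close> of position and momentum satisfy \<open>v' = u\<close>, \<open>u' = s v\<close> along the linearized flow
  \<open>Z' = Y - i Z\<close>, \<open>Y' = 2\<mu> Re Z - i \<mu> Im Z - i Y\<close>.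
\<close>

definition enc_u :: "real \<Rightarrow> real \<Rightarrow> complex \<Rightarrow> complex \<Rightarrow> real" where
  "enc_u s \<mu> Z Y = (s + 1 - \<mu>) * Im Z + (s + \<mu> - 1) * Re Y"

definition enc_v :: "real \<Rightarrow> real \<Rightarrow> complex \<Rightarrow> complex \<Rightarrow> real" where
  "enc_v s \<mu> Z Y = (s + \<mu> + 1) * Re Z + 2 * Im Y"

definition enc_grow :: "real \<Rightarrow> complex \<Rightarrow> complex \<Rightarrow> real" where
  "enc_grow \<mu> Z Y = enc_u ((hyp_rate \<mu>)\<^sup>2) \<mu> Z Y + hyp_rate \<mu> * enc_v ((hyp_rate \<mu>)\<^sup>2) \<mu> Z Y"

definition enc_decay :: "real \<Rightarrow> complex \<Rightarrow> complex \<Rightarrow> real" where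
  "enc_decay \<mu> Z Y = enc_u ((hyp_rate \<mu>)\<^sup>2) \<mu> Z Y - hyp_rate \<mu> * enc_v ((hyp_rate \<mu>)\<^sup>2) \<mu> Z Y"

definition enc_ell :: "real \<Rightarrow> complex \<Rightarrow> complex \<Rightarrow> complex" where
  "enc_ell \<mu> Z Y = Complex (enc_u (- (ell_rate \<mu>)\<^sup>2) \<mu> Z Y) (ell_rate \<mu> * enc_v (- (ell_rate \<mu>)\<^sup>2) \<mu> Z Y)"

text \<open>Applied to encoded data, \<open>dec_xi\<close>, \<open>dec_w\<close> and
  \<open>dec_d\<close> return \<open>Re Z\<close>, \<open>Im Z + Re Y\<close> and
  \<open>Re Y - Im Z\<close>. The first two are differences of the functionals at the two roots,
  divided by the distance of the roots.\<close>

definition dec_xi :: "real \<Rightarrow> real \<Rightarrow> real \<Rightarrow> complex \<Rightarrow> real" where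
  "dec_xi \<mu> p q c = ((p - q) / (2 * hyp_rate \<mu>) - Im c / ell_rate \<mu>) / ((hyp_rate \<mu>)\<^sup>2 + (ell_rate \<mu>)\<^sup>2)"

definition dec_w :: "real \<Rightarrow> real \<Rightarrow> real \<Rightarrow> complex \<Rightarrow> real" where
  "dec_w \<mu> p q c = ((p + q) / 2 - Re c) / ((hyp_rate \<mu>)\<^sup>2 + (ell_rate \<mu>)\<^sup>2)"

definition dec_d :: "real \<Rightarrow> real \<Rightarrow> real \<Rightarrow> complex \<Rightarrow> real" where
  "dec_d \<mu> p q c = ((p + q) / 2 - (hyp_rate \<mu>)\<^sup>2 * dec_w \<mu> p q c) / (\<mu> - 1)"

definition dec_Z :: "real \<Rightarrow> real \<Rightarrow> real \<Rightarrow> complex \<Rightarrow> complex" where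
  "dec_Z \<mu> p q c = Complex (dec_xi \<mu> p q c) ((dec_w \<mu> p q c - dec_d \<mu> p q c) / 2)"

definition dec_Y :: "real \<Rightarrow> real \<Rightarrow> real \<Rightarrow> complex \<Rightarrow> complex" where
  "dec_Y \<mu> p q c = Complex ((dec_w \<mu> p q c + dec_d \<mu> p q c) / 2)
     ((Im c / ell_rate \<mu> - (\<mu> + 1 - (ell_rate \<mu>)\<^sup>2) * dec_xi \<mu> p q c) / 2)"

lemma dec_add:
  "dec_Z \<mu> (p + p') (q + q') (c + c') = dec_Z \<mu> p q c + dec_Z \<mu> p' q' c'"
  "dec_Y \<mu> (p + p') (q + q') (c + c') = dec_Y \<mu> p q c + dec_Y \<mu> p' q' c'"
  by (simp_all add: dec_Z_def dec_Y_def dec_xi_def dec_w_def dec_d_def complex_eq_iff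
      add_divide_distrib diff_divide_distrib algebra_simps)

lemma dec_diff:
  "dec_Z \<mu> (p - p') (q - q') (c - c') = dec_Z \<mu> p q c - dec_Z \<mu> p' q' c'"
  "dec_Y \<mu> (p - p') (q - q') (c - c') = dec_Y \<mu> p q c - dec_Y \<mu> p' q' c'"
  by (simp_all add: dec_Z_def dec_Y_def dec_xi_def dec_w_def dec_d_def complex_eq_iff
      add_divide_distrib diff_divide_distrib algebra_simps)

context
  fixes \<mu> a b A B :: real
  assumes mu: "1 < \<mu>"
  defines "a \<equiv> hyp_rate \<mu>" and "b \<equiv> ell_rate \<mu>" and "A \<equiv> a\<^sup>2" and "B \<equiv> b\<^sup>2"
begin

lemma AB: "0 < a" "0 < b" "0 < A" "0 < B" "B = A + 2 - \<mu>" "A * A + (2 - \<mu>) * A = (2 * \<mu> + 1) * (\<mu> - 1)"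
  using rates[OF mu] by (simp_all add: a_def b_def A_def B_def)

lemma dec_eqs:
  "(A + B) * dec_xi \<mu> p q c = (p - q) / (2 * a) - Im c / b"
  "(A + B) * dec_w \<mu> p q c = (p + q) / 2 - Re c"
  "(\<mu> - 1) * dec_d \<mu> p q c = (p + q) / 2 - A * dec_w \<mu> p q c"
proof -
  have ne: "A + B \<noteq> 0" "\<mu> - 1 \<noteq> 0" using AB(3,4) mu by auto
  show "(A + B) * dec_xi \<mu> p q c = (p - q) / (2 * a) - Im c / b"
    "(A + B) * dec_w \<mu> p q c = (p + q) / 2 - Re c"
    "(\<mu> - 1) * dec_d \<mu> p q c = (p + q) / 2 - A * dec_w \<mu> p q c"
    unfolding dec_xi_def dec_w_def dec_d_def a_def[symmetric] b_def[symmetric] A_def[symmetric] B_def[symmetric]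
    using ne by simp_all
qed

lemma dec_enc:
  "dec_Z \<mu> (enc_grow \<mu> Z Y) (enc_decay \<mu> Z Y) (enc_ell \<mu> Z Y) = Z"
  "dec_Y \<mu> (enc_grow \<mu> Z Y) (enc_decay \<mu> Z Y) (enc_ell \<mu> Z Y) = Y"
proof -
  let ?p = "enc_grow \<mu> Z Y" and ?q = "enc_decay \<mu> Z Y" and ?c = "enc_ell \<mu> Z Y"
  have v: "(?p - ?q) / (2 * a) = enc_v A \<mu> Z Y" "(?p + ?q) / 2 = enc_u A \<mu> Z Y"
    "Re ?c = enc_u (- B) \<mu> Z Y" "Im ?c / b = enc_v (- B) \<mu> Z Y"
    using AB by (simp_all add: enc_grow_def enc_decay_def enc_ell_def a_def b_def A_def B_def)
  have ne: "A + B \<noteq> 0" "\<mu> - 1 \<noteq> 0" using AB mu by auto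
  have "(A + B) * dec_xi \<mu> ?p ?q ?c = (A + B) * Re Z"
    unfolding dec_eqs v by (simp add: enc_v_def algebra_simps)
  then have xi: "dec_xi \<mu> ?p ?q ?c = Re Z" using ne by simp
  have "(A + B) * dec_w \<mu> ?p ?q ?c = (A + B) * (Im Z + Re Y)"
    unfolding dec_eqs v by (simp add: enc_u_def algebra_simps)
  then have w: "dec_w \<mu> ?p ?q ?c = Im Z + Re Y" using ne by simp
  have "(\<mu> - 1) * dec_d \<mu> ?p ?q ?c = (\<mu> - 1) * (Re Y - Im Z)"
    unfolding dec_eqs v w by (simp add: enc_u_def algebra_simps)
  then have d: "dec_d \<mu> ?p ?q ?c = Re Y - Im Z" using ne by simp
  show "dec_Z \<mu> ?p ?q ?c = Z" unfolding dec_Z_def xi w d by (simp add: complex_eq_iff)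
  show "dec_Y \<mu> ?p ?q ?c = Y"
    unfolding dec_Y_def xi w d b_def[symmetric] v B_def[symmetric]
    by (simp add: complex_eq_iff enc_v_def algebra_simps)
qed

text \<open>Decoding turns the diagonal flow \<open>p' = a p\<close>, \<open>q' = - a q\<close>,
  \<open>c' = i b c\<close> into the linearized flow. This direction is the one required, since the
  motion is recovered by differentiating decoded quantities.\<close>

lemma dec_flow:
  "dec_Z \<mu> (a * p) (- a * q) (\<i> * of_real b * c) = dec_Y \<mu> p q c - \<i> * dec_Z \<mu> p q c"
  "dec_Y \<mu> (a * p) (- a * q) (\<i> * of_real b * c)
     = Complex (2 * \<mu> * Re (dec_Z \<mu> p q c)) (- \<mu> * Im (dec_Z \<mu> p q c)) - \<i> * dec_Y \<mu> p q c"
proof -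
  define v u vb ub where "v = (p - q) / (2 * a)" and "u = (p + q) / 2" and "vb = Im c / b" and "ub = Re c"
  let ?p = "a * p" and ?q = "- a * q" and ?c = "\<i> * of_real b * c"
  have n: "(?p - ?q) / (2 * a) = u" "(?p + ?q) / 2 = A * v" "Im ?c / b = ub" "Re ?c = - B * vb"
    using AB by (simp_all add: v_def u_def vb_def ub_def A_def B_def power2_eq_square field_simps)
  have o: "(p - q) / (2 * a) = v" "(p + q) / 2 = u" "Im c / b = vb" "Re c = ub"
    by (simp_all add: v_def u_def vb_def ub_def)
  define xi w d xi' w' d' where "xi = dec_xi \<mu> p q c" and "w = dec_w \<mu> p q c" and "d = dec_d \<mu> p q c"
    and "xi' = dec_xi \<mu> ?p ?q ?c" and "w' = dec_w \<mu> ?p ?q ?c" and "d' = dec_d \<mu> ?p ?q ?c"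
  have E: "(A + B) * xi = v - vb" "(A + B) * w = u - ub" "(\<mu> - 1) * d = u - A * w"
    unfolding xi_def w_def d_def dec_eqs o by simp_all
  have E': "(A + B) * xi' = u - ub" "(A + B) * w' = A * v + B * vb" "(\<mu> - 1) * d' = A * v - A * w'"
    unfolding xi'_def w'_def d'_def dec_eqs n by simp_all
  have ne: "A + B \<noteq> 0" "\<mu> - 1 \<noteq> 0" using AB mu by auto
  note q = AB(5,6)
  have vvb: "v = vb + (A + B) * xi" "u = ub + (A + B) * w" using E by auto
  have "(A + B) * xi' = (A + B) * w" using E E' by simp
  then have xi': "xi' = w" using ne by simp
  have "(A + B) * w' = (A + B) * (vb + A * xi)" unfolding E' vvb by (simp add: algebra_simps)
  then have w': "w' = vb + A * xi" using ne by simp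
  have "(\<mu> - 1) * d' = A * B * xi" unfolding E' w' vvb by (simp add: algebra_simps)
  moreover have "A * B = A * A + (2 - \<mu>) * A" unfolding q(1) by (simp add: algebra_simps)
  then have "A * B = (2 * \<mu> + 1) * (\<mu> - 1)" unfolding q(2) .
  ultimately have "(\<mu> - 1) * d' = (\<mu> - 1) * ((2 * \<mu> + 1) * xi)" by simp
  then have d': "d' = (2 * \<mu> + 1) * xi" using ne by simp
  have ub: "ub = (\<mu> - 1) * d - B * w" using E vvb by (simp add: algebra_simps)
  show "dec_Z \<mu> ?p ?q ?c = dec_Y \<mu> p q c - \<i> * dec_Z \<mu> p q c"
    unfolding dec_Z_def dec_Y_def xi_def[symmetric] w_def[symmetric] d_def[symmetric]
      xi'_def[symmetric] w'_def[symmetric] d'_def[symmetric] xi' w' d' b_def[symmetric] o B_def[symmetric] q(1)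
    by (simp add: complex_eq_iff field_simps)
  show "dec_Y \<mu> ?p ?q ?c = Complex (2 * \<mu> * Re (dec_Z \<mu> p q c)) (- \<mu> * Im (dec_Z \<mu> p q c)) - \<i> * dec_Y \<mu> p q c"
    unfolding dec_Z_def dec_Y_def xi_def[symmetric] w_def[symmetric] d_def[symmetric]
      xi'_def[symmetric] w'_def[symmetric] d'_def[symmetric] xi' w' d' b_def[symmetric] o n B_def[symmetric] ub q(1)
    by (simp add: complex_eq_iff field_simps)
qed

text \<open>The lower bounds for \<open>a\<close> and \<open>\<mu> - 1\<close> are where the
  spectral gap enters: both are denominators of the decoding and tend to 0 as \<open>\<mu>\<close>
  tends to 1.\<close>

lemma rates_bounds:
  assumes H: "1 \<le> H" "1 + 1 / H \<le> \<mu>" "\<mu> \<le> H"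
  shows "1 / H \<le> a" "a \<le> 2 * H" "b \<le> 2 * H" "A \<le> 2 * H" "B \<le> 2 * H + 1" "1 \<le> A + B" "1 \<le> b" "1 / H \<le> \<mu> - 1"
proof -
  have A: "\<mu> - 1 < A" "A < 2 * \<mu>" using rates(3,4)[OF mu] by (simp_all add: A_def a_def)
  show "1 / H \<le> \<mu> - 1" using H by simp
  show A2: "A \<le> 2 * H" using A H by simp
  show B2: "B \<le> 2 * H + 1" unfolding AB(5) using A2 mu by simp
  have B1: "1 < B" unfolding AB(5) using A by simp
  then show "1 \<le> A + B" using AB(3) by simp
  show "1 \<le> b"
    by (rule power2_le_imp_le) (use B1 AB(2) in \<open>simp_all add: B_def\<close>)
  have "(1 / H)\<^sup>2 \<le> 1 / H" using H by (simp add: power2_eq_square field_simps)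
  also have "\<dots> \<le> A" using A H by simp
  finally have "(1 / H)\<^sup>2 \<le> a\<^sup>2" unfolding A_def .
  then show "1 / H \<le> a" by (rule power2_le_imp_le) (use AB(1) in simp)
  have HH: "H \<le> H * H" using H by simp
  have "A \<le> 4 * (H * H)" "B \<le> 4 * (H * H)" using A2 B2 HH H by linarith+
  then have "A \<le> (2 * H)\<^sup>2" "B \<le> (2 * H)\<^sup>2" by (simp_all add: power2_eq_square)
  then show "a \<le> 2 * H" "b \<le> 2 * H" using H unfolding A_def B_def by (auto intro: power2_le_imp_le)
qed

lemma enc_bounds:
  assumes H: "1 \<le> H" "1 + 1 / H \<le> \<mu>" "\<mu> \<le> H"
  shows "\<bar>enc_grow \<mu> Z Y\<bar> \<le> 15 * H\<^sup>2 * (norm Z + norm Y)" "\<bar>enc_decay \<mu> Z Y\<bar> \<le> 15 * H\<^sup>2 * (norm Z + norm Y)"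
    and "norm (enc_ell \<mu> Z Y) \<le> 15 * H\<^sup>2 * (norm Z + norm Y)"
proof -
  note R = rates_bounds[OF H]
  define S where "S = norm Z + norm Y"
  have S: "0 \<le> S" by (simp add: S_def)
  have uv: "\<bar>enc_u s \<mu> Z Y\<bar> \<le> 5 * H * S" "\<bar>enc_v s \<mu> Z Y\<bar> \<le> 5 * H * S" if s: "\<bar>s\<bar> \<le> 2 * H + 1" for s
  proof -
    have c: "\<bar>s + 1 - \<mu>\<bar> \<le> 5 * H" "\<bar>s + \<mu> - 1\<bar> \<le> 5 * H" "\<bar>s + \<mu> + 1\<bar> \<le> 5 * H" "\<bar>2 :: real\<bar> \<le> 5 * H"
      using s H mu by auto
    have "\<bar>enc_u s \<mu> Z Y\<bar> \<le> \<bar>s + 1 - \<mu>\<bar> * \<bar>Im Z\<bar> + \<bar>s + \<mu> - 1\<bar> * \<bar>Re Y\<bar>"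
      unfolding enc_u_def abs_mult[symmetric] by (rule abs_triangle_ineq)
    also have "\<dots> \<le> 5 * H * norm Z + 5 * H * norm Y"
      using c H by (intro add_mono mult_mono abs_Im_le_cmod abs_Re_le_cmod) auto
    finally show "\<bar>enc_u s \<mu> Z Y\<bar> \<le> 5 * H * S" by (simp add: S_def algebra_simps)
    have "\<bar>enc_v s \<mu> Z Y\<bar> \<le> \<bar>s + \<mu> + 1\<bar> * \<bar>Re Z\<bar> + \<bar>2\<bar> * \<bar>Im Y\<bar>"
      unfolding enc_v_def abs_mult[symmetric] by (rule abs_triangle_ineq)
    also have "\<dots> \<le> 5 * H * norm Z + 5 * H * norm Y"
      using c H by (intro add_mono mult_mono abs_Im_le_cmod abs_Re_le_cmod) auto
    finally show "\<bar>enc_v s \<mu> Z Y\<bar> \<le> 5 * H * S" by (simp add: S_def algebra_simps)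
  qed
  have sA: "\<bar>A\<bar> \<le> 2 * H + 1" "\<bar>- B\<bar> \<le> 2 * H + 1" using R AB by auto
  have HS: "H * S \<le> H\<^sup>2 * S" using H S by (intro mult_right_mono) (auto simp: power2_eq_square)
  have av: "\<bar>a * enc_v A \<mu> Z Y\<bar> \<le> 2 * H * (5 * H * S)" "\<bar>b * enc_v (- B) \<mu> Z Y\<bar> \<le> 2 * H * (5 * H * S)"
    unfolding abs_mult using uv(2)[OF sA(1)] uv(2)[OF sA(2)] R(2,3) AB(1,2) H by (intro mult_mono[of _ "2 * H" _ "5 * H * S"]; simp)+
  then have av': "\<bar>a * enc_v A \<mu> Z Y\<bar> \<le> 10 * (H\<^sup>2 * S)" "\<bar>b * enc_v (- B) \<mu> Z Y\<bar> \<le> 10 * (H\<^sup>2 * S)"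
    by (simp_all add: power2_eq_square mult_ac)
  have u': "\<bar>enc_u A \<mu> Z Y\<bar> \<le> 5 * (H\<^sup>2 * S)" "\<bar>enc_u (- B) \<mu> Z Y\<bar> \<le> 5 * (H\<^sup>2 * S)"
    using uv(1)[OF sA(1)] uv(1)[OF sA(2)] HS by auto
  have "\<bar>enc_grow \<mu> Z Y\<bar> \<le> 15 * (H\<^sup>2 * S)" "\<bar>enc_decay \<mu> Z Y\<bar> \<le> 15 * (H\<^sup>2 * S)"
    unfolding enc_grow_def enc_decay_def a_def[symmetric] A_def[symmetric] using av' u' by linarith+
  then show "\<bar>enc_grow \<mu> Z Y\<bar> \<le> 15 * H\<^sup>2 * (norm Z + norm Y)" "\<bar>enc_decay \<mu> Z Y\<bar> \<le> 15 * H\<^sup>2 * (norm Z + norm Y)"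
    by (simp_all add: S_def mult.assoc)
  have "norm (enc_ell \<mu> Z Y) \<le> \<bar>enc_u (- B) \<mu> Z Y\<bar> + \<bar>b * enc_v (- B) \<mu> Z Y\<bar>"
    using cmod_le[of "enc_ell \<mu> Z Y"] by (simp add: enc_ell_def b_def B_def)
  then have "norm (enc_ell \<mu> Z Y) \<le> 15 * (H\<^sup>2 * S)" using av' u' by linarith
  then show "norm (enc_ell \<mu> Z Y) \<le> 15 * H\<^sup>2 * (norm Z + norm Y)" by (simp add: S_def mult.assoc)
qed

lemma dec_bounds:
  assumes H: "1 \<le> H" "1 + 1 / H \<le> \<mu>" "\<mu> \<le> H"
    and Y: "\<bar>p\<bar> \<le> Y" "\<bar>q\<bar> \<le> Y" "norm c \<le> Y"
  shows "norm (dec_Z \<mu> p q c) \<le> 20 * H\<^sup>2 * Y" "norm (dec_Y \<mu> p q c) \<le> 20 * H\<^sup>2 * Y"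
proof -
  note R = rates_bounds[OF H]
  have Y0: "0 \<le> Y" using Y by linarith
  have c: "\<bar>Re c\<bar> \<le> Y" "\<bar>Im c\<bar> \<le> Y" using Y(3) abs_Re_le_cmod[of c] abs_Im_le_cmod[of c] by linarith+
  have div: "\<bar>z / d\<bar> \<le> \<bar>z\<bar>" if "1 \<le> d" for z d :: real
    using that by (simp add: abs_divide divide_le_eq mult_le_cancel_left1)
  have divH: "\<bar>z / d\<bar> \<le> H * \<bar>z\<bar>" if "1 / H \<le> d" for z d :: real
  proof -
    have d: "0 < d" using that H divide_pos_pos[of 1 H] by linarith
    have "1 \<le> H * d" using that H by (simp add: field_simps)
    then have "\<bar>z\<bar> * 1 \<le> \<bar>z\<bar> * (H * d)" by (intro mult_left_mono) auto
    then show ?thesis using d by (simp add: abs_divide divide_le_eq mult_ac)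
  qed
  have HY: "Y \<le> H * Y" using H Y0 by (simp add: mult_le_cancel_right1)
  have HHY: "H * Y \<le> H\<^sup>2 * Y" using H Y0 by (intro mult_right_mono) (auto simp: power2_eq_square)
  have "\<bar>(p - q) / 2 / a\<bar> \<le> H * \<bar>(p - q) / 2\<bar>" by (rule divH[OF R(1)])
  also have "\<dots> \<le> H * Y" using Y H by (intro mult_left_mono) auto
  finally have v: "\<bar>(p - q) / (2 * a)\<bar> \<le> H * Y" by simp
  have vb: "\<bar>Im c / b\<bar> \<le> Y" using div[OF R(7), of "Im c"] c by linarith
  have xi: "\<bar>dec_xi \<mu> p q c\<bar> \<le> 2 * (H * Y)"
  proof -
    have "\<bar>(p - q) / (2 * a) - Im c / b\<bar> \<le> 2 * (H * Y)" using v vb HY by linarith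
    with div[OF R(6), of "(p - q) / (2 * a) - Im c / b"] show ?thesis
      unfolding dec_xi_def a_def[symmetric] b_def[symmetric] A_def[symmetric] B_def[symmetric] by (rule order_trans)
  qed
  have w: "\<bar>dec_w \<mu> p q c\<bar> \<le> 2 * Y"
  proof -
    have "\<bar>(p + q) / 2 - Re c\<bar> \<le> 2 * Y" using Y c unfolding add_divide_distrib by linarith
    with div[OF R(6), of "(p + q) / 2 - Re c"] show ?thesis
      unfolding dec_w_def a_def[symmetric] b_def[symmetric] A_def[symmetric] B_def[symmetric] by (rule order_trans)
  qed
  have "\<bar>A * dec_w \<mu> p q c\<bar> \<le> 2 * H * (2 * Y)"
    unfolding abs_mult using R AB w H by (intro mult_mono) auto
  then have "\<bar>(p + q) / 2 - A * dec_w \<mu> p q c\<bar> \<le> 5 * (H * Y)" using Y HY unfolding add_divide_distrib by linarith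
  then have "H * \<bar>(p + q) / 2 - A * dec_w \<mu> p q c\<bar> \<le> H * (5 * (H * Y))" using H by (intro mult_left_mono) auto
  then have d: "\<bar>dec_d \<mu> p q c\<bar> \<le> 5 * (H\<^sup>2 * Y)"
    using divH[OF R(8), of "(p + q) / 2 - A * dec_w \<mu> p q c"]
    unfolding dec_d_def a_def[symmetric] A_def[symmetric] by (simp add: power2_eq_square mult_ac)
  have "\<bar>\<mu> + 1 - B\<bar> \<le> 5 * H" using R AB H mu by auto
  then have "\<bar>(\<mu> + 1 - B) * dec_xi \<mu> p q c\<bar> \<le> 5 * H * (2 * (H * Y))"
    unfolding abs_mult using xi H by (intro mult_mono) auto
  then have sg: "\<bar>(\<mu> + 1 - B) * dec_xi \<mu> p q c\<bar> \<le> 10 * (H\<^sup>2 * Y)"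
    by (simp add: power2_eq_square mult_ac)
  have "norm (dec_Z \<mu> p q c) \<le> \<bar>dec_xi \<mu> p q c\<bar> + \<bar>(dec_w \<mu> p q c - dec_d \<mu> p q c) / 2\<bar>"
    using cmod_le[of "dec_Z \<mu> p q c"] by (simp add: dec_Z_def)
  also have "\<dots> \<le> 20 * (H\<^sup>2 * Y)" using xi w d HY HHY unfolding diff_divide_distrib by linarith
  finally show "norm (dec_Z \<mu> p q c) \<le> 20 * H\<^sup>2 * Y" by simp
  have "norm (dec_Y \<mu> p q c) \<le> \<bar>(dec_w \<mu> p q c + dec_d \<mu> p q c) / 2\<bar>
      + \<bar>(Im c / b - (\<mu> + 1 - B) * dec_xi \<mu> p q c) / 2\<bar>"
    using cmod_le[of "dec_Y \<mu> p q c"] by (simp add: dec_Y_def b_def B_def)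
  also have "\<dots> \<le> 20 * (H\<^sup>2 * Y)"
  proof -
    have gen: "\<bar>t\<bar> \<le> 10 * K \<Longrightarrow> \<bar>s\<bar> \<le> K \<Longrightarrow> \<bar>w\<bar> \<le> 2 * K \<Longrightarrow> \<bar>d\<bar> \<le> 5 * K \<Longrightarrow>
        \<bar>(w + d) / 2\<bar> + \<bar>(s - t) / 2\<bar> \<le> 20 * K" for w d s t K :: real
      unfolding add_divide_distrib diff_divide_distrib by linarith
    show ?thesis by (rule gen) (use sg vb w d HY HHY in linarith)+
  qed
  finally show "norm (dec_Y \<mu> p q c) \<le> 20 * H\<^sup>2 * Y" by simp
qed

end

section \<open>The perturbed relative equilibrium\<close>

text \<open>
  The inner bodies are at \<open>e\<^sup>i\<^sup>(\<^sup>t\<^sup>+\<^sup>\<phi>\<^sup>) (x\<^sub>i + \<Sum>\<^sub>k e\<^sub>k(i) dZ\<^sub>k)\<close>, with velocities expanded in the same way. The angle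
  \<open>\<phi>\<close> is fixed by the requirement that the homothetic mode \<open>k = 1\<close> of the position be real: it is
  \<open>a0 + rr\<close>, and the velocity in this mode is \<open>pp + i (a0 + ss)\<close>, whence \<open>\<phi>' = om\<close>. \<open>Ang\<close> is the sum
  \<open>rr + ss\<close>, a constant of the linearized motion, and \<open>Kep\<close> is \<open>(rr - 2 Ang) - i pp\<close>.
  \<open>Phase\<close> is \<open>\<phi>\<close>; \<open>Grow k\<close>, \<open>Decay k\<close>, \<open>Ell k\<close> are the hyperbolic and elliptic directions of the \<open>k\<close>-th
  eigenvector, and \<open>OutA\<close>, \<dots>, \<open>OutD\<close> give the deviation of the escaping body from the radial
  parabolic orbit \<open>\<kappa> t\<^bsup>2/3\<^esup>\<close> (characteristic exponents \<open>4/3, -1/3, 1/3, 2/3\<close>).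
\<close>

datatype mode = Phase | Ang | Kep | OutA | OutB | OutC | OutD | Grow nat | Decay nat | Ell nat

text \<open>All data of the configuration are bounded through the single number \<open>H\<close>, so
  the constants below depend on \<open>n\<close> and \<open>H\<close> only and are uniform in the
  inner masses.\<close>

locale planar_data =
  fixes n :: nat and m x :: "nat \<Rightarrow> real" and e :: "nat \<Rightarrow> nat \<Rightarrow> real" and mu :: "nat \<Rightarrow> real" and H mn :: real
  assumes n: "2 \<le> n" and m: "\<And>i. i < n \<Longrightarrow> 1 \<le> m i" "\<And>i. i < n \<Longrightarrow> m i \<le> 2"
    and mn: "0 < mn" and H: "2 \<le> H"
    and sys: "eigensystem n m x n e mu"
    and xb: "\<And>i. i < n \<Longrightarrow> \<bar>x i\<bar> \<le> H"
    and xg: "\<And>i j. i < n \<Longrightarrow> j < n \<Longrightarrow> i \<noteq> j \<Longrightarrow> 1 / H \<le> \<bar>x i - x j\<bar>"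
    and cc: "\<And>i. i < n \<Longrightarrow> lap n m x x i = x i"
    and e0: "\<And>i. i < n \<Longrightarrow> e 0 i = 1 / sqrt (\<Sum>j<n. m j)"
    and e1: "\<And>i. i < n \<Longrightarrow> x i = sqrt (wip n m x x) * e 1 i"
    and mu1: "mu 1 = 1"
    and a0b: "1 / H \<le> sqrt (wip n m x x)"
    and mub: "\<And>k. 2 \<le> k \<Longrightarrow> k < n \<Longrightarrow> 1 + 1 / H \<le> mu k" "\<And>k. 2 \<le> k \<Longrightarrow> k < n \<Longrightarrow> mu k \<le> H"
begin

definition "a0 = sqrt (wip n m x x)"
text \<open>The value 2 for irrelevant indices satisfies the same bounds as a true eigenvalue,
  because \<open>2 \<le> H\<close>; estimates then hold for all \<open>k\<close> without side
  conditions.\<close>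

definition "nu k = (if 2 \<le> k \<and> k < n then mu k else 2)"
definition "rr y = Re (y Kep) + 2 * Re (y Ang)"
definition "pp y = - Im (y Kep)"
definition "ss y = - Re (y Ang) - Re (y Kep)"
definition "dZ y k = (if k = 1 then of_real (rr y)
   else dec_Z (nu k) (Re (y (Grow k))) (Re (y (Decay k))) (y (Ell k)))"
definition "dY y k = (if k = 1 then Complex (pp y) (ss y)
   else dec_Y (nu k) (Re (y (Grow k))) (Re (y (Decay k))) (y (Ell k)))"
definition "disp y i = (\<Sum>k=1..<n. of_real (e k i) * dZ y k)"
definition "om y = (ss y - rr y) / (a0 + rr y)"
definition "ph t y = cis (t + Re (y Phase))"
definition "zeta y i = of_real (x i) + disp y i"
definition "pos t y i = ph t y * zeta y i"
definition "mass_in = (\<Sum>i<n. m i)"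
definition "mtot = mass_in + mn"
text \<open>The radial parabolic law \<open>r'' = - mtot / r^2\<close> is solved by
  \<open>kap * t^(2/3)\<close> exactly when \<open>kap^3 = 9/2 * mtot\<close>.\<close>

definition "kap = (9 / 2 * mtot) powr (1 / 3)"
definition "R0 t = kap * t powr (2 / 3)"
definition "rho y = Complex (Re (y OutA) + Re (y OutB)) (Re (y OutC) + Re (y OutD))"
text \<open>The attraction in the rotating frame minus its value at the center of mass. The
  subtracted vector is the same for all bodies, hence lies in the translation mode and is invisible
  to the modes \<open>k \<ge> 1\<close>; what remains is of order \<open>t^(-2)\<close> instead of
  \<open>t^(-4/3)\<close>.\<close>

definition "tide t y i = of_real mn * cnj (ph t y) *
   (kern (of_real (R0 t) + rho y - pos t y i) - kern (of_real (R0 t) + rho y))"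
text \<open>The remainder of the attraction beyond first order; its summand for \<open>j = i\<close> vanishes as \<open>0 / 0 = 0\<close>.\<close>

definition "frem y i = (\<Sum>j<n. of_real (m j) * (kern (zeta y j - zeta y i)
   - of_real ((x j - x i) / \<bar>x j - x i\<bar> ^ 3) - kern_lin (disp y j - disp y i) / of_real (\<bar>x j - x i\<bar> ^ 3)))"
definition "proj k f = (\<Sum>i<n. of_real (m i * e k i) * f i)" for f :: "nat \<Rightarrow> complex"
definition "frc t y k = proj k (\<lambda>i. frem y i + tide t y i)"
text \<open>The acceleration of the escaping body relative to the center of mass of the others,
  freed of its terms of order zero and one in \<open>rho\<close>. The factor
  \<open>mtot / mass_in\<close> adds the reaction of the inner bodies.\<close>

definition "outer t y = - of_real (mtot / mass_in) * (\<Sum>j<n. of_real (m j) *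
   (kern (of_real (R0 t) + rho y - pos t y j) - (1 + kern_lin (rho y / of_real (R0 t))) / of_real ((R0 t)\<^sup>2)))"
definition "fZ y k = - \<i> * of_real (om y) * dZ y k"
definition "fY t y k = frc t y k - \<i> * of_real (om y) * dY y k"

text \<open>What is left after the diagonal part with exponents \<open>rate\<close> and
  \<open>pw\<close> is removed. The factors \<open>3/5 * t\<close> and \<open>3 * t\<close> come
  from variation of constants: the exponents \<open>4/3, -1/3\<close> differ by \<open>5/3\<close>,
  the exponents \<open>2/3, 1/3\<close> by \<open>1/3\<close>. The angular speed \<open>om\<close>
  is kept here although it is of first order; its size is absorbed by the weights.\<close>

fun field :: "real \<Rightarrow> (mode \<Rightarrow> complex) \<Rightarrow> mode \<Rightarrow> complex" where
  "field t y Phase = of_real (om y)"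
| "field t y Ang = of_real (Im (frc t y 1) - om y * pp y)"
| "field t y Kep = - 2 * of_real (Im (frc t y 1) - om y * pp y)
     - \<i> * of_real (om y * (ss y - rr y) + Re (frc t y 1))"
| "field t y OutA = of_real (3 / 5 * t * Re (outer t y))"
| "field t y OutB = of_real (- 3 / 5 * t * Re (outer t y))"
| "field t y OutC = of_real (- 3 * t * Im (outer t y))"
| "field t y OutD = of_real (3 * t * Im (outer t y))"
| "field t y (Grow k) = (if 2 \<le> k \<and> k < n then of_real (enc_grow (nu k) (fZ y k) (fY t y k)) else 0)"
| "field t y (Decay k) = (if 2 \<le> k \<and> k < n then of_real (enc_decay (nu k) (fZ y k) (fY t y k)) else 0)"
| "field t y (Ell k) = (if 2 \<le> k \<and> k < n then enc_ell (nu k) (fZ y k) (fY t y k) else 0)"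

section \<open>Size of the decoded state and of the angular speed\<close>

lemma nu: "1 < nu k" "1 \<le> H" "1 + 1 / H \<le> nu k" "nu k \<le> H"
proof -
  show "1 \<le> H" using H by simp
  have h: "0 < 1 / H" "1 / H \<le> 1" using H by auto
  show "1 + 1 / H \<le> nu k" "nu k \<le> H" using mub[of k] H h by (auto simp: nu_def)
  then show "1 < nu k" using h by linarith
qed

lemma linear_parts:
  "rr (\<lambda>k. y k - y' k) = rr y - rr y'" "pp (\<lambda>k. y k - y' k) = pp y - pp y'" "ss (\<lambda>k. y k - y' k) = ss y - ss y'"
  "dZ (\<lambda>k. y k - y' k) l = dZ y l - dZ y' l" "dY (\<lambda>k. y k - y' k) l = dY y l - dY y' l"
  "rho (\<lambda>k. y k - y' k) = rho y - rho y'"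
  by (simp_all add: rr_def pp_def ss_def dZ_def dY_def dec_diff rho_def complex_eq_iff)

lemma disp_diff: "disp y i - disp y' i = (\<Sum>k=1..<n. of_real (e k i) * (dZ y k - dZ y' k))"
  by (simp add: disp_def sum_subtractf algebra_simps)

definition "shape_le y Y \<longleftrightarrow> norm (y Ang) \<le> Y \<and> norm (y Kep) \<le> Y \<and>
   (\<forall>l. norm (y (Grow l)) \<le> Y \<and> norm (y (Decay l)) \<le> Y \<and> norm (y (Ell l)) \<le> Y)"

lemma shape_le_bounds:
  assumes "shape_le y Y"
  shows "norm (dZ y k) \<le> 20 * H\<^sup>2 * Y" "norm (dY y k) \<le> 20 * H\<^sup>2 * Y"
proof -
  have c: "\<bar>Re (y l)\<bar> \<le> norm (y l)" "\<bar>Im (y l)\<bar> \<le> norm (y l)" for l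
    by (rule abs_Re_le_cmod abs_Im_le_cmod)+
  have Y: "0 \<le> Y" using assms order_trans[OF norm_ge_zero, of "y Ang" Y] by (simp add: shape_le_def)
  have "1 * 1 \<le> H * H" using H by (intro mult_mono) auto
  then have "3 * Y \<le> 20 * H\<^sup>2 * Y" using Y by (intro mult_right_mono) (auto simp: power2_eq_square)
  moreover have A: "norm (y Ang) \<le> Y" "norm (y Kep) \<le> Y" using assms by (auto simp: shape_le_def)
  have "norm (complex_of_real (rr y)) \<le> 3 * Y"
    using c[of Kep] c[of Ang] A unfolding rr_def norm_of_real by linarith
  moreover have "norm (Complex (pp y) (ss y)) \<le> 3 * Y"
    using cmod_le[of "Complex (pp y) (ss y)"] c[of Kep] c[of Ang] A unfolding pp_def ss_def by simp
  moreover have "norm (dec_Z (nu k) (Re (y (Grow k))) (Re (y (Decay k))) (y (Ell k))) \<le> 20 * H\<^sup>2 * Y"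
    "norm (dec_Y (nu k) (Re (y (Grow k))) (Re (y (Decay k))) (y (Ell k))) \<le> 20 * H\<^sup>2 * Y"
    using assms c[of "Grow k"] c[of "Decay k"]
    by (auto simp: shape_le_def intro!: dec_bounds[OF nu] intro: order_trans)
  ultimately show "norm (dZ y k) \<le> 20 * H\<^sup>2 * Y" "norm (dY y k) \<le> 20 * H\<^sup>2 * Y"
    by (simp_all add: dZ_def dY_def)
qed

lemma e_bound: "k < n \<Longrightarrow> i < n \<Longrightarrow> \<bar>e k i\<bar> \<le> 1"
  using sys m by (intro eigensystem_bound[of n m]) (auto simp: eigensystem_def)

lemma disp_diff_bound:
  assumes "\<And>k. norm (dZ y k - dZ y' k) \<le> D" "i < n"
  shows "norm (disp y i - disp y' i) \<le> real n * D"
proof -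
  have D: "0 \<le> D" using order_trans[OF norm_ge_zero assms(1)] .
  have "norm (disp y i - disp y' i) \<le> (\<Sum>k=1..<n. D)"
    unfolding disp_diff
  proof (rule sum_norm_le)
    fix k assume "k \<in> {1..<n}"
    then have "\<bar>e k i\<bar> \<le> 1" using e_bound assms(2) by simp
    then show "norm (of_real (e k i) * (dZ y k - dZ y' k)) \<le> D"
      using mult_mono[of "\<bar>e k i\<bar>" 1 "norm (dZ y k - dZ y' k)" D] assms(1)[of k] by (simp add: norm_mult)
  qed
  also have "\<dots> \<le> real n * D" using D by (simp add: mult_right_mono)
  finally show ?thesis .
qed

lemma zero_state: "dZ (\<lambda>k. 0) l = 0" "dY (\<lambda>k. 0) l = 0" "disp (\<lambda>k. 0) i = 0" "rho (\<lambda>k. 0) = 0"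
  "om (\<lambda>k. 0) = 0"
proof -
  show z: "dZ (\<lambda>k. 0) l = 0" "dY (\<lambda>k. 0) l = 0" for l
    by (simp_all add: dZ_def dY_def rr_def pp_def ss_def dec_Z_def dec_Y_def dec_xi_def dec_w_def dec_d_def complex_eq_iff)
  show "disp (\<lambda>k. 0) i = 0" by (simp add: disp_def z)
  show "rho (\<lambda>k. 0) = 0" "om (\<lambda>k. 0) = 0"
    by (simp_all add: rho_def om_def rr_def ss_def complex_eq_iff)
qed

lemma disp_bound: "(\<And>k. norm (dZ y k) \<le> b) \<Longrightarrow> i < n \<Longrightarrow> norm (disp y i) \<le> real n * b"
  using disp_diff_bound[of y "\<lambda>k. 0" b i] by (simp add: zero_state)

text \<open>The bound on \<open>b\<close> keeps all relative displacements below one half.\<close>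

definition "tiny y b \<longleftrightarrow> (\<forall>k. norm (dZ y k) \<le> b \<and> norm (dY y k) \<le> b) \<and> 4 * real n * H * b \<le> 1"

lemma tinyD:
  assumes "tiny y b"
  shows "norm (dZ y k) \<le> b" "norm (dY y k) \<le> b" "0 \<le> b" "b \<le> 1" "b \<le> 1 / (2 * H)" "real n * b \<le> 1 / (4 * H)" "real n * b \<le> H"
proof -
  show "norm (dZ y k) \<le> b" "norm (dY y k) \<le> b" for k using assms by (auto simp: tiny_def)
  then show b: "0 \<le> b" using order_trans[OF norm_ge_zero] by blast
  have nb: "4 * (real n * b * H) \<le> 1" using assms by (simp add: tiny_def mult_ac)
  then show c: "real n * b \<le> 1 / (4 * H)" using H by (simp add: field_simps)
  have "1 * b \<le> real n * b" using n b by (intro mult_right_mono) auto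
  then have "b \<le> 1 / (4 * H)" using c by linarith
  moreover have "1 / (4 * H) \<le> 1 / (2 * H)" "1 / (4 * H) \<le> 1" using H by (auto simp: field_simps)
  ultimately show "b \<le> 1 / (2 * H)" "b \<le> 1" "real n * b \<le> H" using c H by linarith+
qed

lemma rr_ss_pp: "rr y = Re (dZ y 1)" "ss y = Im (dY y 1)" "pp y = Re (dY y 1)"
  by (simp_all add: dZ_def dY_def)

lemma rr_ss_pp_bound:
  assumes "tiny y b"
  shows "\<bar>rr y\<bar> \<le> b" "\<bar>ss y\<bar> \<le> b" "\<bar>pp y\<bar> \<le> b" "1 / (2 * H) \<le> a0 + rr y"
proof -
  note t = tinyD[OF assms]
  show r: "\<bar>rr y\<bar> \<le> b" "\<bar>ss y\<bar> \<le> b" "\<bar>pp y\<bar> \<le> b"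
    unfolding rr_ss_pp using t(1,2)[of 1] abs_Re_le_cmod abs_Im_le_cmod by (meson order_trans)+
  have "1 / H = 1 / (2 * H) + 1 / (2 * H)" by simp
  then show "1 / (2 * H) \<le> a0 + rr y" using r(1) t(5) a0b unfolding a0_def by linarith
qed

lemma om_diff:
  assumes y: "tiny y b" "tiny y' b" and D: "\<And>k. norm (dZ y k - dZ y' k) \<le> D" "\<And>k. norm (dY y k - dY y' k) \<le> D"
  shows "\<bar>om y - om y'\<bar> \<le> 12 * H\<^sup>2 * D"
proof -
  define u u' A A' where "u = ss y - rr y" and "u' = ss y' - rr y'" and "A = a0 + rr y" and "A' = a0 + rr y'"
  note r = rr_ss_pp_bound[OF y(1)] and r' = rr_ss_pp_bound[OF y(2)]
  have b1: "b \<le> 1" "0 \<le> b" using tinyD[OF y(1)] by auto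
  have d: "\<bar>rr y - rr y'\<bar> \<le> D" "\<bar>ss y - ss y'\<bar> \<le> D"
    unfolding rr_ss_pp using D[of 1] abs_Re_le_cmod[of "dZ y 1 - dZ y' 1"] abs_Im_le_cmod[of "dY y 1 - dY y' 1"] by simp_all
  have D0: "0 \<le> D" using d by linarith
  have hp: "0 < 1 / (2 * H)" using H by simp
  have A: "1 / (2 * H) \<le> A" "1 / (2 * H) \<le> A'" using r r' by (auto simp: A_def A'_def)
  then have Ap: "0 < A" "0 < A'" using hp by linarith+
  have iA: "1 / A \<le> 2 * H" "1 / A' \<le> 2 * H" using A Ap H by (auto simp: field_simps)
  have "om y - om y' = (u - u') * (1 / A) + u' * (A' - A) * (1 / A * (1 / A'))"
  proof -
    have "om y = u / A" "om y' = u' / A'" by (simp_all add: om_def u_def u'_def A_def A'_def)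
    then show ?thesis using Ap by (simp add: field_simps)
  qed
  also have "\<bar>\<dots>\<bar> \<le> \<bar>(u - u') * (1 / A)\<bar> + \<bar>u' * (A' - A) * (1 / A * (1 / A'))\<bar>" by (rule abs_triangle_ineq)
  also have "\<dots> = \<bar>u - u'\<bar> * (1 / A) + \<bar>u'\<bar> * \<bar>A' - A\<bar> * (1 / A * (1 / A'))" using Ap by (simp add: abs_mult)
  also have "\<dots> \<le> (2 * D) * (2 * H) + 2 * D * (2 * H * (2 * H))"
    using iA Ap d r' b1 D0 H by (intro add_mono mult_mono) (auto simp: u_def u'_def A_def A'_def)
  also have "\<dots> = (4 * H + 8 * (H * H)) * D" by (simp add: algebra_simps)
  also have "\<dots> \<le> (12 * H\<^sup>2) * D"
    using D0 H by (intro mult_right_mono) (auto simp: power2_eq_square)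
  finally show ?thesis .
qed

lemma om_bound: "tiny y b \<Longrightarrow> \<bar>om y\<bar> \<le> 4 * H * b"
proof -
  assume y: "tiny y b"
  note r = rr_ss_pp_bound[OF y]
  have hp: "0 < 1 / (2 * H)" using H by simp
  then have A: "0 < a0 + rr y" using r by linarith
  then have "1 / (a0 + rr y) \<le> 2 * H" using r(4) H by (auto simp: field_simps)
  then have "\<bar>ss y - rr y\<bar> * (1 / (a0 + rr y)) \<le> (2 * b) * (2 * H)"
    using r A H by (intro mult_mono) auto
  then show ?thesis using A by (simp add: om_def abs_mult mult_ac)
qed

text \<open>Both factors are of order \<open>b\<close>, so the product has a Lipschitz constant of
  order \<open>b\<close>.\<close>

lemma om_times_diff:
  fixes q q' :: complex
  assumes y: "tiny y b" "tiny y' b" and D: "\<And>k. norm (dZ y k - dZ y' k) \<le> D" "\<And>k. norm (dY y k - dY y' k) \<le> D"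
    and q: "norm (q - q') \<le> c * D" "norm q' \<le> c * b" "0 \<le> c"
  shows "norm (of_real (om y) * q - of_real (om y') * q') \<le> c * (16 * H\<^sup>2 * b * D)"
proof -
  have b: "0 \<le> b" using tinyD[OF y(1)] by auto
  have D0: "0 \<le> D" using order_trans[OF norm_ge_zero D(1)] .
  have "of_real (om y) * q - of_real (om y') * q' = of_real (om y) * (q - q') + of_real (om y - om y') * q'"
    by (simp add: algebra_simps)
  also have "norm \<dots> \<le> \<bar>om y\<bar> * norm (q - q') + \<bar>om y - om y'\<bar> * norm q'"
    by (rule order_trans[OF norm_triangle_ineq]) (simp add: norm_mult flip: of_real_diff)
  also have "\<dots> \<le> (4 * H * b) * (c * D) + (12 * H\<^sup>2 * D) * (c * b)"
    using om_bound[OF y(1)] om_diff[OF y D] q b D0 H by (intro add_mono mult_mono) auto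
  also have "\<dots> = (4 * H + 12 * H\<^sup>2) * (c * b * D)" by (simp add: algebra_simps)
  also have "\<dots> \<le> (16 * H\<^sup>2) * (c * b * D)"
    using q b D0 H by (intro mult_right_mono mult_nonneg_nonneg) (auto simp: power2_eq_square)
  finally show ?thesis by (simp add: mult_ac)
qed

section \<open>Second order remainder of the inner attraction\<close>

lemma kern_lin_scale: "kern_lin (of_real r * w) = of_real r * kern_lin w"
  by (simp add: kern_lin_def algebra_simps)

lemma frem_summand:
  assumes "i < n" "j < n" "i \<noteq> j"
  shows "kern (zeta y j - zeta y i) - of_real ((x j - x i) / \<bar>x j - x i\<bar> ^ 3)
      - kern_lin (disp y j - disp y i) / of_real (\<bar>x j - x i\<bar> ^ 3)
    = of_real (sgn (x j - x i) / (x j - x i)\<^sup>2) * (kern (1 + (disp y j - disp y i) / of_real (x j - x i)) - 1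
        - kern_lin ((disp y j - disp y i) / of_real (x j - x i)))"
proof -
  define d w where "d = x j - x i" and "w = (disp y j - disp y i) / of_real d"
  have "1 / H \<le> \<bar>d\<bar>" unfolding d_def using xg[of j i] assms by simp
  moreover have "0 < 1 / H" using H by simp
  ultimately have d: "d \<noteq> 0" by auto
  have dw: "disp y j - disp y i = of_real d * w" using d by (simp add: w_def)
  have z: "zeta y j - zeta y i = of_real d * (1 + w)"
    unfolding distrib_left dw[symmetric] by (simp add: zeta_def d_def)
  have wf: "(disp y j - disp y i) / of_real (x j - x i) = w" by (simp add: w_def d_def)
  have s: "sgn d / d\<^sup>2 = d / \<bar>d\<bar> ^ 3"
    using d by (cases "0 < d") (auto simp: power2_eq_square power3_eq_cube)
  show ?thesis
    unfolding wf unfolding z dw kern_scale kern_lin_scale d_def[symmetric] s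
  proof -
    have "of_real d * kern_lin w / of_real (\<bar>d\<bar> ^ 3) = of_real (d / \<bar>d\<bar> ^ 3) * kern_lin w" by simp
    then show "of_real (d / \<bar>d\<bar> ^ 3) * kern (1 + w) - of_real (d / \<bar>d\<bar> ^ 3) - of_real d * kern_lin w / of_real (\<bar>d\<bar> ^ 3)
      = of_real (d / \<bar>d\<bar> ^ 3) * (kern (1 + w) - 1 - kern_lin w)"
      by (simp only: right_diff_distrib mult_1_right)
  qed
qed

text \<open>Each summand is \<open>kern_expansion\<close> at radius \<open>2 n b H\<close>. The
  factor \<open>b\<close> makes this self-coupling contract for small displacements without any help
  from \<open>mn\<close>.\<close>

lemma frem_diff:
  assumes y: "tiny y b" "tiny y' b" and D: "\<And>k. norm (dZ y k - dZ y' k) \<le> D" and i: "i < n"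
  shows "norm (frem y i - frem y' i) \<le> 3200 * real n ^ 3 * H ^ 4 * (b * D)"
proof -
  have D0: "0 \<le> D" using order_trans[OF norm_ge_zero D] .
  have b: "0 \<le> b" "real n * b \<le> 1 / (4 * H)" using tinyD[OF y(1)] by auto
  let ?s = "\<lambda>y j. kern (zeta y j - zeta y i) - of_real ((x j - x i) / \<bar>x j - x i\<bar> ^ 3)
      - kern_lin (disp y j - disp y i) / of_real (\<bar>x j - x i\<bar> ^ 3)"
  have s: "norm (of_real (m j) * ?s y j - of_real (m j) * ?s y' j) \<le> 3200 * real n ^ 2 * H ^ 4 * (b * D)" if j: "j < n" for j
  proof (cases "j = i")
    case True
    then show ?thesis using b D0 H by simp
  next
    case False
    define d where "d = x j - x i"
    define w where "w y = (disp y j - disp y i) / of_real d" for y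
    have d: "1 / H \<le> \<bar>d\<bar>" unfolding d_def using xg[of j i] False i j by simp
    have h: "0 < 1 / H" using H by simp
    then have d0: "0 < \<bar>d\<bar>" using d by linarith
    have id: "1 / \<bar>d\<bar> \<le> H" using d d0 H by (simp add: field_simps)
    have wd: "norm (w y - w y') \<le> 2 * (real n * D) * H"
    proof -
      have "w y - w y' = ((disp y j - disp y' j) - (disp y i - disp y' i)) / of_real d"
        unfolding w_def by (simp add: diff_divide_distrib)
      then have "norm (w y - w y') = norm ((disp y j - disp y' j) - (disp y i - disp y' i)) * (1 / \<bar>d\<bar>)"
        by (simp add: norm_divide)
      also have "\<dots> \<le> (real n * D + real n * D) * H"
        using order_trans[OF norm_triangle_ineq4 add_mono[OF disp_diff_bound[OF D j] disp_diff_bound[OF D i]]] D0 H id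
        by (intro mult_mono) auto
      finally show ?thesis by (simp add: mult_ac)
    qed
    have wb: "norm (w z) \<le> 2 * (real n * b) * H" if z: "tiny z b" for z
    proof -
      have "norm (w z) = norm (disp z j - disp z i) * (1 / \<bar>d\<bar>)" by (simp add: w_def norm_divide)
      also have "\<dots> \<le> (real n * b + real n * b) * H"
        using order_trans[OF norm_triangle_ineq4 add_mono[OF disp_bound[OF tinyD(1)[OF z] j] disp_bound[OF tinyD(1)[OF z] i]]] b(1) H id
        by (intro mult_mono) auto
      finally show ?thesis by (simp add: mult_ac)
    qed
    have half: "2 * (real n * b) * H \<le> 1 / 2" using b(2) H by (simp add: field_simps)
    have "?s y j - ?s y' j = of_real (sgn d / d\<^sup>2) * (kern (1 + w y) - kern (1 + w y') - kern_lin (w y - w y'))"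
    proof -
      have S: "?s z j = of_real (sgn d / d\<^sup>2) * (kern (1 + w z) - 1 - kern_lin (w z))" for z
        unfolding w_def d_def by (rule frem_summand) (use i j False in auto)
      show ?thesis unfolding S unfolding right_diff_distrib[symmetric] kern_lin_diff by (simp add: algebra_simps)
    qed
    then have "norm (?s y j - ?s y' j) = \<bar>sgn d / d\<^sup>2\<bar> * norm (kern (1 + w y) - kern (1 + w y') - kern_lin (w y - w y'))"
      by (simp only: norm_mult norm_of_real)
    also have "\<bar>sgn d / d\<^sup>2\<bar> = 1 / \<bar>d\<bar> * (1 / \<bar>d\<bar>)" using d0 by (cases "0 < d") (auto simp: power2_eq_square)
    also have "1 / \<bar>d\<bar> * (1 / \<bar>d\<bar>) * norm (kern (1 + w y) - kern (1 + w y') - kern_lin (w y - w y'))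
       \<le> H * H * (400 * (2 * (real n * b) * H) * norm (w y - w y'))"
      using kern_expansion[OF wb[OF y(1)] wb[OF y(2)] half] id d0 H b by (intro mult_mono) auto
    also have "\<dots> \<le> H * H * (400 * (2 * (real n * b) * H) * (2 * (real n * D) * H))"
      using wd H b by (intro mult_left_mono) auto
    also have "\<dots> = 1600 * real n ^ 2 * H ^ 4 * (b * D)" by (simp add: power_eq_if)
    finally have "norm (?s y j - ?s y' j) \<le> 1600 * real n ^ 2 * H ^ 4 * (b * D)" .
    moreover have "\<bar>m j\<bar> \<le> 2" using m[OF j] by simp
    ultimately have "\<bar>m j\<bar> * norm (?s y j - ?s y' j) \<le> 2 * (1600 * real n ^ 2 * H ^ 4 * (b * D))"
      by (intro mult_mono) auto
    moreover have "of_real (m j) * ?s y j - of_real (m j) * ?s y' j = of_real (m j) * (?s y j - ?s y' j)"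
      by (rule right_diff_distrib[symmetric])
    ultimately show ?thesis by (simp only: norm_mult norm_of_real)
  qed
  have "norm (frem y i - frem y' i) \<le> (\<Sum>j<n. 3200 * real n ^ 2 * H ^ 4 * (b * D))"
    unfolding frem_def sum_subtractf[symmetric] by (rule sum_norm_le) (use s in simp)
  also have "\<dots> = 3200 * real n ^ 3 * H ^ 4 * (b * D)" by (simp add: power_eq_if)
  finally show ?thesis .
qed

section \<open>Tidal forces on the inner bodies\<close>

lemma zeta_bound: "tiny y b \<Longrightarrow> i < n \<Longrightarrow> norm (zeta y i) \<le> 2 * H"
proof -
  assume y: "tiny y b" and i: "i < n"
  have "norm (zeta y i) \<le> \<bar>x i\<bar> + norm (disp y i)"
    unfolding zeta_def by (rule order_trans[OF norm_triangle_ineq]) simp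
  then show ?thesis using xb[OF i] disp_bound[OF tinyD(1)[OF y] i] tinyD(7)[OF y] by linarith
qed

lemma norm_ph [simp]: "norm (ph t y) = 1" by (simp add: ph_def)

lemma norm_pos: "norm (pos t y i) = norm (zeta y i)" by (simp add: pos_def norm_mult)

lemma norm_cis_diff: "norm (cis a - cis b) \<le> \<bar>a - b\<bar>"
proof -
  have "(norm (cis a - cis b))\<^sup>2 = 2 - 2 * cos (a - b)"
    unfolding cmod_power2 cos_diff using sin_cos_squared_add[of a] sin_cos_squared_add[of b]
    by (simp add: power2_eq_square algebra_simps)
  also have "\<dots> \<le> (a - b)\<^sup>2"
  proof -
    have "cos (a - b) = 1 - 2 * (sin ((a - b) / 2))\<^sup>2"
    proof -
      have h: "2 * ((a - b) / 2) = a - b" by simp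
      show ?thesis using cos_double_sin[of "(a - b) / 2"] unfolding h .
    qed
    moreover have "(sin ((a - b) / 2))\<^sup>2 \<le> ((a - b) / 2)\<^sup>2"
      using abs_sin_x_le_abs_x[of "(a - b) / 2"] by (simp only: abs_le_square_iff)
    ultimately show ?thesis by (simp add: power_divide)
  qed
  finally have "(norm (cis a - cis b))\<^sup>2 \<le> \<bar>a - b\<bar>\<^sup>2" by simp
  then show ?thesis by (rule power2_le_imp_le) simp
qed

lemma ph_diff: "norm (ph t y - ph t y') \<le> norm (y Phase - y' Phase)"
  using norm_cis_diff[of "t + Re (y Phase)" "t + Re (y' Phase)"] abs_Re_le_cmod[of "y Phase - y' Phase"]
  by (simp add: ph_def)

lemma pos_diff:
  assumes y: "tiny y b" "tiny y' b" and D: "\<And>k. norm (dZ y k - dZ y' k) \<le> D" and i: "i < n"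
    and p: "norm (y Phase - y' Phase) \<le> p"
  shows "norm (pos t y i - pos t y' i) \<le> 2 * H * p + real n * D"
proof -
  have p0: "0 \<le> p" using order_trans[OF norm_ge_zero p] .
  have "pos t y i - pos t y' i = (ph t y - ph t y') * zeta y i + ph t y' * (disp y i - disp y' i)"
    by (simp add: pos_def zeta_def algebra_simps)
  also have "norm \<dots> \<le> norm (ph t y - ph t y') * norm (zeta y i) + norm (disp y i - disp y' i)"
    by (rule order_trans[OF norm_triangle_ineq]) (simp add: norm_mult)
  also have "\<dots> \<le> p * (2 * H) + real n * D"
    using ph_diff[of t y y'] p zeta_bound[OF y(1) i] disp_diff_bound[OF D i] p0
    by (intro add_mono mult_mono) auto
  finally show ?thesis by (simp add: mult_ac)
qed

text \<open>After division by \<open>R0 t\<close>, both \<open>rho\<close> and its difference to any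
  inner body stay in the ball of radius one half, where the kernel estimates apply.\<close>

definition "wide t y P \<longleftrightarrow> 0 < R0 t \<and> norm (rho y) \<le> P \<and> P + 2 * H \<le> R0 t / 2"

lemma kern_outer:
  assumes w: "0 < R0 t"
  shows "kern (of_real (R0 t) + z) = of_real (1 / (R0 t)\<^sup>2) * kern (1 + z / of_real (R0 t))"
proof -
  have "of_real (R0 t) + z = of_real (R0 t) * (1 + z / of_real (R0 t))" using w by (simp add: distrib_left)
  then show ?thesis using w by (simp only: kern_scale) simp
qed

lemma wide_bounds:
  assumes w: "wide t y P" and y: "tiny y b" and i: "i < n"
  shows "norm (rho y / of_real (R0 t)) \<le> 1 / 2"
    and "norm ((rho y - pos t y i) / of_real (R0 t)) \<le> (P + 2 * H) / R0 t" "(P + 2 * H) / R0 t \<le> 1 / 2"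
    and "norm ((rho y - pos t y i) / of_real (R0 t)) \<le> 1 / 2"
proof -
  have R: "0 < R0 t" "norm (rho y) \<le> P" "P + 2 * H \<le> R0 t / 2" using w by (auto simp: wide_def)
  have z: "norm (pos t y i) \<le> 2 * H" using zeta_bound[OF y i] by (simp add: norm_pos)
  have "norm (rho y - pos t y i) \<le> P + 2 * H"
    using norm_triangle_ineq4[of "rho y" "pos t y i"] R z by linarith
  then show 1: "norm ((rho y - pos t y i) / of_real (R0 t)) \<le> (P + 2 * H) / R0 t"
    using R by (simp add: norm_divide divide_right_mono)
  show 2: "(P + 2 * H) / R0 t \<le> 1 / 2" using R by (simp add: divide_le_eq)
  show "norm ((rho y - pos t y i) / of_real (R0 t)) \<le> 1 / 2" using 1 2 by (rule order_trans)
  have "norm (rho y) \<le> R0 t / 2" using R H by linarith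
  then show "norm (rho y / of_real (R0 t)) \<le> 1 / 2" using R by (simp add: norm_divide divide_le_eq)
qed

lemma tide_bound:
  assumes w: "wide t y P" and y: "tiny y b" and i: "i < n"
  shows "norm (tide t y i) \<le> mn * (404 * H) / R0 t ^ 3"
proof -
  have R: "0 < R0 t" using w by (auto simp: wide_def)
  note W = wide_bounds[OF w y i]
  have eq: "of_real (R0 t) + rho y - pos t y i = of_real (R0 t) + (rho y - pos t y i)" by simp
  have "norm (tide t y i) = mn * (1 / (R0 t)\<^sup>2 * norm (kern (1 + (rho y - pos t y i) / of_real (R0 t)) - kern (1 + rho y / of_real (R0 t))))"
    unfolding tide_def eq kern_outer[OF R] right_diff_distrib[symmetric]
    using mn by (simp add: norm_mult norm_divide norm_power)
  also have "\<dots> \<le> mn * (1 / (R0 t)\<^sup>2 * (202 * norm ((rho y - pos t y i) / of_real (R0 t) - rho y / of_real (R0 t))))"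
    using mn by (intro mult_left_mono kern_lipschitz W(1,4)) auto
  also have "(rho y - pos t y i) / of_real (R0 t) - rho y / of_real (R0 t) = - (pos t y i / of_real (R0 t))"
    by (simp add: diff_divide_distrib)
  also have "norm (- (pos t y i / of_real (R0 t))) = norm (zeta y i) * (1 / R0 t)"
    using R by (simp add: norm_divide norm_pos)
  also have "mn * (1 / (R0 t)\<^sup>2 * (202 * (norm (zeta y i) * (1 / R0 t)))) \<le> mn * (1 / (R0 t)\<^sup>2 * (202 * (2 * H * (1 / R0 t))))"
    using mn R zeta_bound[OF y i] by (intro mult_left_mono mult_right_mono) auto
  also have "\<dots> = mn * (404 * H) / R0 t ^ 3" using R by (simp add: power2_eq_square power3_eq_cube)
  finally show ?thesis .
qed

text \<open>The phase enters twice, through the frame and through the positions of the bodies,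
  whence \<open>808 = 2 * 404\<close>. All dependence, including that on the phase, carries the
  factor \<open>mn / R0 t ^ 3\<close>.\<close>

lemma tide_diff:
  assumes w: "wide t y P" "wide t y' P" and y: "tiny y b" "tiny y' b"
    and D: "\<And>k. norm (dZ y k - dZ y' k) \<le> D" and i: "i < n"
    and p: "norm (y Phase - y' Phase) \<le> p" and r: "norm (rho y - rho y') \<le> r"
  shows "norm (tide t y i - tide t y' i) \<le> mn * (808 * H * p + 404 * r + 202 * (real n * D)) / R0 t ^ 3"
proof -
  have R: "0 < R0 t" using w by (auto simp: wide_def)
  have p0: "0 \<le> p" using order_trans[OF norm_ge_zero p] .
  define X where "X y = kern (1 + (rho y - pos t y i) / of_real (R0 t)) - kern (1 + rho y / of_real (R0 t))" for y
  have eq: "of_real (R0 t) + rho y - pos t y i = of_real (R0 t) + (rho y - pos t y i)" for y by simp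
  have T: "tide t y i = of_real (mn / (R0 t)\<^sup>2) * (cnj (ph t y) * X y)" for y
    unfolding tide_def eq kern_outer[OF R] right_diff_distrib[symmetric] X_def by simp
  have pd: "norm (pos t y i - pos t y' i) \<le> 2 * H * p + real n * D" by (rule pos_diff[OF y D i p])
  have Xb: "norm (X y) \<le> 404 * H / R0 t"
  proof -
    have "norm (X y) \<le> 202 * norm ((rho y - pos t y i) / of_real (R0 t) - rho y / of_real (R0 t))"
      unfolding X_def by (intro kern_lipschitz wide_bounds(1,4)[OF w(1) y(1) i])
    also have "(rho y - pos t y i) / of_real (R0 t) - rho y / of_real (R0 t) = - (pos t y i / of_real (R0 t))"
      by (simp add: diff_divide_distrib)
    also have "norm (- (pos t y i / of_real (R0 t))) = norm (zeta y i) / R0 t"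
      using R by (simp add: norm_divide norm_pos)
    also have "202 * (norm (zeta y i) / R0 t) \<le> 202 * (2 * H / R0 t)"
      using zeta_bound[OF y(1) i] R by (intro mult_left_mono divide_right_mono) auto
    finally show ?thesis by simp
  qed
  have Xd: "norm (X y - X y') \<le> (404 * r + 404 * H * p + 202 * (real n * D)) / R0 t"
  proof -
    have "norm (X y - X y') \<le> norm (kern (1 + (rho y - pos t y i) / of_real (R0 t)) - kern (1 + (rho y' - pos t y' i) / of_real (R0 t)))
        + norm (kern (1 + rho y / of_real (R0 t)) - kern (1 + rho y' / of_real (R0 t)))"
      unfolding X_def by (rule order_trans[OF _ norm_triangle_ineq4]) (simp add: algebra_simps)
    also have "\<dots> \<le> 202 * norm ((rho y - pos t y i) / of_real (R0 t) - (rho y' - pos t y' i) / of_real (R0 t))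
        + 202 * norm (rho y / of_real (R0 t) - rho y' / of_real (R0 t))"
      by (intro add_mono kern_lipschitz wide_bounds(1,4)[OF w(1) y(1) i] wide_bounds(1,4)[OF w(2) y(2) i])
    also have "\<dots> = 202 * (norm ((rho y - rho y') - (pos t y i - pos t y' i)) / R0 t) + 202 * (norm (rho y - rho y') / R0 t)"
    proof -
      have "(rho y - pos t y i) / of_real (R0 t) - (rho y' - pos t y' i) / of_real (R0 t)
         = ((rho y - rho y') - (pos t y i - pos t y' i)) / of_real (R0 t)"
        "rho y / of_real (R0 t) - rho y' / of_real (R0 t) = (rho y - rho y') / of_real (R0 t)"
        by (simp_all add: diff_divide_distrib)
      then show ?thesis using R by (simp only: norm_divide norm_of_real abs_of_pos)
    qed
    also have "\<dots> \<le> 202 * ((r + (2 * H * p + real n * D)) / R0 t) + 202 * (r / R0 t)"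
      using R r pd norm_triangle_ineq4[of "rho y - rho y'" "pos t y i - pos t y' i"]
      by (intro add_mono mult_left_mono divide_right_mono) auto
    also have "\<dots> = (404 * r + 404 * H * p + 202 * (real n * D)) / R0 t"
      by (simp add: add_divide_distrib distrib_left)
    finally show ?thesis .
  qed
  have "cnj (ph t y) * X y - cnj (ph t y') * X y' = cnj (ph t y - ph t y') * X y + cnj (ph t y') * (X y - X y')"
    by (simp add: algebra_simps)
  also have "norm \<dots> \<le> norm (ph t y - ph t y') * norm (X y) + norm (X y - X y')"
    by (rule order_trans[OF norm_triangle_ineq]) (simp only: norm_mult complex_mod_cnj norm_ph mult_1_left order_refl)
  also have "\<dots> \<le> p * (404 * H / R0 t) + (404 * r + 404 * H * p + 202 * (real n * D)) / R0 t"
    using order_trans[OF ph_diff[of t y y'] p] Xb Xd p0 by (intro add_mono mult_mono) auto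
  also have "\<dots> = (808 * H * p + 404 * r + 202 * (real n * D)) / R0 t"
    by (simp add: add_divide_distrib)
  finally have N: "norm (cnj (ph t y) * X y - cnj (ph t y') * X y') \<le> (808 * H * p + 404 * r + 202 * (real n * D)) / R0 t" .
  have "norm (tide t y i - tide t y' i) = mn / (R0 t)\<^sup>2 * norm (cnj (ph t y) * X y - cnj (ph t y') * X y')"
    unfolding T right_diff_distrib[symmetric] norm_mult norm_of_real using mn by simp
  also have "\<dots> \<le> mn / (R0 t)\<^sup>2 * ((808 * H * p + 404 * r + 202 * (real n * D)) / R0 t)"
    using N mn by (intro mult_left_mono) auto
  also have "\<dots> = mn * (808 * H * p + 404 * r + 202 * (real n * D)) / R0 t ^ 3"
    by (simp add: power2_eq_square power3_eq_cube)
  finally show ?thesis .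
qed

lemma proj_bound:
  assumes "k < n" "\<And>i. i < n \<Longrightarrow> norm (f i) \<le> c"
  shows "norm (proj k f) \<le> 2 * real n * c"
proof -
  have "norm (proj k f) \<le> (\<Sum>i<n. 2 * c)"
    unfolding proj_def
  proof (rule sum_norm_le)
    fix i assume "i \<in> {..<n}"
    then have i: "i < n" by simp
    have "\<bar>m i\<bar> * \<bar>e k i\<bar> \<le> 2 * 1" using m[OF i] e_bound[OF assms(1) i] by (intro mult_mono) auto
    then have "\<bar>m i * e k i\<bar> \<le> 2" by (simp add: abs_mult)
    then show "norm (of_real (m i * e k i) * f i) \<le> 2 * c"
      unfolding norm_mult norm_of_real using assms(2)[OF i] by (intro mult_mono) auto
  qed
  then show ?thesis by simp
qed

lemma proj_diff: "proj k f - proj k g = proj k (\<lambda>i. f i - g i)"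
  by (simp add: proj_def sum_subtractf right_diff_distrib)

lemma frem_zero: "frem (\<lambda>k. 0) i = 0"
  by (simp add: frem_def zeta_def zero_state kern_def kern_lin_def scaleR_conv_of_real abs_minus_commute
      divide_inverse flip: of_real_diff)

lemma frem_bound: "tiny y b \<Longrightarrow> i < n \<Longrightarrow> norm (frem y i) \<le> 3200 * real n ^ 3 * H ^ 4 * (b * b)"
  using frem_diff[of y b "\<lambda>k. 0" b i] tinyD(1,3)[of y b]
  by (auto simp: frem_zero zero_state tiny_def)

lemma frc_bound:
  assumes w: "wide t y P" and y: "tiny y b" and k: "k < n"
  shows "norm (frc t y k) \<le> 6400 * real n ^ 4 * H ^ 4 * (b * b) + mn / R0 t ^ 3 * (808 * real n * H)"
proof -
  have "norm (frc t y k) \<le> 2 * real n * (3200 * real n ^ 3 * H ^ 4 * (b * b) + mn * (404 * H) / R0 t ^ 3)"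
    unfolding frc_def
    by (intro proj_bound[OF k] order_trans[OF norm_triangle_ineq] add_mono frem_bound[OF y] tide_bound[OF w y])
  also have "\<dots> = 6400 * real n ^ 4 * H ^ 4 * (b * b) + mn / R0 t ^ 3 * (808 * real n * H)"
    by (simp add: power_eq_if distrib_left)
  finally show ?thesis .
qed

lemma frc_diff:
  assumes w: "wide t y P" "wide t y' P" and y: "tiny y b" "tiny y' b"
    and D: "\<And>k. norm (dZ y k - dZ y' k) \<le> D" and k: "k < n"
    and p: "norm (y Phase - y' Phase) \<le> p" and r: "norm (rho y - rho y') \<le> r"
  shows "norm (frc t y k - frc t y' k) \<le> 6400 * real n ^ 4 * H ^ 4 * (b * D)
     + mn / R0 t ^ 3 * (1616 * real n * H * p + 808 * real n * r + 404 * real n ^ 2 * D)"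
proof -
  have "norm (frc t y k - frc t y' k) \<le> 2 * real n * (3200 * real n ^ 3 * H ^ 4 * (b * D)
     + mn * (808 * H * p + 404 * r + 202 * (real n * D)) / R0 t ^ 3)"
    unfolding frc_def proj_diff
  proof (rule proj_bound[OF k])
    fix i assume i: "i < n"
    have "frem y i + tide t y i - (frem y' i + tide t y' i) = (frem y i - frem y' i) + (tide t y i - tide t y' i)" by simp
    also have "norm \<dots> \<le> 3200 * real n ^ 3 * H ^ 4 * (b * D) + mn * (808 * H * p + 404 * r + 202 * (real n * D)) / R0 t ^ 3"
      by (intro order_trans[OF norm_triangle_ineq] add_mono frem_diff[OF y D i] tide_diff[OF w y D i p r])
    finally show "norm (frem y i + tide t y i - (frem y' i + tide t y' i)) \<le> 3200 * real n ^ 3 * H ^ 4 * (b * D)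
      + mn * (808 * H * p + 404 * r + 202 * (real n * D)) / R0 t ^ 3" .
  qed
  also have "\<dots> = 6400 * real n ^ 4 * H ^ 4 * (b * D)
     + mn / R0 t ^ 3 * (1616 * real n * H * p + 808 * real n * r + 404 * real n ^ 2 * D)"
    by (simp add: power_eq_if distrib_left add_divide_distrib mult_ac)
  finally show ?thesis .
qed

section \<open>Relative acceleration of the escaping body\<close>

lemma mass_in: "real n \<le> mass_in" "0 < mass_in" "2 \<le> mtot"
proof -
  have "(\<Sum>i<n. 1) \<le> mass_in" unfolding mass_in_def using m by (intro sum_mono) auto
  then show "real n \<le> mass_in" by simp
  then show "0 < mass_in" "2 \<le> mtot" using n mn by (auto simp: mtot_def)
qed

lemma outer_summand:
  assumes w: "wide t y P"
  shows "kern (of_real (R0 t) + rho y - pos t y j) - (1 + kern_lin (rho y / of_real (R0 t))) / of_real ((R0 t)\<^sup>2)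
    = of_real (1 / (R0 t)\<^sup>2) * (kern (1 + (rho y - pos t y j) / of_real (R0 t)) - 1
        - kern_lin ((rho y - pos t y j) / of_real (R0 t)) - kern_lin (pos t y j / of_real (R0 t)))"
proof -
  have R: "0 < R0 t" using w by (auto simp: wide_def)
  have eq: "of_real (R0 t) + rho y - pos t y j = of_real (R0 t) + (rho y - pos t y j)" by simp
  have l: "kern_lin ((rho y - pos t y j) / of_real (R0 t)) = kern_lin (rho y / of_real (R0 t)) - kern_lin (pos t y j / of_real (R0 t))"
    by (simp add: diff_divide_distrib kern_lin_diff)
  show ?thesis unfolding eq kern_outer[OF R] l by (simp add: algebra_simps divide_inverse)
qed

lemma outer_sum_bound:
  fixes f :: "nat \<Rightarrow> complex"
  assumes "\<And>j. j < n \<Longrightarrow> norm (f j) \<le> c / R0 t ^ 3"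
  shows "norm (- of_real (mtot / mass_in) * (\<Sum>j<n. of_real (m j) * f j)) \<le> mtot / R0 t ^ 3 * c"
proof -
  have "norm (\<Sum>j<n. of_real (m j) * f j) \<le> (\<Sum>j<n. m j * (c / R0 t ^ 3))"
  proof (rule sum_norm_le)
    fix j assume "j \<in> {..<n}"
    then show "norm (of_real (m j) * f j) \<le> m j * (c / R0 t ^ 3)"
      using mult_left_mono[OF assms[of j], of "m j"] m(1)[of j] by (simp only: norm_mult norm_of_real) simp
  qed
  also have "\<dots> = mass_in * (c / R0 t ^ 3)" unfolding mass_in_def by (rule sum_distrib_right[symmetric])
  finally have "mtot / mass_in * norm (\<Sum>j<n. of_real (m j) * f j) \<le> mtot / mass_in * (mass_in * (c / R0 t ^ 3))"
    using mass_in by (intro mult_left_mono) auto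
  then show ?thesis using mass_in by (simp add: norm_mult norm_divide)
qed

lemma outer_bound:
  assumes w: "wide t y P" and y: "tiny y b"
  shows "norm (outer t y) \<le> mtot / R0 t ^ 3 * (400 * (P + 2 * H)\<^sup>2 / R0 t + 4 * H)"
  unfolding outer_def
proof (rule outer_sum_bound)
  fix i assume i: "i < n"
  have R: "0 < R0 t" using w by (auto simp: wide_def)
  note W = wide_bounds[OF w y i]
  define q where "q = (P + 2 * H) / R0 t"
  define w1 where "w1 = (rho y - pos t y i) / of_real (R0 t)"
  have q: "norm w1 \<le> q" "q \<le> 1 / 2" "0 \<le> q"
    using W(2,3) order_trans[OF norm_ge_zero W(2)] by (simp_all add: q_def w1_def)
  have k1: "kern 1 = 1" by (simp add: kern_def)
  have "norm (kern (1 + w1) - kern (1 + 0) - kern_lin (w1 - 0)) \<le> 400 * q * norm (w1 - 0)"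
    by (rule kern_expansion) (use q in auto)
  also have "\<dots> \<le> 400 * q * q" using q by (simp add: mult_left_mono)
  finally have a: "norm (kern (1 + w1) - 1 - kern_lin w1) \<le> 400 * q * q" by (simp add: k1)
  have "norm (kern_lin (pos t y i / of_real (R0 t))) \<le> 2 * (norm (pos t y i) / R0 t)"
    using norm_kern_lin[of "pos t y i / of_real (R0 t)"] R by (simp add: norm_divide)
  also have "\<dots> \<le> 2 * (2 * H / R0 t)"
    using zeta_bound[OF y i] R by (intro mult_left_mono divide_right_mono) (auto simp: norm_pos)
  finally have b: "norm (kern_lin (pos t y i / of_real (R0 t))) \<le> 4 * H / R0 t" by simp
  have "norm (kern (1 + w1) - 1 - kern_lin w1 - kern_lin (pos t y i / of_real (R0 t))) \<le> 400 * q * q + 4 * H / R0 t"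
    using norm_triangle_ineq4[of "kern (1 + w1) - 1 - kern_lin w1" "kern_lin (pos t y i / of_real (R0 t))"] a b by linarith
  then have "1 / (R0 t)\<^sup>2 * norm (kern (1 + w1) - 1 - kern_lin w1 - kern_lin (pos t y i / of_real (R0 t)))
    \<le> 1 / (R0 t)\<^sup>2 * (400 * q * q + 4 * H / R0 t)" by (intro mult_left_mono) auto
  also have "\<dots> = (400 * (P + 2 * H)\<^sup>2 / R0 t + 4 * H) / R0 t ^ 3"
  proof -
    have "1 / r\<^sup>2 * (400 * (S / r) * (S / r) + h / r) = (400 * S\<^sup>2 / r + h) / r ^ 3" if "0 < r" for r S h :: real
      using that by (simp add: power2_eq_square power3_eq_cube add_divide_distrib distrib_left)
    from this[OF R] show ?thesis unfolding q_def .
  qed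
  finally show "norm (kern (of_real (R0 t) + rho y - pos t y i) - (1 + kern_lin (rho y / of_real (R0 t))) / of_real ((R0 t)\<^sup>2))
    \<le> (400 * (P + 2 * H)\<^sup>2 / R0 t + 4 * H) / R0 t ^ 3"
    unfolding outer_summand[OF w] norm_mult norm_of_real w1_def by simp
qed

text \<open>The expansion removed the first order in \<open>rho\<close>, so differences of
  \<open>rho\<close> come with the small factor \<open>(P + 2 * H) / R0 t\<close>. Positions of the
  inner bodies, and with them phase and shape, enter with a coefficient that is not small.\<close>

lemma outer_diff:
  assumes w: "wide t y P" "wide t y' P" and y: "tiny y b" "tiny y' b"
    and D: "\<And>k. norm (dZ y k - dZ y' k) \<le> D"
    and p: "norm (y Phase - y' Phase) \<le> p" and r: "norm (rho y - rho y') \<le> r"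
  shows "norm (outer t y - outer t y') \<le> mtot / R0 t ^ 3 * (400 * (P + 2 * H) / R0 t * r + 202 * (2 * H * p + real n * D))"
proof -
  let ?S = "\<lambda>y j. kern (of_real (R0 t) + rho y - pos t y j) - (1 + kern_lin (rho y / of_real (R0 t))) / of_real ((R0 t)\<^sup>2)"
  have R: "0 < R0 t" using w by (auto simp: wide_def)
  define q where "q = (P + 2 * H) / R0 t"
  define Q where "Q = 2 * H * p + real n * D"
  have s: "norm (?S y i - ?S y' i) \<le> (400 * (P + 2 * H) / R0 t * r + 202 * (2 * H * p + real n * D)) / R0 t ^ 3"
    if i: "i < n" for i
  proof -
    note W = wide_bounds[OF w(1) y(1) i] and W' = wide_bounds[OF w(2) y(2) i]
    define v where "v y = (rho y - pos t y i) / of_real (R0 t)" for y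
    define u where "u y = pos t y i / of_real (R0 t)" for y
    have q: "norm (v y) \<le> q" "norm (v y') \<le> q" "q \<le> 1 / 2" "0 \<le> q"
      using W(2,3) W'(2) order_trans[OF norm_ge_zero W(2)] by (simp_all add: q_def v_def)
    have pd: "norm (pos t y i - pos t y' i) \<le> Q" unfolding Q_def by (rule pos_diff[OF y D i p])
    have "v y - v y' = ((rho y - rho y') - (pos t y i - pos t y' i)) / of_real (R0 t)"
      by (simp add: v_def diff_divide_distrib)
    then have "norm (v y - v y') = norm ((rho y - rho y') - (pos t y i - pos t y' i)) / R0 t"
      using R by (simp add: norm_divide)
    also have "\<dots> \<le> (r + Q) / R0 t"
      using R pd r norm_triangle_ineq4[of "rho y - rho y'" "pos t y i - pos t y' i"] by (intro divide_right_mono) auto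
    finally have vd: "norm (v y - v y') \<le> (r + Q) / R0 t" .
    have "u y - u y' = (pos t y i - pos t y' i) / of_real (R0 t)" by (simp add: u_def diff_divide_distrib)
    then have ud: "norm (u y - u y') \<le> Q / R0 t" using R pd by (simp add: norm_divide divide_right_mono)
    have Q0: "0 \<le> Q" using order_trans[OF norm_ge_zero pd] .
    have "?S y i - ?S y' i = of_real (1 / (R0 t)\<^sup>2) * ((kern (1 + v y) - kern (1 + v y') - kern_lin (v y - v y')) - kern_lin (u y - u y'))"
      unfolding outer_summand[OF w(1)] outer_summand[OF w(2)] v_def[symmetric] u_def[symmetric]
        right_diff_distrib[symmetric] kern_lin_diff by (simp add: algebra_simps)
    then have "norm (?S y i - ?S y' i) = 1 / (R0 t)\<^sup>2 * norm ((kern (1 + v y) - kern (1 + v y') - kern_lin (v y - v y')) - kern_lin (u y - u y'))"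
      by (simp only: norm_mult norm_of_real) simp
    also have "\<dots> \<le> 1 / (R0 t)\<^sup>2 * (400 * q * ((r + Q) / R0 t) + 2 * (Q / R0 t))"
    proof (rule mult_left_mono, rule order_trans[OF norm_triangle_ineq4], rule add_mono)
      show "norm (kern (1 + v y) - kern (1 + v y') - kern_lin (v y - v y')) \<le> 400 * q * ((r + Q) / R0 t)"
        using kern_expansion[OF q(1,2,3)] vd q(4) by (meson mult_left_mono order_trans mult_nonneg_nonneg zero_le_numeral)
      show "norm (kern_lin (u y - u y')) \<le> 2 * (Q / R0 t)"
        using norm_kern_lin[of "u y - u y'"] ud by linarith
    qed simp
    also have "\<dots> = (400 * q * r + (400 * q + 2) * Q) / R0 t ^ 3"
      by (simp add: power2_eq_square power3_eq_cube add_divide_distrib distrib_left distrib_right)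
    \<comment> \<open>\<open>400 * q + 2 \<le> 202\<close> because
      \<open>q \<le> 1 / 2\<close>.\<close>
    also have "\<dots> \<le> (400 * q * r + 202 * Q) / R0 t ^ 3"
      using q Q0 R by (intro divide_right_mono add_left_mono mult_right_mono) auto
    finally show ?thesis by (simp add: q_def Q_def)
  qed
  have "outer t y - outer t y' = - of_real (mtot / mass_in) * (\<Sum>j<n. of_real (m j) * (?S y j - ?S y' j))"
    unfolding outer_def right_diff_distrib[of "of_real (m _)" "?S y _"] sum_subtractf by (simp add: algebra_simps)
  then show ?thesis using outer_sum_bound[of "\<lambda>j. ?S y j - ?S y' j", OF s] by simp
qed

text \<open>The field on the shape modes as a real-linear map of the nonlinear ingredients: products
  with \<open>om\<close> and the projected forces. One linear bound then serves both for the size of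
  the field and for its differences.\<close>

fun shape_map :: "mode \<Rightarrow> real \<Rightarrow> real \<Rightarrow> (nat \<Rightarrow> complex) \<Rightarrow> (nat \<Rightarrow> complex) \<Rightarrow> (nat \<Rightarrow> complex) \<Rightarrow> complex" where
  "shape_map Ang a b Z Y f = of_real (Im (f 1) - a)"
| "shape_map Kep a b Z Y f = - 2 * of_real (Im (f 1) - a) - \<i> * of_real (b + Re (f 1))"
| "shape_map (Grow k) a b Z Y f = (if 2 \<le> k \<and> k < n then of_real (enc_grow (nu k) (- \<i> * Z k) (f k - \<i> * Y k)) else 0)"
| "shape_map (Decay k) a b Z Y f = (if 2 \<le> k \<and> k < n then of_real (enc_decay (nu k) (- \<i> * Z k) (f k - \<i> * Y k)) else 0)"
| "shape_map (Ell k) a b Z Y f = (if 2 \<le> k \<and> k < n then enc_ell (nu k) (- \<i> * Z k) (f k - \<i> * Y k) else 0)"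
| "shape_map _ a b Z Y f = 0"

definition "is_shape k \<longleftrightarrow> k \<notin> {Phase, OutA, OutB, OutC, OutD}"

lemma field_shape: "is_shape k \<Longrightarrow> field t y k = shape_map k (om y * pp y) (om y * (ss y - rr y))
    (\<lambda>l. of_real (om y) * dZ y l) (\<lambda>l. of_real (om y) * dY y l) (frc t y)"
  by (cases k) (auto simp: is_shape_def fZ_def fY_def mult.assoc)

lemma shape_map_diff: "shape_map k a b Z Y f - shape_map k a' b' Z' Y' f'
    = shape_map k (a - a') (b - b') (\<lambda>l. Z l - Z' l) (\<lambda>l. Y l - Y' l) (\<lambda>l. f l - f' l)"
  by (cases k) (auto simp: complex_eq_iff enc_grow_def enc_decay_def enc_ell_def enc_u_def enc_v_def algebra_simps)

lemma shape_map_bound: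
  assumes "\<bar>a\<bar> \<le> c" "\<bar>b\<bar> \<le> c" "\<And>l. norm (Z l) \<le> c" "\<And>l. norm (Y l) \<le> c" "\<And>l. 1 \<le> l \<Longrightarrow> l < n \<Longrightarrow> norm (f l) \<le> g"
  shows "norm (shape_map k a b Z Y f) \<le> 15 * H\<^sup>2 * (2 * c + g)"
proof -
  have f1: "\<bar>Re (f 1)\<bar> \<le> g" "\<bar>Im (f 1)\<bar> \<le> g"
    using assms(5)[of 1] n abs_Re_le_cmod[of "f 1"] abs_Im_le_cmod[of "f 1"] by auto
  have c0: "0 \<le> c" "0 \<le> g" using assms(1) f1 by linarith+
  have "2 * 2 \<le> H * H" using H by (intro mult_mono) auto
  then have "4 \<le> 15 * H\<^sup>2" by (simp add: power2_eq_square)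
  then have H4: "1 * (2 * c + g) \<le> 4 * (2 * c + g)" "4 * (2 * c + g) \<le> 15 * H\<^sup>2 * (2 * c + g)"
    using c0 by (intro mult_right_mono; simp)+
  have E: "norm (- \<i> * Z l) + norm (f l - \<i> * Y l) \<le> 2 * c + g" if "2 \<le> l" "l < n" for l
    using norm_triangle_ineq4[of "f l" "\<i> * Y l"] assms(3)[of l] assms(4)[of l] assms(5)[of l] that
    by (simp add: norm_mult)
  have M: "15 * H\<^sup>2 * (norm (- \<i> * Z l) + norm (f l - \<i> * Y l)) \<le> 15 * H\<^sup>2 * (2 * c + g)" if "2 \<le> l" "l < n" for l
    using E[OF that] by (intro mult_left_mono) auto
  have Z: "0 \<le> 15 * H\<^sup>2 * (2 * c + g)" using c0 by simp
  show ?thesis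
  proof (cases k)
    case Ang
    have "norm (shape_map k a b Z Y f) \<le> 2 * c + g"
      unfolding Ang shape_map.simps norm_of_real using f1 assms(1) c0 by linarith
    then show ?thesis using H4 unfolding mult_1_left by (meson order_trans)
  next
    case Kep
    have "norm (shape_map k a b Z Y f) \<le> norm (- 2 * complex_of_real (Im (f 1) - a)) + norm (\<i> * complex_of_real (b + Re (f 1)))"
      unfolding Kep shape_map.simps by (rule norm_triangle_ineq4)
    also have "\<dots> = 2 * \<bar>Im (f 1) - a\<bar> + \<bar>b + Re (f 1)\<bar>" by (simp only: norm_mult norm_of_real) simp
    also have "\<dots> \<le> 8 * c + 4 * g"
    proof -
      have "\<bar>Im (f 1) - a\<bar> \<le> g + c" "\<bar>b + Re (f 1)\<bar> \<le> c + g" using f1 assms(1,2) by linarith+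
      then have "2 * \<bar>Im (f 1) - a\<bar> \<le> 2 * g + 2 * c" "\<bar>b + Re (f 1)\<bar> \<le> c + g" by simp_all
      then show ?thesis using c0 by linarith
    qed
    also have "\<dots> = 4 * (2 * c + g)" by simp
    finally show ?thesis using H4(2) by (rule order_trans)
  next
    case (Grow l)
    then show ?thesis using order_trans[OF enc_bounds(1)[OF nu, of l "- \<i> * Z l" "f l - \<i> * Y l"] M[of l]] Z by simp
  next
    case (Decay l)
    then show ?thesis using order_trans[OF enc_bounds(2)[OF nu, of l "- \<i> * Z l" "f l - \<i> * Y l"] M[of l]] Z by simp
  next
    case (Ell l)
    then show ?thesis using order_trans[OF enc_bounds(3)[OF nu, of l "- \<i> * Z l" "f l - \<i> * Y l"] M[of l]] Z by simp
  qed (use Z in auto)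
qed

text \<open>Rounded up from \<open>15 * 6400 + 15 * 64\<close>, the coefficient of the quadratic
  terms.\<close>

definition "KS = 100000 * real n ^ 4 * H ^ 6"

lemma KS_ge: "15 * H\<^sup>2 * (64 * H\<^sup>2 + 6400 * real n ^ 4 * H ^ 4) \<le> KS" "15 * H\<^sup>2 * (1616 * real n * H) \<le> KS"
   "15 * H\<^sup>2 * (808 * real n) \<le> KS" "15 * H\<^sup>2 * (404 * real n ^ 2) \<le> KS" "1 \<le> KS"
proof -
  have nn: "1 \<le> real n ^ 4" "real n \<le> real n ^ 4" "real n ^ 2 \<le> real n ^ 4"
    using n by (auto intro: one_le_power self_le_power power_increasing)
  have HH: "H ^ 2 \<le> H ^ 6" "H ^ 3 \<le> H ^ 6" "H ^ 4 \<le> H ^ 6" "1 \<le> H ^ 6"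
    using H by (auto intro: one_le_power power_increasing)
  have p: "0 \<le> real n" "0 \<le> H" using H by auto
  have a: "1 * H ^ 4 \<le> real n ^ 4 * H ^ 6" "real n * H ^ 3 \<le> real n ^ 4 * H ^ 6"
    "real n * H ^ 2 \<le> real n ^ 4 * H ^ 6" "real n ^ 2 * H ^ 2 \<le> real n ^ 4 * H ^ 6" "1 * 1 \<le> real n ^ 4 * H ^ 6"
    using nn HH p by (intro mult_mono; simp)+
  have "15 * H\<^sup>2 * (64 * H\<^sup>2 + 6400 * real n ^ 4 * H ^ 4) = 960 * H ^ 4 + 96000 * (real n ^ 4 * H ^ 6)"
    "15 * H\<^sup>2 * (1616 * real n * H) = 24240 * (real n * H ^ 3)" "15 * H\<^sup>2 * (808 * real n) = 12120 * (real n * H\<^sup>2)"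
    "15 * H\<^sup>2 * (404 * real n ^ 2) = 6060 * (real n ^ 2 * H\<^sup>2)" "KS = 100000 * (real n ^ 4 * H ^ 6)"
    by (simp_all add: KS_def power_eq_if distrib_left)
  then show "15 * H\<^sup>2 * (64 * H\<^sup>2 + 6400 * real n ^ 4 * H ^ 4) \<le> KS" "15 * H\<^sup>2 * (1616 * real n * H) \<le> KS"
   "15 * H\<^sup>2 * (808 * real n) \<le> KS" "15 * H\<^sup>2 * (404 * real n ^ 2) \<le> KS" "1 \<le> KS"
    using a by linarith+
qed

text \<open>The decisive structure: the difference \<open>p\<close> of the phases and
  \<open>r\<close> of the outer positions occur only with \<open>mn\<close>, and the shape itself
  only with \<open>b\<close> or \<open>mn\<close>. All links into the shape modes can therefore be
  made weak.\<close>

lemma field_shape_diff: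
  assumes w: "wide t y P" "wide t y' P" and y: "tiny y b" "tiny y' b"
    and D: "\<And>k. norm (dZ y k - dZ y' k) \<le> D" "\<And>k. norm (dY y k - dY y' k) \<le> D"
    and p: "norm (y Phase - y' Phase) \<le> p" and r: "norm (rho y - rho y') \<le> r" and k: "is_shape k"
  shows "norm (field t y k - field t y' k) \<le> KS * (b * D + mn / R0 t ^ 3 * (p + r + D))"
proof -
  have b0: "0 \<le> b" using tinyD[OF y(1)] by auto
  have D0: "0 \<le> D" and p0: "0 \<le> p" and r0: "0 \<le> r" using order_trans[OF norm_ge_zero D(1)] order_trans[OF norm_ge_zero p] order_trans[OF norm_ge_zero r] .
  have R: "0 < R0 t" using w by (auto simp: wide_def)
  define s where "s = mn / R0 t ^ 3"
  have s: "0 \<le> s" using R mn by (simp add: s_def)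
  define c where "c = 32 * H\<^sup>2 * (b * D)"
  define g where "g = 6400 * real n ^ 4 * H ^ 4 * (b * D) + s * (1616 * real n * H * p + 808 * real n * r + 404 * real n ^ 2 * D)"
  have q: "\<bar>pp y - pp y'\<bar> \<le> D" "\<bar>rr y - rr y'\<bar> \<le> D" "\<bar>ss y - ss y'\<bar> \<le> D"
    unfolding rr_ss_pp using D(1)[of 1] D(2)[of 1] abs_Re_le_cmod[of "dZ y 1 - dZ y' 1"]
      abs_Re_le_cmod[of "dY y 1 - dY y' 1"] abs_Im_le_cmod[of "dY y 1 - dY y' 1"] by simp_all
  note rb = rr_ss_pp_bound[OF y(2)]
  have c1: "1 * (16 * H\<^sup>2 * b * D) \<le> c" "2 * (16 * H\<^sup>2 * b * D) \<le> c" using b0 D0 by (simp_all add: c_def)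
  have "norm (complex_of_real (om y) * of_real (pp y) - of_real (om y') * of_real (pp y')) \<le> 1 * (16 * H\<^sup>2 * b * D)"
    by (rule om_times_diff[OF y D]) (use q rb in \<open>simp_all flip: of_real_diff\<close>)
  then have a1: "\<bar>om y * pp y - om y' * pp y'\<bar> \<le> c" using c1 by (simp only: of_real_mult[symmetric] of_real_diff[symmetric] norm_of_real)
  have "norm (complex_of_real (om y) * of_real (ss y - rr y) - of_real (om y') * of_real (ss y' - rr y')) \<le> 2 * (16 * H\<^sup>2 * b * D)"
  proof (rule om_times_diff[OF y D])
    show "norm (complex_of_real (ss y - rr y) - of_real (ss y' - rr y')) \<le> 2 * D"
      unfolding of_real_diff[symmetric] norm_of_real using q by linarith
    show "norm (complex_of_real (ss y' - rr y')) \<le> 2 * b" unfolding norm_of_real using rb by linarith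
  qed simp
  then have a2: "\<bar>om y * (ss y - rr y) - om y' * (ss y' - rr y')\<bar> \<le> c"
    using c1 by (simp only: of_real_mult[symmetric] of_real_diff[symmetric] norm_of_real)
  have a3: "norm (of_real (om y) * dZ y l - of_real (om y') * dZ y' l) \<le> c" for l
    by (rule order_trans[OF om_times_diff[OF y D, of _ _ 1] c1(1)]) (use D tinyD[OF y(2)] in auto)
  have a4: "norm (of_real (om y) * dY y l - of_real (om y') * dY y' l) \<le> c" for l
    by (rule order_trans[OF om_times_diff[OF y D, of _ _ 1] c1(1)]) (use D tinyD[OF y(2)] in auto)
  have "norm (field t y k - field t y' k) \<le> 15 * H\<^sup>2 * (2 * c + g)"
    unfolding field_shape[OF k] shape_map_diff
    by (rule shape_map_bound[OF a1 a2 a3 a4]) (use frc_diff[OF w y D(1) _ p r] in \<open>simp add: g_def s_def\<close>)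
  also have "\<dots> = 15 * H\<^sup>2 * (64 * H\<^sup>2 + 6400 * real n ^ 4 * H ^ 4) * (b * D)
     + s * (15 * H\<^sup>2 * (1616 * real n * H) * p + 15 * H\<^sup>2 * (808 * real n) * r + 15 * H\<^sup>2 * (404 * real n ^ 2) * D)"
    by (simp add: c_def g_def algebra_simps)
  also have "\<dots> \<le> KS * (b * D) + s * (KS * p + KS * r + KS * D)"
    using KS_ge b0 D0 p0 r0 s by (intro add_mono mult_left_mono mult_right_mono) auto
  also have "\<dots> = KS * (b * D + s * (p + r + D))" by (simp add: algebra_simps)
  finally show ?thesis by (simp only: s_def)
qed

lemma field_shape_bound:
  assumes w: "wide t y P" and y: "tiny y b" and k: "is_shape k"
  shows "norm (field t y k) \<le> KS * (b * b + mn / R0 t ^ 3)"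
proof -
  have b0: "0 \<le> b" using tinyD[OF y] by auto
  have R: "0 < R0 t" using w by (auto simp: wide_def)
  define s where "s = mn / R0 t ^ 3"
  have s: "0 \<le> s" using R mn by (simp add: s_def)
  define c where "c = 32 * H\<^sup>2 * (b * b)"
  define g where "g = 6400 * real n ^ 4 * H ^ 4 * (b * b) + s * (808 * real n * H)"
  note rb = rr_ss_pp_bound[OF y] and ob = om_bound[OF y]
  have "H \<le> H\<^sup>2" using H by (simp add: power2_eq_square)
  then have "4 * H * b * (2 * b) \<le> 8 * H\<^sup>2 * (b * b)"
    using b0 by (simp add: mult_right_mono)
  moreover have "0 \<le> H\<^sup>2 * (b * b)" using b0 by simp
  ultimately have cb: "4 * H * b * (2 * b) \<le> c" unfolding c_def by linarith
  have c2: "4 * H * b * b \<le> 4 * H * b * (2 * b)" using b0 H by (intro mult_left_mono) auto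
  have a1: "\<bar>om y * pp y\<bar> \<le> c"
  proof -
    have "\<bar>om y\<bar> * \<bar>pp y\<bar> \<le> 4 * H * b * b" by (rule mult_mono[OF ob rb(3)]) (use b0 H in auto)
    then show ?thesis unfolding abs_mult using cb c2 by linarith
  qed
  have "\<bar>ss y - rr y\<bar> \<le> 2 * b" using rb by linarith
  then have a2: "\<bar>om y * (ss y - rr y)\<bar> \<le> c"
  proof -
    assume *: "\<bar>ss y - rr y\<bar> \<le> 2 * b"
    have "\<bar>om y\<bar> * \<bar>ss y - rr y\<bar> \<le> 4 * H * b * (2 * b)" by (rule mult_mono[OF ob *]) (use b0 H in auto)
    then show ?thesis unfolding abs_mult using cb by linarith
  qed
  have a3: "norm (of_real (om y) * dZ y l) \<le> c" "norm (of_real (om y) * dY y l) \<le> c" for l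
  proof -
    have "\<bar>om y\<bar> * norm (dZ y l) \<le> 4 * H * b * b" "\<bar>om y\<bar> * norm (dY y l) \<le> 4 * H * b * b"
      by (rule mult_mono[OF ob tinyD(1)[OF y]] mult_mono[OF ob tinyD(2)[OF y]]; use b0 H in simp)+
    then show "norm (of_real (om y) * dZ y l) \<le> c" "norm (of_real (om y) * dY y l) \<le> c"
      unfolding norm_mult norm_of_real using cb c2 by linarith+
  qed
  have "norm (field t y k) \<le> 15 * H\<^sup>2 * (2 * c + g)"
    unfolding field_shape[OF k]
    by (rule shape_map_bound[OF a1 a2 a3]) (use frc_bound[OF w y] in \<open>simp add: g_def s_def\<close>)
  also have "\<dots> = 15 * H\<^sup>2 * (64 * H\<^sup>2 + 6400 * real n ^ 4 * H ^ 4) * (b * b) + s * (15 * H\<^sup>2 * (808 * real n * H))"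
    by (simp add: c_def g_def algebra_simps)
  also have "\<dots> \<le> KS * (b * b) + s * KS"
  proof (intro add_mono mult_left_mono mult_right_mono KS_ge s)
    have "15 * H\<^sup>2 * (808 * real n * H) \<le> 15 * H\<^sup>2 * (1616 * real n * H)" using H by (intro mult_left_mono) auto
    then show "15 * H\<^sup>2 * (808 * real n * H) \<le> KS" using KS_ge(2) by (rule order_trans)
  qed (use b0 in simp)
  finally show ?thesis by (simp add: s_def algebra_simps)
qed

end

section \<open>Power bounds for scalar propagators\<close>

lemma propagator_quotient:
  assumes "0 < s" "0 < t"
  shows "norm (propagator a p t / propagator a p s) = exp (Re a * (t - s) + p * (ln t - ln s))"
  using assms by (simp add: propagator_def norm_divide exp_diff[symmetric] algebra_simps)

lemma dichotomy_power:
  assumes T: "0 < T" and d: "if d then Re a \<le> 0 else 0 \<le> Re a"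
  shows "dichotomy d a p T p"
  unfolding dichotomy_def
proof (intro allI impI)
  fix s t assume st: "T \<le> s" "T \<le> t" "if d then s \<le> t else t \<le> s"
  have "Re a * (t - s) \<le> 0"
    using d st(3) by (auto simp: mult_le_0_iff split: if_splits)
  then have "exp (Re a * (t - s) + p * (ln t - ln s)) \<le> exp (p * (ln t - ln s))" by simp
  also have "\<dots> = (t / s) powr p" using T st by (simp add: powr_def ln_div)
  finally show "norm (propagator a p t / propagator a p s) \<le> (t / s) powr p"
    using T st by (simp add: propagator_quotient)
qed

text \<open>Forward integration in the weight \<open>t^(-1)\<close> needs an exponent below -1, so
  the exponential decay has to be exploited. Since \<open>ln t - ln s \<le> (t - s) / T\<close>, it
  beats \<open>t^(-2)\<close> as soon as \<open>2 \<le> h * T\<close>.\<close>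

lemma dichotomy_decay:
  assumes T: "0 < T" and h: "2 \<le> h * T"
  shows "dichotomy True (- of_real h) 0 T (-2)"
  unfolding dichotomy_def
proof (intro allI impI)
  fix s t assume st: "T \<le> s" "T \<le> t" "if True then s \<le> t else t \<le> s"
  have s0: "0 < s" "0 < t" using T st by auto
  have h0: "0 < h" using T h by (metis less_le_trans zero_less_mult_pos2 zero_less_numeral)
  have "ln t - ln s = ln (t / s)" using s0 by (simp add: ln_div)
  also have "\<dots> \<le> t / s - 1" using s0 by (intro ln_le_minus_one) auto
  also have "\<dots> = (t - s) / s" using s0 by (simp add: diff_divide_distrib)
  also have "\<dots> \<le> (t - s) / T" using st T s0 by (intro divide_left_mono) auto
  finally have l: "ln t - ln s \<le> (t - s) / T" .
  have "2 * (ln t - ln s) \<le> h * T * ((t - s) / T)"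
    using l h st T s0 by (intro mult_mono) auto
  also have "\<dots> = h * (t - s)" using T by simp
  finally have "- h * (t - s) \<le> -2 * (ln t - ln s)" by simp
  then have "exp (- h * (t - s)) \<le> exp (-2 * (ln t - ln s))" by simp
  also have "\<dots> = (t / s) powr (-2)" using s0 by (simp add: powr_def ln_div)
  finally show "norm (propagator (- of_real h) 0 t / propagator (- of_real h) 0 s) \<le> (t / s) powr (-2)"
    using s0 by (simp add: propagator_quotient)
qed

section \<open>Existence of the perturbed solution\<close>

context planar_data
begin

lemma zeta_distinct:
  assumes "tiny y b" "i < n" "j < n" "i \<noteq> j"
  shows "zeta y j - zeta y i \<noteq> 0"
proof
  assume "zeta y j - zeta y i = 0"
  then have "of_real (x j - x i) = disp y i - disp y j" by (simp add: zeta_def algebra_simps)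
  then have "\<bar>x j - x i\<bar> = norm (disp y i - disp y j)" by (metis norm_of_real)
  also have "\<dots> \<le> real n * b + real n * b"
    by (rule order_trans[OF norm_triangle_ineq4])
      (intro add_mono disp_bound tinyD(1)[OF assms(1)] assms)
  also have "\<dots> \<le> 1 / (4 * H) + 1 / (4 * H)" by (intro add_mono tinyD(6)[OF assms(1)])
  also have "\<dots> < 1 / H" using H by (simp add: field_simps)
  also have "\<dots> \<le> \<bar>x j - x i\<bar>" using xg[of j i] assms by simp
  finally show False by simp
qed

lemma outer_distinct:
  assumes w: "wide t y P" and y: "tiny y b" and i: "i < n"
  shows "of_real (R0 t) + rho y - pos t y i \<noteq> 0" "of_real (R0 t) + rho y \<noteq> 0"
proof -
  have R: "0 < R0 t" "norm (rho y) \<le> P" "P + 2 * H \<le> R0 t / 2" using w by (auto simp: wide_def)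
  have z: "norm (pos t y i) \<le> 2 * H" using zeta_bound[OF y i] by (simp add: norm_pos)
  have a: "norm (pos t y i - rho y) \<noteq> norm (complex_of_real (R0 t))"
    using norm_triangle_ineq4[of "pos t y i" "rho y"] R z by simp
  show "of_real (R0 t) + rho y - pos t y i \<noteq> 0"
  proof
    assume "of_real (R0 t) + rho y - pos t y i = 0"
    then have "pos t y i - rho y = of_real (R0 t)" by (simp add: algebra_simps)
    then show False using a by simp
  qed
  have b: "norm (- rho y) \<noteq> norm (complex_of_real (R0 t))" using R H by simp
  show "of_real (R0 t) + rho y \<noteq> 0"
  proof
    assume "of_real (R0 t) + rho y = 0"
    then have "- rho y = of_real (R0 t)" by (simp add: add_eq_0_iff)
    then show False using b by simp
  qed
qed

section \<open>Continuity of the field along admissible curves\<close>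

context
  fixes y :: "real \<Rightarrow> mode \<Rightarrow> complex" and S :: "real set" and P :: real
  assumes S: "\<And>t. t \<in> S \<Longrightarrow> 0 < t"
    and yc: "\<And>l. continuous_on S (\<lambda>t. y t l)"
    and ty: "\<And>t. t \<in> S \<Longrightarrow> \<exists>b. tiny (y t) b"
    and wi: "\<And>t. t \<in> S \<Longrightarrow> wide t (y t) P"
begin

lemma cont_small:
  "continuous_on S (\<lambda>t. rr (y t))" "continuous_on S (\<lambda>t. pp (y t))" "continuous_on S (\<lambda>t. ss (y t))"
  "continuous_on S (\<lambda>t. rho (y t))" "continuous_on S (\<lambda>t. ph t (y t))"
  unfolding rr_def pp_def ss_def rho_def ph_def by (intro continuous_intros yc)+

lemma cont_dec: "continuous_on S (\<lambda>t. dZ (y t) k)" "continuous_on S (\<lambda>t. dY (y t) k)"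
  by (cases "k = 1"; simp add: dZ_def dY_def;
      (unfold dec_Z_def dec_Y_def dec_xi_def dec_w_def dec_d_def divide_inverse)?;
      intro continuous_intros cont_small yc)+

lemma cont_disp: "continuous_on S (\<lambda>t. disp (y t) i)" "continuous_on S (\<lambda>t. zeta (y t) i)"
  "continuous_on S (\<lambda>t. pos t (y t) i)"
  unfolding pos_def zeta_def disp_def by (intro continuous_intros cont_small cont_dec)+

lemma cont_R0: "continuous_on S R0"
  unfolding R0_def [abs_def] by (intro continuous_intros) (use S in force)+

lemma cont_om: "continuous_on S (\<lambda>t. om (y t))"
proof -
  have "a0 + rr (y t) \<noteq> 0" if t: "t \<in> S" for t
  proof -
    obtain b where "tiny (y t) b" using ty[OF t] by blast
    then have "1 / (2 * H) \<le> a0 + rr (y t)" by (rule rr_ss_pp_bound)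
    moreover have "0 < 1 / (2 * H)" using H by simp
    ultimately show ?thesis by linarith
  qed
  then show ?thesis unfolding om_def by (intro continuous_intros cont_small) auto
qed

lemma cont_frc: "continuous_on S (\<lambda>t. frc t (y t) k)"
proof -
  have kk: "continuous_on S (\<lambda>t. kern (zeta (y t) j - zeta (y t) i))" if "i < n" "j < n" for i j
  proof (cases "i = j")
    case True
    then show ?thesis by simp
  next
    case False
    show ?thesis
      by (intro continuous_intros cont_disp) (use ty zeta_distinct[OF _ that False] in blast)
  qed
  have "continuous_on S (\<lambda>t. frem (y t) i)" if "i < n" for i
    unfolding frem_def kern_lin_def divide_inverse
    by (intro continuous_intros kk cont_disp that) auto
  moreover have "continuous_on S (\<lambda>t. tide t (y t) i)" if "i < n" for i
    unfolding tide_def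
    by (intro continuous_intros cont_disp cont_small cont_R0)
      (use ty wi outer_distinct[OF _ _ that] in blast)+
  ultimately show ?thesis
    unfolding frc_def proj_def by (intro continuous_intros) auto
qed

lemma cont_outer: "continuous_on S (\<lambda>t. outer t (y t))"
proof -
  have R: "R0 t \<noteq> 0" if "t \<in> S" for t using wi[OF that] by (auto simp: wide_def)
  have "continuous_on S (\<lambda>t. kern (of_real (R0 t) + rho (y t) - pos t (y t) i))" if "i < n" for i
    by (intro continuous_intros cont_disp cont_small cont_R0)
      (use ty wi outer_distinct(1)[OF _ _ that] in blast)
  moreover have "continuous_on S (\<lambda>t. (1 + kern_lin (rho (y t) / of_real (R0 t))) / of_real ((R0 t)\<^sup>2))"
    unfolding kern_lin_def by (intro continuous_intros cont_small cont_R0) (use R in auto)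
  ultimately show ?thesis unfolding outer_def
    by (intro continuous_on_mult continuous_on_const continuous_on_sum continuous_on_diff) auto
qed

lemma cont_enc:
  "continuous_on S (\<lambda>t. enc_grow c (fZ (y t) l) (fY t (y t) l))"
  "continuous_on S (\<lambda>t. enc_decay c (fZ (y t) l) (fY t (y t) l))"
  "continuous_on S (\<lambda>t. enc_ell c (fZ (y t) l) (fY t (y t) l))"
  unfolding fZ_def fY_def enc_grow_def enc_decay_def enc_ell_def enc_u_def enc_v_def
  by (intro continuous_intros cont_om cont_small cont_frc cont_dec)+

lemma cont_field: "continuous_on S (\<lambda>t. field t (y t) k)"
proof (cases k)
  case (Grow l)
  then show ?thesis by (cases "2 \<le> l \<and> l < n") (auto intro!: continuous_intros cont_enc)
next
  case (Decay l)
  then show ?thesis by (cases "2 \<le> l \<and> l < n") (auto intro!: continuous_intros cont_enc)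
next
  case (Ell l)
  then show ?thesis by (cases "2 \<le> l \<and> l < n") (auto intro!: continuous_intros cont_enc)
qed (simp_all only: field.simps, (intro continuous_intros cont_om cont_small cont_frc cont_outer)+)

end

section \<open>Exponents, weights and radii\<close>

fun rate :: "mode \<Rightarrow> complex" where
  "rate Kep = \<i>" | "rate (Grow k) = of_real (hyp_rate (nu k))" | "rate (Decay k) = - of_real (hyp_rate (nu k))"
| "rate (Ell k) = \<i> * of_real (ell_rate (nu k))" | "rate _ = 0"

fun pw :: "mode \<Rightarrow> real" where
  "pw OutA = 4 / 3" | "pw OutB = - 1 / 3" | "pw OutC = 1 / 3" | "pw OutD = 2 / 3" | "pw _ = 0"

fun ex :: "mode \<Rightarrow> real" where
  "ex OutA = 4 / 3" | "ex OutB = - 1 / 3" | "ex OutC = 1 / 3" | "ex OutD = 2 / 3" | "ex (Decay k) = - 2" | "ex _ = 0"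

text \<open>Decaying modes are integrated from \<open>T\<close>. So is the phase, because its
  derivative of order \<open>1/t\<close> is not integrable at infinity.\<close>

definition fwd :: "mode \<Rightarrow> bool" where
  "fwd k \<longleftrightarrow> k = Phase \<or> k = OutB \<or> (\<exists>l. k = Decay l)"

text \<open>
  The difference of two phases may grow like \<open>t\<^bsup>1/6\<^esup>\<close>, which is below the smallest exponent \<open>1/3\<close>
  integrated from infinity in the outer equation; the weights \<open>wt'\<close> for the other modes follow.
\<close>

fun wt :: "mode \<Rightarrow> real" where
  "wt Phase = 1 / 6" | "wt OutA = 0" | "wt OutB = 0" | "wt OutC = 0" | "wt OutD = 0" | "wt _ = - 1"

fun wt' :: "mode \<Rightarrow> real" where
  "wt' Phase = 1 / 6" | "wt' OutA = 1 / 6" | "wt' OutB = 1 / 6" | "wt' OutC = 1 / 6" | "wt' OutD = 1 / 6" | "wt' _ = - 5 / 6"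

text \<open>Chosen so that the quadratic self-coupling takes one sixth of the radius:
  \<open>KS * (400 * H ^ 4 * ru) = 1 / 6\<close>.\<close>

definition "ru = 1 / (2400 * KS * H ^ 4)"
text \<open>Chosen so that the Lipschitz bound of \<open>om\<close>, with
  \<open>12 H^2 * 20 H^2 = 240 H^4\<close>, gives \<open>1 / 12\<close>, half of the gap
  \<open>1 / 6\<close> of the phase.\<close>

definition "Bu = 1 / (2880 * H ^ 4)"
text \<open>As \<open>4848 = 24 * 202\<close>, the influence of phase and shape on the outer modes
  is a 24th of their weight.\<close>

definition "Bo = 4848 * (2 * H + real n)"

text \<open>The outer radius \<open>15 * H\<close> is the bound \<open>5 * H\<close> for the outer
  forcing divided by the smallest outer gap \<open>1 / 3\<close>.\<close>

fun rad :: "mode \<Rightarrow> real" where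
  "rad Phase = 1" | "rad OutA = 15 * H" | "rad OutB = 15 * H" | "rad OutC = 15 * H" | "rad OutD = 15 * H" | "rad _ = ru"

fun Bm :: "mode \<Rightarrow> real" where
  "Bm Phase = 1" | "Bm OutA = Bo" | "Bm OutB = Bo" | "Bm OutC = Bo" | "Bm OutD = Bo" | "Bm _ = Bu"

definition "inball t y \<longleftrightarrow> (\<forall>k. norm (y k) \<le> rad k * t powr wt k)"

lemma constants: "0 < ru" "0 < Bu" "0 < Bo" "KS * (400 * H ^ 4 * ru) = 1 / 6" "240 * H ^ 4 * Bu = 1 / 12"
  "20 * H\<^sup>2 * Bu \<le> 1" "80 * real n * H ^ 3 * ru \<le> 1" "480 * H ^ 3 * ru \<le> 1" "Bu \<le> 1"
proof -
  have K: "1 \<le> KS" by (rule KS_ge)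
  have h: "1 \<le> H ^ k" for k using H by (intro one_le_power) simp
  have hp: "0 < H ^ k" for k using h[of k] by linarith
  show "0 < ru" "0 < Bu" "0 < Bo" using K hp H by (auto simp: ru_def Bu_def Bo_def)
  show "KS * (400 * H ^ 4 * ru) = 1 / 6" "240 * H ^ 4 * Bu = 1 / 12" using K hp[of 4] H by (auto simp: ru_def Bu_def field_simps)
  have "H\<^sup>2 \<le> H ^ 4" using H by (intro power_increasing) auto
  then have "20 * H\<^sup>2 \<le> 2880 * H ^ 4" using hp[of 4] by linarith
  then show "20 * H\<^sup>2 * Bu \<le> 1" using hp[of 4] H by (simp add: Bu_def divide_le_eq)
  show "Bu \<le> 1" using h[of 4] by (simp add: Bu_def divide_le_eq)
  have "15 * 1 * (808 * real n) \<le> 15 * H\<^sup>2 * (808 * real n)" using h[of 2] by (intro mult_mono) auto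
  then have nK: "real n \<le> KS" using KS_ge(3) by simp
  have H34: "H ^ 3 \<le> H ^ 4" using H by (intro power_increasing) auto
  have pK: "0 < 2400 * KS * H ^ 4" using K hp[of 4] by simp
  have "real n * H ^ 3 \<le> KS * H ^ 4" "1 * H ^ 3 \<le> KS * H ^ 4"
    using nK H34 K hp[of 3] by (intro mult_mono; simp)+
  moreover have "0 < KS * H ^ 4" using K hp[of 4] by simp
  ultimately have "80 * (real n * H ^ 3) \<le> 2400 * (KS * H ^ 4)" "480 * H ^ 3 \<le> 2400 * (KS * H ^ 4)" by linarith+
  then have "80 * real n * H ^ 3 \<le> 2400 * KS * H ^ 4" "480 * H ^ 3 \<le> 2400 * KS * H ^ 4" by (simp_all add: mult.assoc)
  then show "80 * real n * H ^ 3 * ru \<le> 1" "480 * H ^ 3 * ru \<le> 1"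
    using pK by (simp_all add: ru_def divide_le_eq)
qed

lemma kap: "0 < kap" "1 \<le> kap" "0 < t \<Longrightarrow> R0 t ^ 3 = 9 / 2 * mtot * t\<^sup>2" "0 < t \<Longrightarrow> mtot / R0 t ^ 3 = 2 / 9 * t powr (-2)"
  "0 < t \<Longrightarrow> 1 / R0 t ^ 3 \<le> t powr (-2)" "1 \<le> t \<Longrightarrow> t powr (2/3) \<le> R0 t"
proof -
  have M: "2 \<le> mtot" by (rule mass_in)
  show k: "0 < kap" using M by (simp add: kap_def)
  show k1: "1 \<le> kap" unfolding kap_def using M by (intro ge_one_powr_ge_zero) auto
  show R: "R0 t ^ 3 = 9 / 2 * mtot * t\<^sup>2" if "0 < t" for t
  proof -
    have cube: "(a powr q) ^ 3 = a powr (q + q + q)" for a q :: real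
      unfolding power3_eq_cube powr_add by simp
    show ?thesis
      unfolding R0_def kap_def power_mult_distrib cube using M that by simp
  qed
  have p: "t powr (-2) = 1 / t\<^sup>2" if "0 < t" for t :: real
    using that by (simp add: powr_minus_divide)
  show "mtot / R0 t ^ 3 = 2 / 9 * t powr (-2)" if "0 < t" for t
    unfolding R[OF that] p[OF that] using M that by (simp add: field_simps)
  show "1 / R0 t ^ 3 \<le> t powr (-2)" if "0 < t" for t
    unfolding R[OF that] p[OF that] using M that by (intro divide_left_mono) (auto simp: mult_le_cancel_right1)
  show "t powr (2/3) \<le> R0 t" if "1 \<le> t" for t
    using mult_right_mono[OF k1, of "t powr (2/3)"] by (simp add: R0_def)
qed

end

text \<open>A large initial time makes the expansion at the escaping body accurate. The two bounds
  on \<open>mn\<close> come after the weights: the first keeps the iteration in the ball, the second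
  makes the return from phase and outer modes to the shape weak enough for the contraction.\<close>

locale planar_problem = planar_data +
  fixes T :: real
  assumes T1: "1 \<le> T" and T2: "10000000 * H\<^sup>2 \<le> T powr (2/3)"
    and mn1: "KS * mn \<le> ru / 2" and mn2: "KS * mn * (2 + 4 * Bo) \<le> Bu / 5"
begin

lemma in_range:
  assumes t: "T \<le> t" and y: "inball t y"
  shows "tiny y (20 * H\<^sup>2 * (ru * t powr (-1)))" "wide t y (60 * H)"
    and "10000000 * H\<^sup>2 \<le> R0 t"
proof -
  have t1: "1 \<le> t" using t T1 by simp
  have b: "norm (y k) \<le> rad k * t powr wt k" for k using y by (simp add: inball_def)
  have tp: "t powr (-1) \<le> 1" using t1 by (simp add: powr_minus_divide divide_le_eq)
  have "shape_le y (ru * t powr (-1))"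
    unfolding shape_le_def
  proof (intro conjI allI)
    show "norm (y Ang) \<le> ru * t powr (-1)" "norm (y Kep) \<le> ru * t powr (-1)" using b[of Ang] b[of Kep] by simp_all
    show "norm (y (Grow l)) \<le> ru * t powr (-1)" "norm (y (Decay l)) \<le> ru * t powr (-1)"
      "norm (y (Ell l)) \<le> ru * t powr (-1)" for l using b[of "Grow l"] b[of "Decay l"] b[of "Ell l"] by simp_all
  qed
  note sb = shape_le_bounds[OF this]
  have "4 * real n * H * (20 * H\<^sup>2 * (ru * t powr (-1))) = 80 * real n * H ^ 3 * ru * t powr (-1)"
    by (simp add: power_eq_if)
  also have "\<dots> \<le> 1 * 1" using constants tp H by (intro mult_mono) auto
  finally show "tiny y (20 * H\<^sup>2 * (ru * t powr (-1)))" using sb by (simp add: tiny_def)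
  have "T powr (2/3) \<le> t powr (2/3)" using t T1 by (intro powr_mono2) auto
  then show R: "10000000 * H\<^sup>2 \<le> R0 t" using T2 kap(6)[OF t1] by linarith
  have c: "\<bar>Re (y l)\<bar> \<le> 15 * H" if "l \<in> {OutA, OutB, OutC, OutD}" for l
  proof -
    have "norm (y l) \<le> 15 * H" using b[of l] that t1 by auto
    then show ?thesis using abs_Re_le_cmod[of "y l"] by linarith
  qed
  have "norm (rho y) \<le> \<bar>Re (y OutA) + Re (y OutB)\<bar> + \<bar>Re (y OutC) + Re (y OutD)\<bar>"
    using cmod_le[of "rho y"] by (simp add: rho_def)
  then have "norm (rho y) \<le> 60 * H" using c[of OutA] c[of OutB] c[of OutC] c[of OutD] by simp
  moreover have "H \<le> H\<^sup>2" using H by (simp add: power2_eq_square)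
  then have "60 * H + 2 * H \<le> R0 t / 2" "0 < R0 t" using R H by auto
  ultimately show "wide t y (60 * H)" by (simp add: wide_def)
qed

lemma dichotomies: "dichotomy (fwd k) (rate k) (pw k) T (ex k)"
proof (cases "\<exists>l. k = Decay l")
  case True
  then obtain l where k: "k = Decay l" by blast
  have h: "1 / H \<le> hyp_rate (nu l)" by (rule rates_bounds(1)[OF nu])
  have H1: "1 \<le> H" using H by simp
  have "T powr (2/3) \<le> T powr 1" using T1 by (intro powr_mono) auto
  then have "10000000 * H\<^sup>2 \<le> T" using T2 T1 by simp
  moreover have "H \<le> H\<^sup>2" using H by (simp add: power2_eq_square)
  ultimately have "2 * H \<le> T" using H by linarith
  then have "1 / H * (2 * H) \<le> hyp_rate (nu l) * T" using h H rates(1)[OF nu(1), of l] by (intro mult_mono) auto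
  then have "2 \<le> hyp_rate (nu l) * T" using H by simp
  then show ?thesis unfolding k using dichotomy_decay[of T "hyp_rate (nu l)"] T1 by (simp add: fwd_def)
next
  case False
  have r: "0 \<le> hyp_rate (nu l)" for l using rates(1)[OF nu(1)] by (simp add: less_imp_le)
  have "dichotomy (fwd k) (rate k) (pw k) T (pw k)"
    by (rule dichotomy_power) (use T1 r False in \<open>cases k; simp add: fwd_def\<close>)+
  moreover have "ex k = pw k" using False by (cases k) auto
  ultimately show ?thesis by simp
qed

lemma field_bound:
  assumes t: "T \<le> t" and y: "inball t y"
  shows "norm (field t y k) \<le> rad k * \<bar>ex k - wt k\<bar> * t powr (wt k - 1)"
proof -
  note R = in_range[OF t y]
  have t1: "1 \<le> t" using t T1 by simp
  define b where "b = 20 * H\<^sup>2 * (ru * t powr (-1))"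
  note ty = R(1)[folded b_def]
  have pos_ru: "0 < ru" "0 < KS" using constants KS_ge by auto
  \<comment> \<open>The factor 3 is the largest coefficient of the outer field, and
    \<open>5 * H = 15 * H * (1 / 3)\<close> is the allowance of the outer modes with the smallest
    gap.\<close>
  have outer_b: "3 * t * norm (outer t y) \<le> 5 * H * t powr (-1)"
  proof -
    have HH: "1 \<le> H\<^sup>2" using H by (simp add: one_le_power)
    have R0: "0 < R0 t" using R(2) by (simp add: wide_def)
    have "400 * (60 * H + 2 * H)\<^sup>2 = 1537600 * H\<^sup>2" by (simp add: power2_eq_square algebra_simps)
    then have "400 * (60 * H + 2 * H)\<^sup>2 \<le> R0 t" using R(3) HH by simp
    then have "400 * (60 * H + 2 * H)\<^sup>2 / R0 t \<le> 1" using R0 by (simp add: divide_le_eq)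
    then have "400 * (60 * H + 2 * H)\<^sup>2 / R0 t + 4 * H \<le> 15 / 2 * H" using H by simp
    then have "mtot / R0 t ^ 3 * (400 * (60 * H + 2 * H)\<^sup>2 / R0 t + 4 * H) \<le> 2 / 9 * t powr (-2) * (15 / 2 * H)"
      using t1 by (simp only: kap(4)) (intro mult_left_mono; simp)
    then have "norm (outer t y) \<le> 2 / 9 * t powr (-2) * (15 / 2 * H)"
      using outer_bound[OF R(2) ty] by linarith
    then have "3 * t * norm (outer t y) \<le> 3 * t * (2 / 9 * t powr (-2) * (15 / 2 * H))"
      using t1 by (intro mult_left_mono) auto
    also have "\<dots> = 5 * H * (t powr 1 * t powr (-2))" using t1 by simp
    also have "\<dots> = 5 * H * t powr (-1)" unfolding powr_add[symmetric] by simp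
    finally show ?thesis .
  qed
  have out: "norm (complex_of_real (c * t * z)) \<le> 15 * H * d * t powr (-1)"
    if "\<bar>z\<bar> \<le> norm (outer t y)" "\<bar>c\<bar> \<le> 3" "1 / 3 \<le> d" for c z d
  proof -
    have "norm (complex_of_real (c * t * z)) = \<bar>c\<bar> * t * \<bar>z\<bar>" unfolding norm_of_real using t1 by (simp add: abs_mult)
    also have "\<dots> \<le> 3 * t * norm (outer t y)" using that t1 by (intro mult_mono) auto
    also have "\<dots> \<le> 15 * H * (1 / 3) * t powr (-1)" using outer_b by simp
    also have "\<dots> \<le> 15 * H * d * t powr (-1)" using that H by (intro mult_left_mono mult_right_mono) auto
    finally show ?thesis .
  qed
  have shp: "norm (field t y k) \<le> ru * t powr (-2)" if "is_shape k"
  proof -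
    have bb: "b * b = 400 * H ^ 4 * ru * ru * t powr (-2)"
    proof -
      have "b * b = 400 * H ^ 4 * ru * ru * (t powr (-1) * t powr (-1))" by (simp add: b_def power_eq_if)
      then show ?thesis unfolding powr_add[symmetric] by simp
    qed
    have "norm (field t y k) \<le> KS * (b * b + mn / R0 t ^ 3)" by (rule field_shape_bound[OF R(2) ty that])
    also have "\<dots> \<le> KS * (400 * H ^ 4 * ru * ru * t powr (-2) + mn * t powr (-2))"
      using mult_left_mono[OF kap(5)[of t], of mn] mn t1 pos_ru unfolding bb by (intro mult_left_mono add_left_mono) auto
    also have "\<dots> = (KS * (400 * H ^ 4 * ru) * ru + KS * mn) * t powr (-2)" by (simp add: algebra_simps)
    \<comment> \<open>Quadratic terms take one sixth and tidal terms one half of the radius; the gap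
      of every shape mode is 1 in these weights.\<close>
    also have "\<dots> \<le> (1 / 6 * ru + ru / 2) * t powr (-2)"
      unfolding constants(4) using mn1 by (intro mult_right_mono add_left_mono) auto
    also have "\<dots> \<le> ru * t powr (-2)" using pos_ru by (intro mult_right_mono) auto
    finally show ?thesis .
  qed
  have dc: "\<bar>Re (outer t y)\<bar> \<le> norm (outer t y)" "\<bar>Im (outer t y)\<bar> \<le> norm (outer t y)"
    by (rule abs_Re_le_cmod abs_Im_le_cmod)+
  show ?thesis
  proof (cases k)
    case Phase
    \<comment> \<open>The speed is of order \<open>1/t\<close>, and its integral would only be
      logarithmic; the weight \<open>t^(1/6)\<close> provides the positive gap that the estimate
      needs.\<close>
    have "\<bar>om y\<bar> \<le> 4 * H * b" by (rule om_bound[OF ty])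
    also have "\<dots> = 1 / 6 * (480 * H ^ 3 * ru) * t powr (-1)" by (simp add: b_def power_eq_if)
    also have "\<dots> \<le> 1 / 6 * 1 * t powr (-1)" using constants by (intro mult_right_mono mult_left_mono) auto
    also have "\<dots> \<le> 1 / 6 * 1 * t powr (1/6 - 1)" using t1 by (intro mult_left_mono powr_mono) auto
    finally show ?thesis unfolding Phase by simp
  next
    case OutA
    then show ?thesis using out[OF dc(1), of "3/5" "4/3"] by simp
  next
    case OutB
    then show ?thesis using out[OF dc(1), of "-3/5" "1/3"] by simp
  next
    case OutC
    then show ?thesis using out[OF dc(2), of "-3" "1/3"] by simp
  next
    case OutD
    then show ?thesis using out[OF dc(2), of "3" "2/3"] by simp
  qed (use shp in \<open>simp_all add: is_shape_def del: field.simps\<close>)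
qed

text \<open>Each link of the cycle has to cost at most half of the gap in the weights
  \<open>wt'\<close>. These match along the cycle: shape \<open>t^(-5/6)\<close> integrates to phase
  \<open>t^(1/6)\<close>, which drives the outer modes at the same power and returns to the shape as
  \<open>mn t^(-2) t^(1/6)\<close>, the derivative order of \<open>t^(-5/6)\<close>.\<close>

lemma field_lipschitz:
  assumes t: "T \<le> t" and y: "inball t y" "inball t y'" and D: "0 \<le> D"
    and le: "\<And>l. norm (y l - y' l) \<le> D * Bm l * t powr wt' l"
  shows "norm (field t y k - field t y' k) \<le> D * Bm k * \<bar>ex k - wt' k\<bar> / 2 * t powr (wt' k - 1)"
proof -
  note R = in_range[OF t y(1)] and R' = in_range[OF t y(2)]
  have t1: "1 \<le> t" using t T1 by simp
  define b where "b = 20 * H\<^sup>2 * (ru * t powr (-1))"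
  note ty = R(1)[folded b_def] R'(1)[folded b_def] and wi = R(2) R'(2)
  note C = constants
  define d where "d = D * t powr (1/6)"
  define E where "E = 20 * H\<^sup>2 * (D * Bu * t powr (-5/6))"
  have d0: "0 \<le> d" using D by (simp add: d_def)
  have "shape_le (\<lambda>k. y k - y' k) (D * Bu * t powr (-5/6))"
    unfolding shape_le_def
  proof (intro conjI allI)
    show "norm (y Ang - y' Ang) \<le> D * Bu * t powr (-5/6)" "norm (y Kep - y' Kep) \<le> D * Bu * t powr (-5/6)"
      using le[of Ang] le[of Kep] by simp_all
    show "norm (y (Grow l) - y' (Grow l)) \<le> D * Bu * t powr (-5/6)" "norm (y (Decay l) - y' (Decay l)) \<le> D * Bu * t powr (-5/6)"
      "norm (y (Ell l) - y' (Ell l)) \<le> D * Bu * t powr (-5/6)" for l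
      using le[of "Grow l"] le[of "Decay l"] le[of "Ell l"] by simp_all
  qed
  note sb = shape_le_bounds[OF this, unfolded linear_parts, folded E_def]
  have E0: "0 \<le> E" using D C by (simp add: E_def)
  have Ed: "E \<le> d"
  proof -
    have "E = (20 * H\<^sup>2 * Bu) * (D * t powr (-5/6))" by (simp add: E_def)
    also have "\<dots> \<le> 1 * (D * t powr (1/6))"
      using C D t1 H by (intro mult_mono mult_left_mono powr_mono) auto
    finally show ?thesis by (simp add: d_def)
  qed
  have p: "norm (y Phase - y' Phase) \<le> d" using le[of Phase] by (simp add: d_def)
  have r: "norm (rho y - rho y') \<le> 4 * Bo * d"
  proof -
    have c: "\<bar>Re (y l - y' l)\<bar> \<le> Bo * d" if "l \<in> {OutA, OutB, OutC, OutD}" for l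
    proof -
      have "norm (y l - y' l) \<le> Bo * d" using le[of l] that by (auto simp: d_def mult_ac)
      then show ?thesis using abs_Re_le_cmod[of "y l - y' l"] by linarith
    qed
    have "norm (rho y - rho y') \<le> \<bar>Re (rho y - rho y')\<bar> + \<bar>Im (rho y - rho y')\<bar>" by (rule cmod_le)
    also have "\<dots> \<le> \<bar>Re (y OutA - y' OutA)\<bar> + \<bar>Re (y OutB - y' OutB)\<bar> + (\<bar>Re (y OutC - y' OutC)\<bar> + \<bar>Re (y OutD - y' OutD)\<bar>)"
      unfolding rho_def by simp
    also have "\<dots> \<le> Bo * d + Bo * d + (Bo * d + Bo * d)" by (intro add_mono c) auto
    finally show ?thesis by (simp add: mult_ac)
  qed
  have tt: "t * t powr (-2) = t powr (-1)" "t powr (-1) * t powr (1/6) = t powr (-5/6)"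
    "t powr (-1) * t powr (-5/6) = t powr (-11/6)" "t powr (-2) * t powr (1/6) = t powr (-11/6)"
  proof -
    have "t * t powr (-2) = t powr 1 * t powr (-2)" using t1 by simp
    then show "t * t powr (-2) = t powr (-1)" unfolding powr_add[symmetric] by simp
    show "t powr (-1) * t powr (1/6) = t powr (-5/6)" "t powr (-1) * t powr (-5/6) = t powr (-11/6)"
      "t powr (-2) * t powr (1/6) = t powr (-11/6)"
      unfolding powr_add[symmetric] by simp_all
  qed
  have outer_d: "3 * t * norm (outer t y - outer t y') \<le> D * Bo / 12 * t powr (-5/6)"
  proof -
    have R0: "0 < R0 t" using R(2) by (simp add: wide_def)
    have HH: "H \<le> H\<^sup>2" using H by (simp add: power2_eq_square)
    have "2480000 * H \<le> 10000000 * H\<^sup>2" using HH H by simp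
    then have "400 * (60 * H + 2 * H) / R0 t \<le> 1 / 100"
      using R(3) R0 by (simp add: divide_le_eq)
    then have "400 * (60 * H + 2 * H) / R0 t * (4 * Bo * d) \<le> 1 / 100 * (4 * Bo * d)"
      using C d0 by (intro mult_right_mono) auto
    then have F1: "400 * (60 * H + 2 * H) / R0 t * (4 * Bo * d) \<le> Bo * d / 25" by (simp add: mult_ac)
    have "real n * E \<le> real n * d" using Ed by (intro mult_left_mono) auto
    then have "202 * (2 * H * d + real n * E) \<le> 202 * (2 * H * d + real n * d)" by simp
    also have "\<dots> = Bo * d / 24" by (simp add: Bo_def algebra_simps)
    finally have F2: "202 * (2 * H * d + real n * E) \<le> Bo * d / 24" .
    have "0 \<le> Bo * d" using C d0 by simp
    \<comment> \<open>The allowance is \<open>3 * 2/9 * 1/8 = 1/12\<close>, half of the smallest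
      outer gap \<open>1/3 - 1/6\<close>.\<close>
    then have "Bo * d / 25 + Bo * d / 24 \<le> Bo * d / 8" by linarith
    with add_mono[OF F1 F2]
    have "400 * (60 * H + 2 * H) / R0 t * (4 * Bo * d) + 202 * (2 * H * d + real n * E) \<le> Bo * d / 8"
      by (rule order_trans)
    then have "mtot / R0 t ^ 3 * (400 * (60 * H + 2 * H) / R0 t * (4 * Bo * d) + 202 * (2 * H * d + real n * E))
       \<le> 2 / 9 * t powr (-2) * (Bo * d / 8)"
      using t1 by (simp only: kap(4)) (intro mult_left_mono; simp)
    then have "norm (outer t y - outer t y') \<le> 2 / 9 * t powr (-2) * (Bo * d / 8)"
      using outer_diff[OF wi ty sb(1) p r] by linarith
    then have "3 * t * norm (outer t y - outer t y') \<le> 3 * t * (2 / 9 * t powr (-2) * (Bo * d / 8))"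
      using t1 by (intro mult_left_mono) auto
    also have "\<dots> = D * Bo / 12 * ((t * t powr (-2)) * t powr (1/6))" by (simp add: d_def)
    finally show ?thesis unfolding tt .
  qed
  have out: "norm (complex_of_real (c * t * z) - complex_of_real (c * t * z')) \<le> D * Bo * q / 2 * t powr (-5/6)"
    if "\<bar>z - z'\<bar> \<le> norm (outer t y - outer t y')" "\<bar>c\<bar> \<le> 3" "1 / 6 \<le> q" for c z z' q
  proof -
    have "c * t * z - c * t * z' = c * t * (z - z')" by (simp add: algebra_simps)
    then have "norm (complex_of_real (c * t * z) - complex_of_real (c * t * z')) = \<bar>c\<bar> * t * \<bar>z - z'\<bar>"
      unfolding of_real_diff[symmetric] norm_of_real using t1 by (simp add: abs_mult)
    also have "\<dots> \<le> 3 * t * norm (outer t y - outer t y')" using that t1 by (intro mult_mono) auto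
    also have "\<dots> \<le> D * Bo * (1 / 6) / 2 * t powr (-5/6)" using outer_d by simp
    also have "\<dots> \<le> D * Bo * q / 2 * t powr (-5/6)"
      using that D C by (intro mult_left_mono mult_right_mono divide_right_mono) auto
    finally show ?thesis .
  qed
  have shp: "norm (field t y k - field t y' k) \<le> D * Bu * q / 2 * t powr (-11/6)" if k: "is_shape k" and q: "5 / 6 \<le> q" for q
  proof -
    have KS: "0 < KS" using KS_ge(5) by linarith
    have bE: "b * E = 400 * H ^ 4 * ru * (D * Bu) * t powr (-11/6)"
    proof -
      have "b * E = 400 * H ^ 4 * ru * (D * Bu) * (t powr (-1) * t powr (-5/6))" by (simp add: b_def E_def power_eq_if)
      then show ?thesis unfolding tt .
    qed
    have "mn / R0 t ^ 3 \<le> mn * t powr (-2)"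
      using mult_left_mono[OF kap(5)[of t], of mn] mn t1 by simp
    then have "mn / R0 t ^ 3 * (d + 4 * Bo * d + E) \<le> mn * t powr (-2) * (d + 4 * Bo * d + d)"
      using Ed E0 d0 C mn by (intro mult_mono add_left_mono) auto
    also have "\<dots> = mn * (2 + 4 * Bo) * D * (t powr (-2) * t powr (1/6))" by (simp add: d_def algebra_simps)
    finally have m': "mn / R0 t ^ 3 * (d + 4 * Bo * d + E) \<le> mn * (2 + 4 * Bo) * D * t powr (-11/6)" unfolding tt .
    have "norm (field t y k - field t y' k) \<le> KS * (b * E + mn / R0 t ^ 3 * (d + 4 * Bo * d + E))"
      by (rule field_shape_diff[OF wi ty sb p r k])
    also have "\<dots> \<le> KS * (400 * H ^ 4 * ru * (D * Bu) * t powr (-11/6) + mn * (2 + 4 * Bo) * D * t powr (-11/6))"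
      using m' KS unfolding bE by (intro mult_left_mono add_left_mono) auto
    also have "\<dots> = (KS * (400 * H ^ 4 * ru) * Bu + KS * mn * (2 + 4 * Bo)) * (D * t powr (-11/6))" by (simp add: algebra_simps)
    \<comment> \<open>\<open>1/6\<close> for the self-coupling and \<open>1/5\<close> for the tidal
      feedback stay below \<open>5/12\<close>, half of the smallest shape gap.\<close>
    also have "\<dots> \<le> (1 / 6 * Bu + Bu / 5) * (D * t powr (-11/6))"
      unfolding C(4) using mn2 D by (intro mult_right_mono add_left_mono) auto
    also have "\<dots> \<le> (Bu * (5 / 6) / 2) * (D * t powr (-11/6))" using C D by (intro mult_right_mono) auto
    also have "\<dots> \<le> (Bu * q / 2) * (D * t powr (-11/6))" using C D q by (intro mult_right_mono divide_right_mono mult_left_mono) auto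
    finally show ?thesis by (simp add: mult_ac)
  qed
  have dc: "\<bar>Re (outer t y) - Re (outer t y')\<bar> \<le> norm (outer t y - outer t y')"
    "\<bar>Im (outer t y) - Im (outer t y')\<bar> \<le> norm (outer t y - outer t y')"
    using abs_Re_le_cmod[of "outer t y - outer t y'"] abs_Im_le_cmod[of "outer t y - outer t y'"] by simp_all
  show ?thesis
  proof (cases k)
    case Phase
    have "\<bar>om y - om y'\<bar> \<le> 12 * H\<^sup>2 * E" by (rule om_diff[OF ty sb])
    also have "\<dots> = (240 * H ^ 4 * Bu) * D * t powr (-5/6)" by (simp add: E_def power_eq_if)
    finally have "\<bar>om y - om y'\<bar> \<le> D / 12 * t powr (-5/6)" unfolding C(5) by simp
    then show ?thesis unfolding Phase by (simp flip: of_real_diff)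
  next
    case OutA
    then show ?thesis using out[OF dc(1), of "3/5" "7/6"] by simp
  next
    case OutB
    then show ?thesis using out[OF dc(1), of "-3/5" "1/2"] by simp
  next
    case OutC
    then show ?thesis using out[OF dc(2), of "-3" "1/6"] by simp
  next
    case OutD
    then show ?thesis using out[OF dc(2), of "3" "1/2"] by simp
  next
    case Ang
    then show ?thesis using shp[of "5/6"] by (simp add: is_shape_def del: field.simps)
  next
    case Kep
    then show ?thesis using shp[of "5/6"] by (simp add: is_shape_def del: field.simps)
  next
    case (Grow l)
    then show ?thesis using shp[of "5/6"] by (simp add: is_shape_def del: field.simps)
  next
    case (Decay l)
    then show ?thesis using shp[of "7/6"] by (simp add: is_shape_def del: field.simps)
  next
    case (Ell l)
    then show ?thesis using shp[of "5/6"] by (simp add: is_shape_def del: field.simps)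
  qed
qed

theorem solution_exists:
  "\<exists>y. (\<forall>t\<ge>T. inball t (y t)) \<and> (\<forall>t\<ge>T. \<forall>k.
      ((\<lambda>t. y t k) has_vector_derivative (rate k + of_real (pw k / t)) * y t k + field t (y t) k) (at t within {T..}))"
  unfolding inball_def
\<comment> \<open>\<open>D\<close> only has to dominate the ratios of radii to contraction weights,
  of which there are three kinds: phase, outer and shape.\<close>
proof (rule weighted_ode_solution[where e = ex and d = fwd and g' = wt' and B = Bm and D = "max 1 (max (15 * H / Bo) (ru / Bu))"])
  note C = constants
  show "1 \<le> T" by (rule T1)
  show "dichotomy (fwd k) (rate k) (pw k) T (ex k)" for k by (rule dichotomies)
  show "if fwd k then ex k < wt k else wt' k < ex k" for k by (cases k) (auto simp: fwd_def)
  show "wt k \<le> wt' k" for k by (cases k) auto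
  show "0 < Bm k" for k using C by (cases k) auto
  show "0 \<le> rad k" for k using C H by (cases k) auto
  show "rad k \<le> max 1 (max (15 * H / Bo) (ru / Bu)) * Bm k" for k
  proof -
    let ?M = "max 1 (max (15 * H / Bo) (ru / Bu))"
    have "1 * 1 \<le> ?M * 1" by (intro mult_right_mono) auto
    moreover have "15 * H / Bo * Bo \<le> ?M * Bo" "ru / Bu * Bu \<le> ?M * Bu" using C by (intro mult_right_mono; simp)+
    ultimately show ?thesis using C by (cases k) auto
  qed
  show "continuous_on {T..} (\<lambda>t. field t (y t) k)"
    if c: "\<And>l. continuous_on {T..} (\<lambda>t. y t l)" and b: "\<And>t. T \<le> t \<Longrightarrow> \<forall>k. norm (y t k) \<le> rad k * t powr wt k" for y k
  proof (rule cont_field[where P = "60 * H"])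
    show "0 < t" if "t \<in> {T..}" for t using that T1 by simp
    show "\<exists>b. tiny (y t) b" "wide t (y t) (60 * H)" if "t \<in> {T..}" for t
      using in_range[of t "y t"] b[of t] that by (auto simp: inball_def)
  qed (rule c)
  show "norm (field t y k) \<le> rad k * \<bar>ex k - wt k\<bar> * t powr (wt k - 1)"
    if "T \<le> t" "\<forall>k. norm (y k) \<le> rad k * t powr wt k" for t y k
    using field_bound[of t y k] that by (simp add: inball_def)
  show "norm (field t y k - field t y' k) \<le> D * Bm k * \<bar>ex k - wt' k\<bar> / 2 * t powr (wt' k - 1)"
    if "T \<le> t" "\<forall>k. norm (y k) \<le> rad k * t powr wt k" "\<forall>k. norm (y' k) \<le> rad k * t powr wt k" "0 \<le> D"
      "\<And>l. norm (y l - y' l) \<le> D * Bm l * t powr wt' l" for t y y' k D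
    by (rule field_lipschitz) (use that in \<open>auto simp: inball_def\<close>)
qed

end

section \<open>Reconstruction of the motion\<close>

lemma dec_has_derivative:
  assumes "(p has_real_derivative p') (at x within S)" "(q has_real_derivative q') (at x within S)" "(c has_vector_derivative c') (at x within S)"
  shows "((\<lambda>t. dec_Z \<mu> (p t) (q t) (c t)) has_vector_derivative dec_Z \<mu> p' q' c') (at x within S)"
    and "((\<lambda>t. dec_Y \<mu> (p t) (q t) (c t)) has_vector_derivative dec_Y \<mu> p' q' c') (at x within S)"
proof -
  have c: "((\<lambda>t. Re (c t)) has_real_derivative Re c') (at x within S)" "((\<lambda>t. Im (c t)) has_real_derivative Im c') (at x within S)"
    using assms(3) unfolding has_vector_derivative_complex_iff by auto
  have xi: "((\<lambda>t. dec_xi \<mu> (p t) (q t) (c t)) has_real_derivative dec_xi \<mu> p' q' c') (at x within S)"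
    unfolding dec_xi_def by (intro DERIV_cdivide DERIV_diff assms c)
  have w: "((\<lambda>t. dec_w \<mu> (p t) (q t) (c t)) has_real_derivative dec_w \<mu> p' q' c') (at x within S)"
    unfolding dec_w_def by (intro DERIV_cdivide DERIV_diff DERIV_add assms c)
  have d: "((\<lambda>t. dec_d \<mu> (p t) (q t) (c t)) has_real_derivative dec_d \<mu> p' q' c') (at x within S)"
    unfolding dec_d_def by (intro DERIV_cdivide DERIV_diff DERIV_add DERIV_cmult assms w)
  show "((\<lambda>t. dec_Z \<mu> (p t) (q t) (c t)) has_vector_derivative dec_Z \<mu> p' q' c') (at x within S)"
    unfolding has_vector_derivative_complex_iff dec_Z_def complex.sel
    by (intro conjI DERIV_cdivide DERIV_diff xi w d)
  show "((\<lambda>t. dec_Y \<mu> (p t) (q t) (c t)) has_vector_derivative dec_Y \<mu> p' q' c') (at x within S)"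
    unfolding has_vector_derivative_complex_iff dec_Y_def complex.sel
    by (intro conjI DERIV_cdivide DERIV_diff DERIV_add DERIV_cmult xi w d c)
qed

context planar_data
begin

section \<open>Forces expanded in eigenvectors\<close>

definition "accel y i = (\<Sum>j<n. of_real (m j) * kern (zeta y j - zeta y i))"

definition "vel y t i = ph t (y t) * (\<Sum>k=1..<n. of_real (e k i) * (\<i> * of_real (if k = 1 then a0 else 0) + dY (y t) k))"

text \<open>As usual in variation of constants, the forcing terms of \<open>OutA\<close> and
  \<open>OutB\<close>, and of \<open>OutC\<close> and \<open>OutD\<close>, cancel in the first
  derivative of the outer position, so only the exponents remain.\<close>

definition "Rvel y t = Complex (2 / 3 * kap * t powr (-1/3) + (4 / 3 * Re (y t OutA) - 1 / 3 * Re (y t OutB)) / t)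
   ((1 / 3 * Re (y t OutC) + 2 / 3 * Re (y t OutD)) / t)"

lemma wip_e: "k < n \<Longrightarrow> l < n \<Longrightarrow> wip n m (e k) (e l) = (if k = l then 1 else 0)"
  using sys by (auto simp: eigensystem_def)

lemma mode_lap:
  assumes k: "1 \<le> k" "k < n"
  shows "wip n m (e k) (lap n m x (\<lambda>i. \<Sum>l=1..<n. e l i * c l)) = mu k * c k"
proof -
  have "wip n m (e k) (lap n m x (\<lambda>i. \<Sum>l=1..<n. e l i * c l)) = wip n m (lap n m x (e k)) (\<lambda>i. \<Sum>l=1..<n. e l i * c l)"
    by (rule wip_lap_commute)
  also have "\<dots> = wip n m (\<lambda>i. \<Sum>l=1..<n. c l * e l i) (\<lambda>i. mu k * e k i)"
    unfolding wip_commute[of n m "lap n m x (e k)"]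
    using sys k by (intro wip_cong) (auto simp: eigensystem_def mult.commute)
  also have "\<dots> = (\<Sum>l=1..<n. c l * (mu k * wip n m (e l) (e k)))"
    unfolding wip_sum wip_scale unfolding wip_commute[of n m "e _" "\<lambda>i. mu k * e k i"] wip_scale wip_commute[of n m "e k"] ..
  also have "\<dots> = (\<Sum>l=1..<n. if l = k then mu k * c k else 0)"
    using k by (intro sum.cong) (auto simp: wip_e)
  also have "\<dots> = mu k * c k" using k by simp
  finally show ?thesis .
qed

lemma proj_real: "proj k (\<lambda>i. Complex (u i) (v i)) = Complex (wip n m (e k) u) (wip n m (e k) v)"
  by (simp add: proj_def wip_def complex_eq_iff)

text \<open>To first order the attraction is diagonal in the eigenvectors, \<open>2 * mu k\<close>
  along the line and \<open>- mu k\<close> across. The equilibrium itself contributes only to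
  \<open>k = 1\<close>, since \<open>x\<close> is \<open>a0\<close> times
  \<open>e 1\<close>.\<close>

lemma proj_accel:
  assumes k: "1 \<le> k" "k < n"
  shows "proj k (\<lambda>i. accel y i + tide t y i) = frc t y k + of_real (if k = 1 then - a0 else 0)
     + Complex (2 * mu k * Re (dZ y k)) (- mu k * Im (dZ y k))"
proof -
  define u v where "u i = (\<Sum>l=1..<n. e l i * Re (dZ y l))" and "v i = (\<Sum>l=1..<n. e l i * Im (dZ y l))" for i
  have d: "disp y i = Complex (u i) (v i)" for i
    by (simp add: disp_def u_def v_def complex_eq_iff)
  have A: "accel y i = frem y i + Complex (- x i + 2 * lap n m x u i) (- lap n m x v i)" if i: "i < n" for i
  proof -
    have s: "kern (zeta y j - zeta y i) = (kern (zeta y j - zeta y i) - of_real ((x j - x i) / \<bar>x j - x i\<bar> ^ 3)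
      - kern_lin (disp y j - disp y i) / of_real (\<bar>x j - x i\<bar> ^ 3))
      + Complex (- ((x i - x j) / \<bar>x i - x j\<bar> ^ 3) + 2 * ((u i - u j) / \<bar>x i - x j\<bar> ^ 3)) (- ((v i - v j) / \<bar>x i - x j\<bar> ^ 3))" for j
      unfolding d abs_minus_commute[of "x j"]
      by (simp add: kern_lin_def complex_eq_iff diff_divide_distrib flip: of_real_power)
    have "accel y i = frem y i + (\<Sum>j<n. of_real (m j) * Complex (- ((x i - x j) / \<bar>x i - x j\<bar> ^ 3) + 2 * ((u i - u j) / \<bar>x i - x j\<bar> ^ 3)) (- ((v i - v j) / \<bar>x i - x j\<bar> ^ 3)))"
      unfolding accel_def frem_def sum.distrib[symmetric] distrib_left[symmetric]
      by (intro sum.cong refl arg_cong2[where f = times] s)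
    also have "(\<Sum>j<n. of_real (m j) * Complex (- ((x i - x j) / \<bar>x i - x j\<bar> ^ 3) + 2 * ((u i - u j) / \<bar>x i - x j\<bar> ^ 3)) (- ((v i - v j) / \<bar>x i - x j\<bar> ^ 3)))
      = Complex (- lap n m x x i + 2 * lap n m x u i) (- lap n m x v i)"
      by (simp add: complex_eq_iff lap_def sum_distrib_left sum_negf[symmetric] sum.distrib[symmetric] algebra_simps)
    finally show ?thesis using cc[OF i] by simp
  qed
  have "proj k (\<lambda>i. accel y i + tide t y i) = proj k (\<lambda>i. (frem y i + tide t y i) + Complex (- x i + 2 * lap n m x u i) (- lap n m x v i))"
    unfolding proj_def by (rule sum.cong) (simp_all add: A)
  also have "\<dots> = frc t y k + proj k (\<lambda>i. Complex (- x i + 2 * lap n m x u i) (- lap n m x v i))"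
    unfolding frc_def proj_def by (simp add: sum.distrib distrib_left)
  also have "proj k (\<lambda>i. Complex (- x i + 2 * lap n m x u i) (- lap n m x v i))
    = Complex (- wip n m (e k) x + 2 * wip n m (e k) (lap n m x u)) (- wip n m (e k) (lap n m x v))"
    unfolding proj_real by (simp add: complex_eq_iff wip_def sum.distrib sum_distrib_left sum_negf sum_subtractf algebra_simps)
  also have "wip n m (e k) (lap n m x u) = mu k * Re (dZ y k)"
    unfolding u_def [abs_def] by (rule mode_lap[OF k])
  also have "wip n m (e k) (lap n m x v) = mu k * Im (dZ y k)"
    unfolding v_def [abs_def] by (rule mode_lap[OF k])
  also have "wip n m (e k) x = (if k = 1 then a0 else 0)"
  proof -
    have "wip n m (e k) x = wip n m (\<lambda>i. a0 * e 1 i) (e k)"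
      unfolding wip_commute[of n m "e k"] by (intro wip_cong) (use e1 in \<open>simp_all add: a0_def\<close>)
    then show ?thesis using k n unfolding wip_scale by (simp add: wip_e)
  qed
  finally show ?thesis by (simp add: complex_eq_iff)
qed

text \<open>Completeness of the eigenvectors with the constant vector \<open>e 0\<close> left out:
  what is lost is the weighted mean.\<close>

lemma proj_sum:
  assumes i: "i < n"
  shows "(\<Sum>k=1..<n. of_real (e k i) * proj k f) = f i - (\<Sum>l<n. of_real (m l) * f l) / of_real mass_in"
proof -
  have m0: "\<forall>i<n. 0 < m i" using m(1) by (auto intro: less_le_trans[OF zero_less_one])
  have "(\<Sum>k<n. of_real (e k i) * proj k f) = (\<Sum>k<n. \<Sum>l<n. of_real (m l * e k l * e k i) * f l)"
    by (simp add: proj_def sum_distrib_left mult_ac)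
  also have "\<dots> = (\<Sum>l<n. \<Sum>k<n. of_real (m l * e k l * e k i) * f l)" by (rule sum.swap)
  also have "\<dots> = (\<Sum>l<n. of_real (\<Sum>k<n. m l * e k l * e k i) * f l)"
    by (simp add: sum_distrib_right)
  also have "\<dots> = (\<Sum>l<n. if l = i then f i else 0)"
    using eigensystem_complete[OF sys m0 _ i] by (intro sum.cong) auto
  also have "\<dots> = f i" using i by simp
  finally have full: "(\<Sum>k<n. of_real (e k i) * proj k f) = f i" .
  have "{..<n} = insert 0 {1..<n}" using n by auto
  then have "(\<Sum>k<n. of_real (e k i) * proj k f) = of_real (e 0 i) * proj 0 f + (\<Sum>k=1..<n. of_real (e k i) * proj k f)"
    by simp
  moreover have "of_real (e 0 i) * proj 0 f = (\<Sum>l<n. of_real (m l) * f l) / of_real mass_in"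
  proof -
    have e0': "e 0 i = 1 / sqrt mass_in" using e0[OF i] by (simp add: mass_in_def)
    have "proj 0 f = (\<Sum>l<n. of_real (1 / sqrt mass_in) * (of_real (m l) * f l))"
      unfolding proj_def by (rule sum.cong) (use e0 in \<open>simp_all add: mass_in_def\<close>)
    then have "of_real (e 0 i) * proj 0 f = of_real (1 / sqrt mass_in * (1 / sqrt mass_in)) * (\<Sum>l<n. of_real (m l) * f l)"
      unfolding e0' sum_distrib_left[symmetric] by (simp only: of_real_mult mult.assoc)
    also have "1 / sqrt mass_in * (1 / sqrt mass_in) = 1 / mass_in" using mass_in by simp
    finally show ?thesis by simp
  qed
  ultimately show ?thesis using full by (simp add: algebra_simps)
qed

lemma zeta_modes:
  assumes i: "i < n"
  shows "zeta y i = (\<Sum>k=1..<n. of_real (e k i) * (of_real (if k = 1 then a0 else 0) + dZ y k))"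
proof -
  have "(\<Sum>k=1..<n. of_real (e k i) * of_real (if k = 1 then a0 else 0)) = (\<Sum>k=1..<n. if k = 1 then complex_of_real (e 1 i * a0) else 0)"
    by (rule sum.cong) auto
  also have "\<dots> = of_real (e 1 i * a0)" using n by simp
  also have "e 1 i * a0 = x i" using e1[OF i] by (simp add: a0_def mult.commute)
  finally show ?thesis unfolding zeta_def disp_def by (simp add: distrib_left sum.distrib)
qed

lemma zeta_centered: "(\<Sum>i<n. of_real (m i) * zeta y i) = 0"
proof -
  have z: "(\<Sum>i<n. m i * e k i) = 0" if k: "k \<in> {1..<n}" for k
  proof -
    have "0 = wip n m (e k) (e 0)" using k n by (simp add: wip_e)
    also have "\<dots> = (\<Sum>i<n. (m i * e k i) * (1 / sqrt mass_in))"
      unfolding wip_def by (rule sum.cong) (use e0 in \<open>simp_all add: mass_in_def\<close>)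
    also have "\<dots> = (\<Sum>i<n. m i * e k i) * (1 / sqrt mass_in)" by (rule sum_distrib_right[symmetric])
    finally show ?thesis using mass_in by simp
  qed
  let ?c = "\<lambda>k. of_real (if k = 1 then a0 else 0) + dZ y k"
  have "(\<Sum>i<n. of_real (m i) * zeta y i) = (\<Sum>i<n. \<Sum>k=1..<n. of_real (m i * e k i) * ?c k)"
    by (rule sum.cong) (simp_all add: zeta_modes sum_distrib_left mult.assoc)
  also have "\<dots> = (\<Sum>k=1..<n. \<Sum>i<n. of_real (m i * e k i) * ?c k)" by (rule sum.swap)
  also have "\<dots> = (\<Sum>k=1..<n. of_real (\<Sum>i<n. m i * e k i) * ?c k)"
    unfolding of_real_sum sum_distrib_right ..
  also have "\<dots> = 0" using z by (intro sum.neutral) simp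
  finally show ?thesis .
qed

text \<open>Newton's third law: the double sum changes sign when the indices are
  interchanged.\<close>

lemma accel_centered: "(\<Sum>i<n. of_real (m i) * accel y i) = 0"
proof -
  let ?S = "\<Sum>i<n. \<Sum>j<n. of_real (m i * m j) * kern (zeta y j - zeta y i)"
  have "?S = (\<Sum>i<n. \<Sum>j<n. of_real (m j * m i) * kern (zeta y i - zeta y j))" by (rule sum.swap)
  also have "\<dots> = (\<Sum>i<n. \<Sum>j<n. - (of_real (m i * m j) * kern (zeta y j - zeta y i)))"
    by (intro sum.cong refl) (metis kern_minus minus_diff_eq mult.commute mult_minus_right)
  also have "\<dots> = - ?S" by (simp add: sum_negf)
  finally have "?S = 0" by simp
  then show ?thesis by (simp add: accel_def sum_distrib_left mult.assoc)
qed

section \<open>Newton's equations from the mode equations\<close>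

context
  fixes y :: "real \<Rightarrow> mode \<Rightarrow> complex" and t T :: real
  assumes t: "0 < t"
    and dy: "\<And>k. ((\<lambda>t. y t k) has_vector_derivative (rate k + of_real (pw k / t)) * y t k + field t (y t) k) (at t within {T..})"
    and ty: "\<exists>b. tiny (y t) b"
begin

lemma dRe: "((\<lambda>t. Re (y t k)) has_real_derivative Re ((rate k + of_real (pw k / t)) * y t k + field t (y t) k)) (at t within {T..})"
  and dIm: "((\<lambda>t. Im (y t k)) has_real_derivative Im ((rate k + of_real (pw k / t)) * y t k + field t (y t) k)) (at t within {T..})"
  using dy[of k] unfolding has_vector_derivative_complex_iff by auto

lemma om_eq: "om (y t) * (a0 + rr (y t)) = ss (y t) - rr (y t)"
proof -
  obtain b where "tiny (y t) b" using ty by blast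
  then have "1 / (2 * H) \<le> a0 + rr (y t)" by (rule rr_ss_pp_bound)
  moreover have "0 < 1 / (2 * H)" using H by simp
  ultimately have "a0 + rr (y t) \<noteq> 0" by linarith
  then show ?thesis by (simp add: om_def)
qed

lemma modes_derivative:
  assumes k: "1 \<le> k" "k < n"
  shows "((\<lambda>t. of_real (if k = 1 then a0 else 0) + dZ (y t) k) has_vector_derivative
      (\<i> * of_real (if k = 1 then a0 else 0) + dY (y t) k) - \<i> * of_real (1 + om (y t)) * (of_real (if k = 1 then a0 else 0) + dZ (y t) k))
      (at t within {T..})" (is ?Z)
    and "((\<lambda>t. \<i> * of_real (if k = 1 then a0 else 0) + dY (y t) k) has_vector_derivative
      proj k (\<lambda>i. accel (y t) i + tide t (y t) i) - \<i> * of_real (1 + om (y t)) * (\<i> * of_real (if k = 1 then a0 else 0) + dY (y t) k))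
      (at t within {T..})" (is ?Y)
proof -
  have "?Z \<and> ?Y"
  proof (cases "k = 1")
    case True
    define FA where "FA = Im (frc t (y t) 1) - om (y t) * pp (y t)"
    have rK: "((\<lambda>t. Re (y t Kep)) has_real_derivative pp (y t) - 2 * FA) (at t within {T..})"
      using dRe[of Kep] by (simp add: FA_def pp_def algebra_simps)
    have iK: "((\<lambda>t. Im (y t Kep)) has_real_derivative Re (y t Kep) - (om (y t) * (ss (y t) - rr (y t)) + Re (frc t (y t) 1))) (at t within {T..})"
      using dIm[of Kep] by (simp add: algebra_simps)
    have rA: "((\<lambda>t. Re (y t Ang)) has_real_derivative FA) (at t within {T..})"
      using dRe[of Ang] by (simp add: FA_def)
    have rr': "((\<lambda>t. rr (y t)) has_real_derivative pp (y t)) (at t within {T..})"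
      using DERIV_add[OF rK DERIV_cmult[OF rA, of 2]] unfolding rr_def by simp
    have ss': "((\<lambda>t. ss (y t)) has_real_derivative FA - pp (y t)) (at t within {T..})"
      using DERIV_diff[OF DERIV_minus[OF rA] rK] unfolding ss_def by simp
    have pp': "((\<lambda>t. pp (y t)) has_real_derivative om (y t) * (ss (y t) - rr (y t)) + Re (frc t (y t) 1) - Re (y t Kep)) (at t within {T..})"
      using DERIV_minus[OF iK] unfolding pp_def by simp
    have d1: "dZ (y s) k = of_real (rr (y s))" "dY (y s) k = Complex (pp (y s)) (ss (y s))" for s
      using True by (simp_all add: dZ_def dY_def)
    \<comment> \<open>The defining property of \<open>om\<close>: it cancels the imaginary part of
      the derivative of the homothetic mode, which therefore stays real.\<close>
    have om1: "om (y t) * a0 + om (y t) * rr (y t) = ss (y t) - rr (y t)"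
      using om_eq by (simp add: distrib_left)
    have rs: "rr (y t) + 2 * ss (y t) = - Re (y t Kep)" by (simp add: rr_def ss_def)
    have P: "proj k (\<lambda>i. accel (y t) i + tide t (y t) i) = frc t (y t) 1 - of_real a0 + of_real (2 * rr (y t))"
      unfolding proj_accel[OF k] d1 using True mu1 by (simp add: complex_eq_iff)
    have ?Z
      unfolding has_vector_derivative_complex_iff d1
      using rr' True om1 by (auto intro!: derivative_eq_intros simp: algebra_simps)
    moreover have ?Y
      unfolding has_vector_derivative_complex_iff d1 P
    proof (intro conjI)
      have fn: "(\<lambda>s. Re (\<i> * of_real (if k = 1 then a0 else 0) + Complex (pp (y s)) (ss (y s)))) = (\<lambda>s. pp (y s))" by simp
      have E: "om (y t) * (ss (y t) - rr (y t)) + Re (frc t (y t) 1) - Re (y t Kep)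
        = Re (frc t (y t) 1 - of_real a0 + of_real (2 * rr (y t)) - \<i> * of_real (1 + om (y t)) * (\<i> * of_real (if k = 1 then a0 else 0) + Complex (pp (y t)) (ss (y t))))"
        using True om1 rs by (simp add: algebra_simps)
      show "((\<lambda>s. Re (\<i> * of_real (if k = 1 then a0 else 0) + Complex (pp (y s)) (ss (y s)))) has_real_derivative
         Re (frc t (y t) 1 - of_real a0 + of_real (2 * rr (y t)) - \<i> * of_real (1 + om (y t)) * (\<i> * of_real (if k = 1 then a0 else 0) + Complex (pp (y t)) (ss (y t)))))
         (at t within {T..})" unfolding fn E[symmetric] by (rule pp')
      have "FA - pp (y t)
        = Im (frc t (y t) 1 - of_real a0 + of_real (2 * rr (y t)) - \<i> * of_real (1 + om (y t)) * (\<i> * of_real (if k = 1 then a0 else 0) + Complex (pp (y t)) (ss (y t))))"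
        using True by (simp add: FA_def algebra_simps)
      moreover have "((\<lambda>s. a0 + ss (y s)) has_real_derivative FA - pp (y t)) (at t within {T..})"
        using DERIV_add[OF DERIV_const ss', of a0] by simp
      ultimately show "((\<lambda>s. Im (\<i> * of_real (if k = 1 then a0 else 0) + Complex (pp (y s)) (ss (y s)))) has_real_derivative
         Im (frc t (y t) 1 - of_real a0 + of_real (2 * rr (y t)) - \<i> * of_real (1 + om (y t)) * (\<i> * of_real (if k = 1 then a0 else 0) + Complex (pp (y t)) (ss (y t)))))
         (at t within {T..})" using True by simp
    qed
    ultimately show ?thesis by blast
  next
    case False
    with k have k2: "2 \<le> k" "k < n" by auto
    have nk: "nu k = mu k" using k2 by (simp add: nu_def)
    define p q c where "p s = Re (y s (Grow k))" and "q s = Re (y s (Decay k))" and "c s = y s (Ell k)" for s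
    have d: "dZ (y s) k = dec_Z (nu k) (p s) (q s) (c s)" "dY (y s) k = dec_Y (nu k) (p s) (q s) (c s)" for s
      using False by (simp_all add: dZ_def dY_def p_def q_def c_def)
    let ?Z = "fZ (y t) k" and ?Y = "fY t (y t) k"
    have p': "(p has_real_derivative hyp_rate (nu k) * p t + enc_grow (nu k) ?Z ?Y) (at t within {T..})"
      using dRe[of "Grow k"] k2 unfolding p_def by simp
    have q': "(q has_real_derivative - hyp_rate (nu k) * q t + enc_decay (nu k) ?Z ?Y) (at t within {T..})"
      using dRe[of "Decay k"] k2 unfolding q_def by simp
    have c': "(c has_vector_derivative \<i> * of_real (ell_rate (nu k)) * c t + enc_ell (nu k) ?Z ?Y) (at t within {T..})"
      using dy[of "Ell k"] k2 unfolding c_def by simp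
    \<comment> \<open>The three rewrites split decoded derivatives into diagonal part and forcing,
      turn the diagonal part into the linearized flow, and give back the forcing \<open>fZ\<close>,
      \<open>fY\<close> that had been encoded.\<close>
    note D = dec_has_derivative[OF p' q' c', of "nu k", unfolded dec_add dec_flow[OF nu(1)] dec_enc[OF nu(1)], folded d]
    have Z: "((\<lambda>t. of_real (if k = 1 then a0 else 0) + dZ (y t) k) has_vector_derivative dY (y t) k - \<i> * dZ (y t) k + ?Z) (at t within {T..})"
      using D(1) False by simp
    have Y: "((\<lambda>t. \<i> * of_real (if k = 1 then a0 else 0) + dY (y t) k) has_vector_derivative
        Complex (2 * nu k * Re (dZ (y t) k)) (- nu k * Im (dZ (y t) k)) - \<i> * dY (y t) k + ?Y) (at t within {T..})"
      using D(2) False by simp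
    have eZ: "dY (y t) k - \<i> * dZ (y t) k + ?Z = (\<i> * of_real (if k = 1 then a0 else 0) + dY (y t) k)
        - \<i> * of_real (1 + om (y t)) * (of_real (if k = 1 then a0 else 0) + dZ (y t) k)"
      using False by (simp add: fZ_def algebra_simps)
    have eY: "Complex (2 * nu k * Re (dZ (y t) k)) (- nu k * Im (dZ (y t) k)) - \<i> * dY (y t) k + ?Y
        = proj k (\<lambda>i. accel (y t) i + tide t (y t) i) - \<i> * of_real (1 + om (y t)) * (\<i> * of_real (if k = 1 then a0 else 0) + dY (y t) k)"
      unfolding proj_accel[OF k] nk using False by (simp add: fY_def algebra_simps)
    show ?thesis using Z[unfolded eZ] Y[unfolded eY] by blast
  qed
  then show ?Z ?Y by auto
qed

lemma ph_derivative: "((\<lambda>t. ph t (y t)) has_vector_derivative \<i> * of_real (1 + om (y t)) * ph t (y t)) (at t within {T..})"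
proof -
  have "((\<lambda>t. t + Re (y t Phase)) has_real_derivative 1 + om (y t)) (at t within {T..})"
  proof -
    have "((\<lambda>t. Re (y t Phase)) has_real_derivative om (y t)) (at t within {T..})"
      using dRe[of Phase] by simp
    from DERIV_add[OF DERIV_ident this] show ?thesis .
  qed
  then have "((\<lambda>t. t + Re (y t Phase)) has_derivative (\<lambda>h. h * (1 + om (y t)))) (at t within {T..})"
    by (simp add: has_field_derivative_def mult.commute[of _ "1 + om (y t)"])
  from has_derivative_cis[OF this]
  show ?thesis unfolding has_vector_derivative_def ph_def
    by (simp add: scaleR_conv_of_real mult_ac)
qed

text \<open>The term with \<open>1 + om\<close> is the angular velocity of the frame; it cancels
  against the derivative of \<open>ph\<close>, so velocities and forces appear in inertial
  directions.\<close>

lemma rotating_sum_derivative: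
  assumes "\<And>k. k \<in> {1..<n} \<Longrightarrow> ((\<lambda>t. f t k) has_vector_derivative f' k - \<i> * of_real (1 + om (y t)) * f t k) (at t within {T..})"
  shows "((\<lambda>t. ph t (y t) * (\<Sum>k=1..<n. of_real (e k i) * f t k)) has_vector_derivative
     ph t (y t) * (\<Sum>k=1..<n. of_real (e k i) * f' k)) (at t within {T..})"
proof -
  have s: "((\<lambda>t. \<Sum>k=1..<n. of_real (e k i) * f t k) has_vector_derivative
     (\<Sum>k=1..<n. of_real (e k i) * (f' k - \<i> * of_real (1 + om (y t)) * f t k))) (at t within {T..})"
    by (intro has_vector_derivative_sum has_vector_derivative_mult_right assms)
  have e: "(\<Sum>k=1..<n. of_real (e k i) * (f' k - \<i> * of_real (1 + om (y t)) * f t k))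
    = (\<Sum>k=1..<n. of_real (e k i) * f' k) - \<i> * of_real (1 + om (y t)) * (\<Sum>k=1..<n. of_real (e k i) * f t k)"
    unfolding right_diff_distrib sum_subtractf sum_distrib_left by (simp add: mult_ac)
  have "((\<lambda>t. ph t (y t) * (\<Sum>k=1..<n. of_real (e k i) * f t k)) has_vector_derivative
     ph t (y t) * ((\<Sum>k=1..<n. of_real (e k i) * f' k) - \<i> * of_real (1 + om (y t)) * (\<Sum>k=1..<n. of_real (e k i) * f t k))
     + \<i> * of_real (1 + om (y t)) * ph t (y t) * (\<Sum>k=1..<n. of_real (e k i) * f t k)) (at t within {T..})"
    using has_vector_derivative_mult[OF ph_derivative s] unfolding e .
  then show ?thesis by (simp add: algebra_simps)
qed

lemma pos_derivative:
  assumes i: "i < n"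
  shows "((\<lambda>t. pos t (y t) i) has_vector_derivative vel y t i) (at t within {T..})"
  unfolding pos_def zeta_modes[OF i] vel_def
  by (rule rotating_sum_derivative) (use modes_derivative(1) in auto)

text \<open>Leaving out mode 0 subtracts the mean force, which is the acceleration of the center of
  mass of the inner bodies. The vector \<open>kern\<close> at the center that was removed in
  \<open>tide\<close> cancels in this subtraction.\<close>

lemma vel_derivative:
  assumes i: "i < n"
  shows "((\<lambda>t. vel y t i) has_vector_derivative
     (\<Sum>j<n. of_real (m j) * kern (pos t (y t) j - pos t (y t) i)) + of_real mn * kern (of_real (R0 t) + rho (y t) - pos t (y t) i)
     - of_real (mn / mass_in) * (\<Sum>j<n. of_real (m j) * kern (of_real (R0 t) + rho (y t) - pos t (y t) j))) (at t within {T..})"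
proof -
  let ?R = "of_real (R0 t) + rho (y t)" and ?p = "ph t (y t)"
  have pc: "?p * cnj ?p = 1" by (simp add: complex_norm_square[symmetric])
  have td: "?p * tide t (y t) j = of_real mn * (kern (?R - pos t (y t) j) - kern ?R)" for j
  proof -
    have "?p * tide t (y t) j = (?p * cnj ?p) * (of_real mn * (kern (?R - pos t (y t) j) - kern ?R))"
      by (simp only: tide_def mult_ac)
    then show ?thesis by (simp only: pc mult_1_left)
  qed
  have ac: "?p * accel (y t) i = (\<Sum>j<n. of_real (m j) * kern (pos t (y t) j - pos t (y t) i))"
    unfolding accel_def sum_distrib_left pos_def right_diff_distrib[symmetric] ph_def kern_cis
    by (simp add: mult_ac)
  have "?p * (\<Sum>l<n. of_real (m l) * (accel (y t) l + tide t (y t) l)) = ?p * (\<Sum>l<n. of_real (m l) * accel (y t) l) + (\<Sum>l<n. of_real (m l) * (?p * tide t (y t) l))"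
    by (simp add: distrib_left sum.distrib sum_distrib_left mult_ac)
  also have "\<dots> = (\<Sum>l<n. of_real (m l) * (of_real mn * (kern (?R - pos t (y t) l) - kern ?R)))"
    unfolding accel_centered td by simp
  also have "\<dots> = of_real mn * (\<Sum>l<n. of_real (m l) * kern (?R - pos t (y t) l)) - of_real (mn * mass_in) * kern ?R"
    by (simp add: mass_in_def sum_distrib_left sum_distrib_right sum_subtractf algebra_simps)
  finally have av: "?p * (\<Sum>l<n. of_real (m l) * (accel (y t) l + tide t (y t) l))
    = of_real mn * (\<Sum>l<n. of_real (m l) * kern (?R - pos t (y t) l)) - of_real (mn * mass_in) * kern ?R" .
  have "((\<lambda>t. vel y t i) has_vector_derivative
     ?p * (\<Sum>k=1..<n. of_real (e k i) * proj k (\<lambda>i. accel (y t) i + tide t (y t) i))) (at t within {T..})"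
    unfolding vel_def by (rule rotating_sum_derivative) (use modes_derivative(2) in auto)
  moreover have "?p * (\<Sum>k=1..<n. of_real (e k i) * proj k (\<lambda>i. accel (y t) i + tide t (y t) i))
    = ?p * accel (y t) i + ?p * tide t (y t) i - ?p * (\<Sum>l<n. of_real (m l) * (accel (y t) l + tide t (y t) l)) / of_real mass_in"
    unfolding proj_sum[OF i] by (simp add: algebra_simps)
  moreover have "\<dots> = (\<Sum>j<n. of_real (m j) * kern (pos t (y t) j - pos t (y t) i)) + of_real mn * kern (?R - pos t (y t) i)
     - of_real (mn / mass_in) * (\<Sum>j<n. of_real (m j) * kern (?R - pos t (y t) j))"
    unfolding av ac td using mass_in(2) by (simp add: diff_divide_distrib algebra_simps)
  ultimately show ?thesis by simp
qed

text \<open>Since \<open>mtot / R0 t ^ 3 = 2/9 t^(-2)\<close>, the linearized equations are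
  \<open>u'' = 4/9 u / t^2\<close> radially and \<open>w'' = - 2/9 w / t^2\<close> across. Their
  exponents solve \<open>s (s - 1) = 4/9\<close> and \<open>s (s - 1) = - 2/9\<close>, which are
  those of the four outer modes.\<close>

lemma R_derivative:
  "((\<lambda>t. of_real (R0 t) + rho (y t)) has_vector_derivative Rvel y t) (at t within {T..})"
  "((\<lambda>t. Rvel y t) has_vector_derivative
     - of_real (mtot / mass_in) * (\<Sum>j<n. of_real (m j) * kern (of_real (R0 t) + rho (y t) - pos t (y t) j))) (at t within {T..})"
proof -
  define g where "g = outer t (y t)"
  have dA: "((\<lambda>t. Re (y t OutA)) has_real_derivative 4 / 3 / t * Re (y t OutA) + 3 / 5 * t * Re g) (at t within {T..})"
    using dRe[of OutA] by (simp add: g_def)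
  have dB: "((\<lambda>t. Re (y t OutB)) has_real_derivative - 1 / 3 / t * Re (y t OutB) - 3 / 5 * t * Re g) (at t within {T..})"
    using dRe[of OutB] by (simp add: g_def)
  have dC: "((\<lambda>t. Re (y t OutC)) has_real_derivative 1 / 3 / t * Re (y t OutC) - 3 * t * Im g) (at t within {T..})"
    using dRe[of OutC] by (simp add: g_def)
  have dD: "((\<lambda>t. Re (y t OutD)) has_real_derivative 2 / 3 / t * Re (y t OutD) + 3 * t * Im g) (at t within {T..})"
    using dRe[of OutD] by (simp add: g_def)
  have R0': "(R0 has_real_derivative 2 / 3 * kap * t powr (-1/3)) (at t within {T..})"
    unfolding R0_def [abs_def] using t by (auto intro!: derivative_eq_intros)
  have powd: "((\<lambda>t. 2 / 3 * kap * t powr (-1/3)) has_real_derivative - (2 / 9) * kap * t powr (-4/3)) (at t within {T..})"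
    using t by (auto intro!: derivative_eq_intros)
  have id: "((\<lambda>t. t) has_real_derivative 1) (at t within {T..})" by (rule DERIV_ident)
  show "((\<lambda>t. of_real (R0 t) + rho (y t)) has_vector_derivative Rvel y t) (at t within {T..})"
    unfolding has_vector_derivative_complex_iff
  proof (intro conjI)
    show "((\<lambda>t. Re (of_real (R0 t) + rho (y t))) has_real_derivative Re (Rvel y t)) (at t within {T..})"
      using DERIV_add[OF R0' DERIV_add[OF dA dB]] t by (simp add: rho_def Rvel_def add_divide_distrib diff_divide_distrib)
    show "((\<lambda>t. Im (of_real (R0 t) + rho (y t))) has_real_derivative Im (Rvel y t)) (at t within {T..})"
      using DERIV_add[OF dC dD] t by (simp add: rho_def Rvel_def add_divide_distrib)
  qed
  have t0: "t \<noteq> 0" using t by simp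
  have out: "- of_real (mtot / mass_in) * (\<Sum>j<n. of_real (m j) * kern (of_real (R0 t) + rho (y t) - pos t (y t) j))
    = g - of_real mtot * ((1 + kern_lin (rho (y t) / of_real (R0 t))) / of_real ((R0 t)\<^sup>2))"
  proof -
    let ?c = "(1 + kern_lin (rho (y t) / of_real (R0 t))) / of_real ((R0 t)\<^sup>2)"
    have "(\<Sum>j<n. of_real (m j) * (kern (of_real (R0 t) + rho (y t) - pos t (y t) j) - ?c))
      = (\<Sum>j<n. of_real (m j) * kern (of_real (R0 t) + rho (y t) - pos t (y t) j)) - of_real mass_in * ?c"
      by (simp add: right_diff_distrib sum_subtractf sum_distrib_right mass_in_def del: times_divide_eq_right)
    then show ?thesis unfolding g_def outer_def using mass_in(2) by (simp add: right_diff_distrib)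
  qed
  have R0p: "0 < R0 t" using kap(1) t by (simp add: R0_def)
  have c3: "mtot / R0 t ^ 3 = 2 / 9 / t\<^sup>2"
    using kap(4)[OF t] t by (simp add: powr_minus_divide)
  have c2: "mtot / (R0 t)\<^sup>2 = 2 / 9 * kap * t powr (-4/3)"
  proof -
    have "mtot / (R0 t)\<^sup>2 = mtot / R0 t ^ 3 * R0 t" using R0p by (simp add: power2_eq_square power3_eq_cube)
    also have "\<dots> = 2 / 9 * kap * (t powr (-2) * t powr (2/3))" unfolding kap(4)[OF t] by (simp add: R0_def)
    also have "t powr (-2) * t powr (2/3) = t powr (-4/3)" unfolding powr_add[symmetric] by simp
    finally show ?thesis .
  qed
  have "of_real mtot * ((1 + kern_lin (rho (y t) / of_real (R0 t))) / of_real ((R0 t)\<^sup>2))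
     = of_real (mtot / (R0 t)\<^sup>2) + of_real (mtot / R0 t ^ 3) * kern_lin (rho (y t))"
  proof -
    have "kern_lin (rho (y t) / of_real (R0 t)) = kern_lin (rho (y t)) / of_real (R0 t)"
      by (simp add: kern_lin_def diff_divide_distrib)
    then show ?thesis by (simp add: distrib_left add_divide_distrib power2_eq_square power3_eq_cube mult_ac)
  qed
  also have "\<dots> = Complex (2 / 9 * kap * t powr (-4/3) - 4 / 9 * Re (rho (y t)) / t\<^sup>2) (2 / 9 * Im (rho (y t)) / t\<^sup>2)"
    unfolding c2 c3 by (simp add: complex_eq_iff kern_lin_def)
  finally have lin: "- of_real (mtot / mass_in) * (\<Sum>j<n. of_real (m j) * kern (of_real (R0 t) + rho (y t) - pos t (y t) j))
     = g - Complex (2 / 9 * kap * t powr (-4/3) - 4 / 9 * Re (rho (y t)) / t\<^sup>2) (2 / 9 * Im (rho (y t)) / t\<^sup>2)"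
    unfolding out by simp
  show "((\<lambda>t. Rvel y t) has_vector_derivative
     - of_real (mtot / mass_in) * (\<Sum>j<n. of_real (m j) * kern (of_real (R0 t) + rho (y t) - pos t (y t) j))) (at t within {T..})"
    unfolding lin has_vector_derivative_complex_iff
  proof (intro conjI)
    let ?a = "Re (y t OutA)" and ?b = "Re (y t OutB)" and ?c = "Re (y t OutC)" and ?d = "Re (y t OutD)"
    have 1: "((\<lambda>t. 2 / 3 * kap * t powr (-1/3) + (4 / 3 * Re (y t OutA) - 1 / 3 * Re (y t OutB)) / t) has_real_derivative
       - (2 / 9) * kap * t powr (-4/3) + ((4 / 3 * (4 / 3 / t * ?a + 3 / 5 * t * Re g) - 1 / 3 * (- 1 / 3 / t * ?b - 3 / 5 * t * Re g)) * t - (4 / 3 * ?a - 1 / 3 * ?b) * 1) / (t * t)) (at t within {T..})"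
      by (intro DERIV_add powd DERIV_divide DERIV_diff DERIV_cmult dA dB id t0)
    have 2: "((4 / 3 * (4 / 3 / t * ?a + 3 / 5 * t * Re g) - 1 / 3 * (- 1 / 3 / t * ?b - 3 / 5 * t * Re g)) * t - (4 / 3 * ?a - 1 / 3 * ?b) * 1) / (t * t)
       = Re g + 4 / 9 * (?a + ?b) / t\<^sup>2"
      using t0 by (simp add: field_simps power2_eq_square)
    show "((\<lambda>t. Re (Rvel y t)) has_real_derivative
       Re (g - Complex (2 / 9 * kap * t powr (-4/3) - 4 / 9 * Re (rho (y t)) / t\<^sup>2) (2 / 9 * Im (rho (y t)) / t\<^sup>2))) (at t within {T..})"
    proof -
      have "- (2 / 9) * kap * t powr (-4/3) + (Re g + 4 / 9 * (?a + ?b) / t\<^sup>2)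
        = Re (g - Complex (2 / 9 * kap * t powr (-4/3) - 4 / 9 * Re (rho (y t)) / t\<^sup>2) (2 / 9 * Im (rho (y t)) / t\<^sup>2))"
        by (simp add: rho_def)
      from 1[unfolded 2 this] show ?thesis unfolding Rvel_def complex.sel .
    qed
    have 3: "((\<lambda>t. (1 / 3 * Re (y t OutC) + 2 / 3 * Re (y t OutD)) / t) has_real_derivative
       ((1 / 3 * (1 / 3 / t * ?c - 3 * t * Im g) + 2 / 3 * (2 / 3 / t * ?d + 3 * t * Im g)) * t - (1 / 3 * ?c + 2 / 3 * ?d) * 1) / (t * t)) (at t within {T..})"
      by (intro DERIV_divide DERIV_add DERIV_cmult dC dD id t0)
    have 4: "((1 / 3 * (1 / 3 / t * ?c - 3 * t * Im g) + 2 / 3 * (2 / 3 / t * ?d + 3 * t * Im g)) * t - (1 / 3 * ?c + 2 / 3 * ?d) * 1) / (t * t)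
       = Im g - 2 / 9 * (?c + ?d) / t\<^sup>2"
      using t0 by (simp add: field_simps power2_eq_square)
    show "((\<lambda>t. Im (Rvel y t)) has_real_derivative
       Im (g - Complex (2 / 9 * kap * t powr (-4/3) - 4 / 9 * Re (rho (y t)) / t\<^sup>2) (2 / 9 * Im (rho (y t)) / t\<^sup>2))) (at t within {T..})"
    proof -
      have "Im g - 2 / 9 * (?c + ?d) / t\<^sup>2
        = Im (g - Complex (2 / 9 * kap * t powr (-4/3) - 4 / 9 * Re (rho (y t)) / t\<^sup>2) (2 / 9 * Im (rho (y t)) / t\<^sup>2))"
        by (simp add: rho_def)
      from 3[unfolded 4 this] show ?thesis unfolding Rvel_def complex.sel .
    qed
  qed
qed

end

end

section \<open>The motion in the real plane, starting at time 0\<close>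

definition plane :: "complex \<Rightarrow> real^2" where
  "plane z = (\<chi> i. if i = 1 then Re z else Im z)"

lemma plane_linear: "plane (u - v) = plane u - plane v" "plane (u + v) = plane u + plane v"
  "plane (r *\<^sub>R u) = r *\<^sub>R plane u" "plane 0 = 0"
  by (simp_all add: plane_def vec_eq_iff)

lemma norm_plane: "norm (plane z) = norm z"
  by (simp add: plane_def norm_vec_def L2_set_def sum_2 cmod_def)

lemma bounded_linear_plane: "bounded_linear plane"
  by (rule bounded_linear_intro[where K = 1]) (simp_all add: plane_linear norm_plane)

lemma plane_eq_iff: "plane u = plane v \<longleftrightarrow> u = v"
  using norm_plane[of "u - v"] by (auto simp: plane_linear)

lemma plane_sum: "plane (sum f A) = (\<Sum>i\<in>A. plane (f i))"
  by (rule linear_sum) (rule bounded_linear.linear[OF bounded_linear_plane])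

text \<open>The force does not depend on time, so a solution on \<open>[T, oo)\<close> may be moved
  to start at 0, with its one-sided derivative there.\<close>

lemma shift_derivative:
  assumes "(f has_vector_derivative f') (at (t + T) within {T..})"
  shows "((\<lambda>t. f (t + T)) has_vector_derivative f') (at t within {0..})"
proof -
  have g: "((\<lambda>t. t + T) has_vector_derivative 1) (at t within {0..})"
    by (auto intro!: derivative_eq_intros)
  have "(\<lambda>t. t + T) ` {0..} \<subseteq> {T..}" by auto
  then have "(f has_vector_derivative f') (at (t + T) within (\<lambda>t. t + T) ` {0..})"
    using assms has_vector_derivative_within_subset by blast
  from vector_diff_chain_within[OF g this] show ?thesis by (simp add: o_def)
qed

context planar_problem
begin

lemma parabolic_bounded_motion_exists:
  assumes mass: "m n = mn"
  shows "\<exists>q. parabolic_bounded_motion n m q"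
proof -
  obtain y where ball: "\<And>t. T \<le> t \<Longrightarrow> inball t (y t)"
    and dy: "\<And>t k. T \<le> t \<Longrightarrow> ((\<lambda>t. y t k) has_vector_derivative (rate k + of_real (pw k / t)) * y t k + field t (y t) k) (at t within {T..})"
    using solution_exists by blast
  have tiny: "\<exists>b. tiny (y t) b" if "T \<le> t" for t using in_range(1)[OF that ball[OF that]] by blast
  have wide: "wide t (y t) (60 * H)" if "T \<le> t" for t by (rule in_range(2)[OF that ball[OF that]])
  have pos: "0 < t" if "T \<le> t" for t using that T1 by simp
  have M: "0 < mass_in" "0 < mtot" "mtot = mass_in + mn" using mass_in by (auto simp: mtot_def)
  define Q where "Q i t = pos t (y t) i" for i t
  define R where "R t = of_real (R0 t) + rho (y t)" for t
  define Fo where "Fo t = (\<Sum>j<n. of_real (m j) * kern (R t - Q j t))" for t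
  have dQ: "(Q i has_vector_derivative vel y t i) (at t within {T..})" if "T \<le> t" "i < n" for t i
    using pos_derivative[OF pos[OF that(1)] dy[OF that(1)] tiny[OF that(1)] that(2)] by (simp add: Q_def [abs_def])
  have dV: "((\<lambda>t. vel y t i) has_vector_derivative
     (\<Sum>j<n. of_real (m j) * kern (Q j t - Q i t)) + of_real mn * kern (R t - Q i t) - of_real (mn / mass_in) * Fo t) (at t within {T..})"
    if "T \<le> t" "i < n" for t i
    using vel_derivative[OF pos[OF that(1)] dy[OF that(1)] tiny[OF that(1)] that(2)] by (simp add: Q_def R_def Fo_def)
  have dR: "(R has_vector_derivative Rvel y t) (at t within {T..})"
    and dS: "((\<lambda>t. Rvel y t) has_vector_derivative - of_real (mtot / mass_in) * Fo t) (at t within {T..})" if "T \<le> t" for t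
    using R_derivative[OF pos[OF that] dy[OF that] tiny[OF that]] by (simp_all add: Q_def R_def [abs_def] Fo_def)
  \<comment> \<open>Positions from the relative vectors \<open>Q\<close> and \<open>R\<close>, with
    the center of mass of all \<open>n + 1\<close> bodies placed at the origin.\<close>
  define qc where "qc i t = (if i < n then Q i t - of_real (mn / mtot) * R t else of_real (mass_in / mtot) * R t)" for i t
  define vc where "vc i t = (if i < n then vel y t i - of_real (mn / mtot) * Rvel y t else of_real (mass_in / mtot) * Rvel y t)" for i t
  define ac where "ac i t = (\<Sum>j\<in>{..n} - {i}. of_real (m j) * kern (qc j t - qc i t))" for i t
  have split: "{..n} = insert n {..<n}" by auto
  have frac: "complex_of_real (mass_in / mtot) + of_real (mn / mtot) = 1"
    using M by (simp add: add_divide_distrib[symmetric] flip: of_real_add)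
  have qd: "qc j t - qc i t = Q j t - Q i t" "qc n t - qc i t = R t - Q i t" if "i < n" "j < n" for i j t
  proof -
    show "qc j t - qc i t = Q j t - Q i t" using that by (simp add: qc_def)
    have "qc n t - qc i t = (of_real (mass_in / mtot) + of_real (mn / mtot)) * R t - Q i t"
      unfolding qc_def using that by (simp add: distrib_right)
    then show "qc n t - qc i t = R t - Q i t" unfolding frac by simp
  qed
  have acc_in: "ac i t = (\<Sum>j<n. of_real (m j) * kern (Q j t - Q i t)) + of_real mn * kern (R t - Q i t)" if i: "i < n" for i t
  proof -
    \<comment> \<open>The term \<open>j = i\<close> may be added because
      \<open>kern 0 = 0\<close>.\<close>
    have "ac i t = (\<Sum>j\<in>{..n}. of_real (m j) * kern (qc j t - qc i t))"
      unfolding ac_def using i by (intro sum.mono_neutral_left) (auto simp: kern_def)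
    also have "\<dots> = of_real mn * kern (qc n t - qc i t) + (\<Sum>j<n. of_real (m j) * kern (qc j t - qc i t))"
      unfolding split using mass by simp
    also have "(\<Sum>j<n. of_real (m j) * kern (qc j t - qc i t)) = (\<Sum>j<n. of_real (m j) * kern (Q j t - Q i t))"
      by (rule sum.cong) (simp_all add: qd(1)[OF i])
    finally show ?thesis unfolding qd(2)[OF i i] by simp
  qed
  have acc_out: "ac n t = - Fo t" for t
  proof -
    have "{..n} - {n} = {..<n}" by auto
    then have "ac n t = (\<Sum>j<n. - (of_real (m j) * kern (R t - Q j t)))"
      unfolding ac_def
    proof (simp only:, intro sum.cong refl)
      fix j assume "j \<in> {..<n}"
      then have "qc j t - qc n t = - (R t - Q j t)" using qd(2)[of j j t] by (simp add: algebra_simps)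
      then show "of_real (m j) * kern (qc j t - qc n t) = - (of_real (m j) * kern (R t - Q j t))"
        by (simp only: kern_minus mult_minus_right)
    qed
    then show ?thesis by (simp add: Fo_def sum_negf)
  qed
  have c1: "complex_of_real (mn / mtot) * (of_real (mtot / mass_in) * Fo t) = of_real (mn / mass_in) * Fo t"
    and c2: "complex_of_real (mass_in / mtot) * (of_real (mtot / mass_in) * Fo t) = Fo t" for t
  proof -
    have f: "mn / mtot * (mtot / mass_in) = mn / mass_in" "mass_in / mtot * (mtot / mass_in) = 1"
      using M(1,2) by simp_all
    show "complex_of_real (mn / mtot) * (of_real (mtot / mass_in) * Fo t) = of_real (mn / mass_in) * Fo t"
      "complex_of_real (mass_in / mtot) * (of_real (mtot / mass_in) * Fo t) = Fo t"
      unfolding mult.assoc[symmetric] of_real_mult[symmetric] f by simp_all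
  qed
  have dq: "((\<lambda>t. qc i t) has_vector_derivative vc i t) (at t within {T..})"
    and dv: "((\<lambda>t. vc i t) has_vector_derivative ac i t) (at t within {T..})" if t: "T \<le> t" and i: "i \<le> n" for i t
  proof -
    show "((\<lambda>t. qc i t) has_vector_derivative vc i t) (at t within {T..})"
    proof (cases "i < n")
      case True
      show ?thesis unfolding qc_def vc_def using True
        has_vector_derivative_diff[OF dQ[OF t True] has_vector_derivative_mult_right[OF dR[OF t], of "of_real (mn / mtot)"]] by simp
    next
      case False
      then show ?thesis unfolding qc_def vc_def
        using has_vector_derivative_mult_right[OF dR[OF t], of "of_real (mass_in / mtot)"] by simp
    qed
    show "((\<lambda>t. vc i t) has_vector_derivative ac i t) (at t within {T..})"
    proof (cases "i < n")
      case True
      have e: "(\<Sum>j<n. of_real (m j) * kern (Q j t - Q i t)) + of_real mn * kern (R t - Q i t) - of_real (mn / mass_in) * Fo t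
        - of_real (mn / mtot) * (- of_real (mtot / mass_in) * Fo t) = ac i t"
        unfolding acc_in[OF True] using c1[of t] by simp
      have f: "vc i = (\<lambda>t. vel y t i - of_real (mn / mtot) * Rvel y t)" using True by (auto simp: vc_def)
      show ?thesis unfolding f
        using has_vector_derivative_diff[OF dV[OF t True] has_vector_derivative_mult_right[OF dS[OF t], of "of_real (mn / mtot)"]]
        unfolding e .
    next
      case False
      with i have i: "i = n" by simp
      have e: "of_real (mass_in / mtot) * (- of_real (mtot / mass_in) * Fo t) = ac i t"
        unfolding i acc_out using c2[of t] by simp
      have f: "vc i = (\<lambda>t. of_real (mass_in / mtot) * Rvel y t)" using False by (auto simp: vc_def)
      show ?thesis unfolding f
        using has_vector_derivative_mult_right[OF dS[OF t], of "of_real (mass_in / mtot)"] unfolding e .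
    qed
  qed
  define q where "q i t = plane (qc i (t + T))" for i t
  define v where "v i t = plane (vc i (t + T))" for i t
  define a where "a i t = plane (ac i (t + T))" for i t
  have distinct: "qc i t \<noteq> qc j t" if t: "T \<le> t" and ij: "i \<le> n" "j \<le> n" "i \<noteq> j" for i j t
  proof -
    obtain b where b: "tiny (y t) b" using tiny[OF t] by blast
    have inner: "Q i t \<noteq> Q j t" if "i < n" "j < n" "i \<noteq> j" for i j
    proof -
      have "Q j t - Q i t = ph t (y t) * (zeta (y t) j - zeta (y t) i)" by (simp add: Q_def pos_def right_diff_distrib)
      moreover have "ph t (y t) \<noteq> 0" using norm_ph[of t "y t"] by force
      ultimately show ?thesis using zeta_distinct[OF b that] by auto
    qed
    have outer: "R t - Q i t \<noteq> 0" if "i < n" for i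
      using outer_distinct(1)[OF wide[OF t] b that] by (simp add: R_def Q_def)
    consider "i < n" "j < n" | "i < n" "j = n" | "i = n" "j < n" using ij by linarith
    then show ?thesis
    proof cases
      case 1
      then show ?thesis using inner[OF 1 ij(3)] qd(1)[OF 1, of t] by auto
    next
      case 2
      then show ?thesis using outer[of i] qd(2)[of i i t] by auto
    next
      case 3
      then show ?thesis using outer[of j] qd(2)[of j j t] by auto
    qed
  qed
  have sol: "nbody_solution n m q"
    unfolding nbody_solution_def
  proof (rule conjI[OF _ exI[of _ v, OF exI[of _ a]]]; intro allI impI conjI)
    fix t :: real and i j :: nat assume "0 \<le> t" "i \<le> n" "j \<le> n" "i \<noteq> j"
    then show "q i t \<noteq> q j t" unfolding q_def plane_eq_iff by (intro distinct) auto
  next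
    fix t :: real and i :: nat assume t: "0 \<le> t" and i: "i \<le> n"
    then have tT: "T \<le> t + T" by simp
    show "(q i has_vector_derivative v i t) (at t within {0..})"
      unfolding q_def [abs_def] v_def
      by (rule bounded_linear.has_vector_derivative[OF bounded_linear_plane shift_derivative[OF dq[OF tT i]]])
    show "(v i has_vector_derivative a i t) (at t within {0..})"
      unfolding v_def [abs_def] a_def
      by (rule bounded_linear.has_vector_derivative[OF bounded_linear_plane shift_derivative[OF dv[OF tT i]]])
    have "m i *\<^sub>R a i t = (\<Sum>j\<in>{..n} - {i}. m i *\<^sub>R plane (of_real (m j) * kern (qc j (t + T) - qc i (t + T))))"
      unfolding a_def ac_def plane_sum by (rule scaleR_sum_right)
    also have "\<dots> = gravitational_force n m (\<lambda>j. q j t) i"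
      unfolding gravitational_force_def
    proof (rule sum.cong[OF refl])
      fix j
      have "of_real (m j) * kern (qc j (t + T) - qc i (t + T))
        = (m j / norm (qc j (t + T) - qc i (t + T)) ^ 3) *\<^sub>R (qc j (t + T) - qc i (t + T))"
        by (simp add: kern_def scaleR_conv_of_real divide_inverse)
      then show "m i *\<^sub>R plane (of_real (m j) * kern (qc j (t + T) - qc i (t + T)))
        = (m i * m j / norm (q j t - q i t) ^ 3) *\<^sub>R (q j t - q i t)"
        unfolding q_def plane_linear(1)[symmetric] norm_plane by (simp only: plane_linear(3)) simp
    qed
    finally show "m i *\<^sub>R a i t = gravitational_force n m (\<lambda>j. q j t) i" .
  qed
  have com: "center_of_mass n m q t = plane (- of_real (mn / mtot) * R (t + T))" if "0 \<le> t" for t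
  proof -
    have "(\<Sum>i<n. of_real (m i) * qc i (t + T)) = (\<Sum>i<n. of_real (m i) * Q i (t + T)) - of_real mass_in * (of_real (mn / mtot) * R (t + T))"
    proof -
      define W where "W = of_real (mn / mtot) * R (t + T)"
      have "(\<Sum>i<n. of_real (m i) * qc i (t + T)) = (\<Sum>i<n. of_real (m i) * Q i (t + T) - of_real (m i) * W)"
        by (rule sum.cong) (simp_all add: qc_def W_def right_diff_distrib)
      also have "\<dots> = (\<Sum>i<n. of_real (m i) * Q i (t + T)) - (\<Sum>i<n. of_real (m i)) * W"
        by (simp only: sum_subtractf sum_distrib_right)
      also have "(\<Sum>i<n. complex_of_real (m i)) = of_real mass_in" by (simp add: mass_in_def)
      finally show ?thesis unfolding W_def .
    qed
    also have "(\<Sum>i<n. of_real (m i) * Q i (t + T)) = ph (t + T) (y (t + T)) * (\<Sum>i<n. of_real (m i) * zeta (y (t + T)) i)"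
      by (simp add: Q_def pos_def sum_distrib_left mult_ac)
    also have "\<dots> = 0" by (simp add: zeta_centered)
    finally have "(\<Sum>i<n. of_real (m i) * qc i (t + T)) = of_real mass_in * (- of_real (mn / mtot) * R (t + T))" by simp
    then have "(\<Sum>i<n. m i *\<^sub>R q i t) = plane (mass_in *\<^sub>R (- of_real (mn / mtot) * R (t + T)))"
      unfolding q_def plane_linear(3)[symmetric] plane_sum[symmetric] by (simp add: scaleR_conv_of_real)
    then show ?thesis unfolding center_of_mass_def mass_in_def[symmetric] plane_linear(3) using M by simp
  qed
  have rel_out: "q n t - center_of_mass n m q t = plane (R (t + T))" if "0 \<le> t" for t
  proof -
    have "qc n (t + T) - - of_real (mn / mtot) * R (t + T) = (of_real (mass_in / mtot) + of_real (mn / mtot)) * R (t + T)"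
      unfolding qc_def by (simp add: distrib_right)
    then show ?thesis unfolding com[OF that] q_def plane_linear(1)[symmetric] frac by simp
  qed
  have rel_in: "q i t - center_of_mass n m q t = plane (Q i (t + T))" if "0 \<le> t" "i < n" for t i
    unfolding com[OF that(1)] q_def plane_linear(1)[symmetric] using that by (simp add: qc_def)
  have out_bound: "norm (y t l) \<le> 15 * H" if "T \<le> t" "l \<in> {OutA, OutB, OutC, OutD}" for t l
  proof -
    have "norm (y t l) \<le> rad l * t powr wt l" using ball[OF that(1)] by (auto simp: inball_def)
    then show ?thesis using that pos[OF that(1)] by auto
  qed
  have esc: "filterlim (\<lambda>t. norm (q n t - center_of_mass n m q t)) at_top at_top"
  proof (rule filterlim_at_top_mono)
    show "filterlim (\<lambda>t. t powr (2/3) - 60 * H) at_top at_top" by real_asymp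
    show "\<forall>\<^sub>F t in at_top. t powr (2/3) - 60 * H \<le> norm (q n t - center_of_mass n m q t)"
    proof (rule eventually_mono[OF eventually_ge_at_top[of 0]])
      fix t :: real assume t: "0 \<le> t"
      then have tT: "T \<le> t + T" by simp
      have "t powr (2/3) \<le> (t + T) powr (2/3)" using t T1 by (intro powr_mono2) auto
      also have "\<dots> \<le> R0 (t + T)" using t T1 by (intro kap(6)) auto
      finally have 1: "t powr (2/3) \<le> R0 (t + T)" .
      have 2: "norm (rho (y (t + T))) \<le> 60 * H" "0 < R0 (t + T)" using wide[OF tT] by (auto simp: wide_def)
      have "norm (complex_of_real (R0 (t + T))) - norm (- rho (y (t + T))) \<le> norm (of_real (R0 (t + T)) - - rho (y (t + T)))"
        by (rule norm_triangle_ineq2)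
      then have "R0 (t + T) - norm (rho (y (t + T))) \<le> norm (R (t + T))" using 2 by (simp add: R_def)
      then show "t powr (2/3) - 60 * H \<le> norm (q n t - center_of_mass n m q t)"
        unfolding rel_out[OF t] norm_plane using 1 2 by linarith
    qed
  qed
  have vel: "((\<lambda>t. vector_derivative (\<lambda>s. q n s - center_of_mass n m q s) (at t)) \<longlongrightarrow> 0) at_top"
  proof (rule Lim_null_comparison)
    have "((\<lambda>t :: real. t powr (-1/3)) \<longlongrightarrow> 0) at_top" "((\<lambda>t :: real. 1 / t) \<longlongrightarrow> 0) at_top"
      by real_asymp+
    from tendsto_add_zero[OF tendsto_mult_right_zero[OF this(1), of "2 / 3 * kap"] tendsto_mult_right_zero[OF this(2), of "100 * H"]]
    show "((\<lambda>t. 2 / 3 * kap * t powr (-1/3) + 100 * H / t) \<longlongrightarrow> 0) at_top" by simp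
    show "\<forall>\<^sub>F t in at_top. norm (vector_derivative (\<lambda>s. q n s - center_of_mass n m q s) (at t))
      \<le> 2 / 3 * kap * t powr (-1/3) + 100 * H / t"
    proof (rule eventually_mono[OF eventually_gt_at_top[of 0]])
      fix t :: real assume t: "0 < t"
      then have tT: "T \<le> t + T" and t0: "0 \<le> t" and le: "t \<le> t + T" using T1 by auto
      have "((\<lambda>s. plane (R (s + T))) has_vector_derivative plane (Rvel y (t + T))) (at t within {0..})"
        by (rule bounded_linear.has_vector_derivative[OF bounded_linear_plane shift_derivative[OF dR[OF tT]]])
      then have "((\<lambda>s. q n s - center_of_mass n m q s) has_vector_derivative plane (Rvel y (t + T))) (at t within {0..})"
        by (rule has_vector_derivative_transform[rotated 2]) (use t0 rel_out in auto)
      moreover have "at t within {0..} = at t" using t by (intro at_within_interior) (simp add: interior_Ici[of "-1"])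
      ultimately have "vector_derivative (\<lambda>s. q n s - center_of_mass n m q s) (at t) = plane (Rvel y (t + T))"
        by (simp add: vector_derivative_at)
      then have "norm (vector_derivative (\<lambda>s. q n s - center_of_mass n m q s) (at t)) = norm (Rvel y (t + T))"
        by (simp add: norm_plane)
      also have "\<dots> \<le> \<bar>Re (Rvel y (t + T))\<bar> + \<bar>Im (Rvel y (t + T))\<bar>" by (rule cmod_le)
      also have "\<dots> \<le> 2 / 3 * kap * (t + T) powr (-1/3) + 100 * H / (t + T)"
      proof -
        define s where "s = t + T"
        have s: "0 < s" "T \<le> s" using t T1 by (auto simp: s_def)
        have b: "\<bar>Re (y s l)\<bar> \<le> 15 * H" if "l \<in> {OutA, OutB, OutC, OutD}" for l
          using out_bound[OF s(2) that] abs_Re_le_cmod[of "y s l"] by linarith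
        have "\<bar>4 / 3 * Re (y s OutA) - 1 / 3 * Re (y s OutB)\<bar> \<le> 50 * H" using b[of OutA] b[of OutB] H by auto
        then have "\<bar>(4 / 3 * Re (y s OutA) - 1 / 3 * Re (y s OutB)) / s\<bar> \<le> 50 * H / s"
          using s by (simp add: abs_divide divide_right_mono)
        moreover have "\<bar>1 / 3 * Re (y s OutC) + 2 / 3 * Re (y s OutD)\<bar> \<le> 50 * H" using b[of OutC] b[of OutD] H by auto
        then have "\<bar>(1 / 3 * Re (y s OutC) + 2 / 3 * Re (y s OutD)) / s\<bar> \<le> 50 * H / s"
          using s by (simp add: abs_divide divide_right_mono)
        moreover have "0 \<le> 2 / 3 * kap * s powr (-1/3)" using kap(1) by simp
        moreover have "50 * H / s + 50 * H / s = 100 * H / s" by (simp add: add_divide_distrib[symmetric])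
        ultimately show ?thesis unfolding Rvel_def complex.sel s_def[symmetric] by linarith
      qed
      also have "\<dots> \<le> 2 / 3 * kap * t powr (-1/3) + 100 * H / t"
        using t le kap(1) H by (intro add_mono mult_left_mono powr_mono2' divide_left_mono) auto
      finally show "norm (vector_derivative (\<lambda>s. q n s - center_of_mass n m q s) (at t)) \<le> 2 / 3 * kap * t powr (-1/3) + 100 * H / t" .
    qed
  qed
  have bdd: "bounded ((\<lambda>t. q i t - center_of_mass n m q t) ` {0..})" if i: "i < n" for i
    unfolding bounded_iff
  proof (intro exI[of _ "2 * H"] ballI)
    fix z assume "z \<in> (\<lambda>t. q i t - center_of_mass n m q t) ` {0..}"
    then obtain t where t: "0 \<le> t" "z = plane (Q i (t + T))" using rel_in[OF _ i] by auto
    obtain b where "tiny (y (t + T)) b" using tiny[of "t + T"] t by auto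
    then show "norm z \<le> 2 * H" unfolding t(2) norm_plane Q_def norm_pos using i by (rule zeta_bound)
  qed
  show ?thesis
    unfolding parabolic_bounded_motion_def using sol esc vel bdd by blast
qed

end

text \<open>Mass vectors are extensional functions on \<open>{..n}\<close>, and the product topology
  is taken over these labels, so openness concerns exactly the \<open>n + 1\<close> masses. A box
  suffices, because the bound on the escaping mass is the same for all inner masses in
  \<open>(1, 2)\<close>.\<close>

theorem claim1p1:
  fixes n :: nat
  assumes "n \<ge> 2"
  shows "\<exists>U :: (nat \<Rightarrow> real) set.
           U \<noteq> {} \<and>
           openin (product_topology (\<lambda>_. euclideanreal) {..n}) U \<and>
           U \<subseteq> (\<Pi>\<^sub>E i\<in>{..n}. {0<..}) \<and>
           (\<forall>m\<in>U. \<exists>q. parabolic_bounded_motion n m q)"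
proof -
  define H where "H = spectral_bound n"
  have H2: "2 \<le> H"
  proof -
    have "1 ^ 9 \<le> config_bound n ^ 9" using config_bound_ge[OF assms] by (intro power_mono) auto
    moreover have "1 \<le> (real n)\<^sup>2" using assms by (simp add: one_le_power)
    ultimately have "256 * 1 * 1 \<le> H" unfolding H_def spectral_bound_def
      using config_bound_ge[OF assms] by (intro mult_mono) auto
    then show ?thesis by simp
  qed
  \<comment> \<open>The values of \<open>KS\<close>, \<open>ru\<close>, \<open>Bu\<close> and
    \<open>Bo\<close> in terms of \<open>n\<close>: the set of masses has to be fixed before a
    configuration is available.\<close>
  define K where "K = 100000 * real n ^ 4 * H ^ 6"
  define r where "r = 1 / (2400 * K * H ^ 4)"
  define B where "B = 1 / (2880 * H ^ 4)"
  define C where "C = 4848 * (2 * H + real n)"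
  \<comment> \<open>The two smallness conditions on the escaping mass, solved for it.\<close>
  define \<epsilon> where "\<epsilon> = min (r / (2 * K)) (B / (5 * (K * (2 + 4 * C))))"
  have p: "0 < K" "0 < r" "0 < B" "0 < C"
    using assms H2 by (auto simp: K_def r_def B_def C_def intro!: mult_pos_pos divide_pos_pos add_pos_pos)
  have \<epsilon>: "0 < \<epsilon>" using p by (simp add: \<epsilon>_def)
  define U where "U = PiE {..n} (\<lambda>i. if i < n then {1<..<2} else {0<..<\<epsilon>})"
  have "(\<lambda>i\<in>{..n}. if i < n then 3 / 2 else \<epsilon> / 2) \<in> U" using \<epsilon> by (auto simp: U_def)
  then have "U \<noteq> {}" by blast
  moreover have "openin (product_topology (\<lambda>_. euclideanreal) {..n}) U"
    unfolding U_def by (subst openin_PiE) auto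
  moreover have "U \<subseteq> (\<Pi>\<^sub>E i\<in>{..n}. {0<..})"
    unfolding U_def by (rule PiE_mono) auto
  moreover have "\<exists>q. parabolic_bounded_motion n m q" if m: "m \<in> U" for m
  proof -
    have mU: "m i \<in> (if i < n then {1<..<2} else {0<..<\<epsilon>})" if "i \<le> n" for i
      by (rule PiE_mem[OF m[unfolded U_def]]) (use that in simp)
    have mi: "1 < m i" "m i < 2" if "i < n" for i using mU[of i] that by simp_all
    have mm: "0 < m n" "m n < \<epsilon>" using mU[of n] by simp_all
    have "\<forall>i<n. 1 \<le> m i" "\<forall>i<n. m i \<le> 2" using mi by (auto intro: less_imp_le)
    from collinear_spectral_data[OF assms this, folded H_def]
    show ?thesis
    proof (elim exE conjE)
      fix x e mu
      assume sys: "eigensystem n m x n e mu" and x: "\<forall>i<n. \<bar>x i\<bar> \<le> H"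
        "\<forall>i<n. \<forall>j<n. i \<noteq> j \<longrightarrow> 1 / H \<le> \<bar>x i - x j\<bar>" "\<forall>i<n. lap n m x x i = x i"
        "\<forall>i<n. e 0 i = 1 / sqrt (\<Sum>j<n. m j)" "\<forall>i<n. x i = sqrt (wip n m x x) * e 1 i" "mu 1 = 1"
        "1 / H \<le> sqrt (wip n m x x)" "\<forall>k. 2 \<le> k \<longrightarrow> k < n \<longrightarrow> 1 + 1 / H \<le> mu k \<and> mu k \<le> H"
      interpret D: planar_data n m x e mu H "m n"
      proof
        show "2 \<le> n" "0 < m n" "2 \<le> H" "eigensystem n m x n e mu" "mu 1 = 1" "1 / H \<le> sqrt (wip n m x x)"
          by (fact assms mm H2 sys x)+
        show "1 \<le> m i" "m i \<le> 2" if "i < n" for i using mi[OF that] by simp_all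
        show "\<bar>x i\<bar> \<le> H" if "i < n" for i using x(1) that by blast
        show "1 / H \<le> \<bar>x i - x j\<bar>" if "i < n" "j < n" "i \<noteq> j" for i j using x(2) that by blast
        show "lap n m x x i = x i" if "i < n" for i using x(3) that by blast
        show "e 0 i = 1 / sqrt (\<Sum>j<n. m j)" if "i < n" for i using x(4) that by blast
        show "x i = sqrt (wip n m x x) * e 1 i" if "i < n" for i using x(5) that by blast
        show "1 + 1 / H \<le> mu k" "mu k \<le> H" if "2 \<le> k" "k < n" for k using x(8) that by blast+
      qed
      \<comment> \<open>The exponent \<open>3/2\<close> inverts the growth \<open>t^(2/3)\<close> of
        the parabolic orbit.\<close>
      define T where "T = max 1 ((10000000 * H\<^sup>2) powr (3/2))"
      have c: "D.KS = K" "D.ru = r" "D.Bu = B" "D.Bo = C"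
        by (simp_all add: D.KS_def K_def D.ru_def r_def D.Bu_def B_def D.Bo_def C_def)
      interpret planar_problem n m x e mu H "m n" T
      proof
        show "1 \<le> T" by (simp add: T_def)
        have "10000000 * H\<^sup>2 = ((10000000 * H\<^sup>2) powr (3/2)) powr (2/3)" using H2 by (simp add: powr_powr)
        also have "\<dots> \<le> T powr (2/3)" unfolding T_def by (intro powr_mono2) auto
        finally show "10000000 * H\<^sup>2 \<le> T powr (2/3)" .
        have "m n \<le> r / (2 * K)" "m n \<le> B / (5 * (K * (2 + 4 * C)))" using mm by (auto simp: \<epsilon>_def)
        then show "D.KS * m n \<le> D.ru / 2" "D.KS * m n * (2 + 4 * D.Bo) \<le> D.Bu / 5"
          unfolding c using p by (simp_all add: pos_le_divide_eq mult_ac)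
      qed
      show "\<exists>q. parabolic_bounded_motion n m q" by (rule parabolic_bounded_motion_exists) simp
    qed
  qed
  ultimately show ?thesis by blast
qed

end
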